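(* Fix $\mu\in(-1,1)$ and let $\xi$ be such that $u^\xi\in\mathcal M_\mu$. Let $v\in H^1(0,1)$ with $\int_0^1v\,dx=0$ and $\langle v,u^\xi_i\rangle=0$ for $i=1,\dots,N$. Then $$\langle\mathcal L^\xi v,v\rangle\le\big(-\lambda_0\varepsilon+\mathcal O(\exp)\big)\|v\|^2 .$$
   Context: $0<\varepsilon\ll1$; $f(u)=u^3-u$; $\langle\cdot,\cdot\rangle$, $\|\cdot\|$ inner product and norm of $L^2(0,1)$. $U(x)=\tanh(x/\sqrt2)$; $U(x;\xi,\pm1)=\pm U((x-\xi)/\varepsilon)$. Fix an integer $N\ge1$, small $\kappa_0>0$, $\rho_\varepsilon=\varepsilon^{\kappa_0}$. $\Omega_{\rho_\varepsilon}=\{h\in\mathbb R^{N+1}:0<h_1<\dots<h_{N+1}<1,\ \min_{j=0,\dots,N+1}|h_{j+1}-h_j|>\varepsilon/\rho_\varepsilon\}$ with $h_0=-h_1$, $h_{N+2}=2-h_{N+1}$. For $h\in\Omega_{\rho_\varepsilon}$, $u^h=\sum_{j=1}^{N+1}U(\cdot;h_j,(-1)^{j+1})+\beta_N$, where $\beta_N=\frac{(-1)^N-1}{2}+\mathcal O(\exp)$ (also for derivatives) is a correction making $u^h(0)=-1$ and $u^h$ satisfy Neumann boundary conditions; $\mathcal O(\exp)$ means exponentially small in $\varepsilon$. $\mathcal M=\{u^h:h\in\Omega_{\rho_\varepsilon}\}$ and $\mathcal M_\mu=\{u^h\in\mathcal M:\int_0^1u^h=\mu\}$. There is a smooth map $h_{N+1}:[0,1]^N\to\mathbb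 R$ such that $u^h\in\mathcal M_\mu$ iff $h=(\xi,h_{N+1}(\xi))\in\Omega_{\rho_\varepsilon}$ with $\xi=(h_1,\dots,h_N)$; write $u^\xi=u^{(\xi,h_{N+1}(\xi))}$ and $u^\xi_i=\partial_{\xi_i}u^\xi$. $\mathcal L^\xi v=\varepsilon^2v_{xx}-f'(u^\xi)v$. $\lambda_0>0$ is a constant such that every $w\in H^1(\mathbb R)$ with $w(0)=0$ or $\int_{\mathbb R}wU'=0$ satisfies $\int_{\mathbb R}(-w'^2-f'(U)w^2)\le-\lambda_0\|w\|^2_{L^2(\mathbb R)}$. *)

theory Defs
  imports "HOL-Analysis.Analysis"
begin

definition f :: "real \<Rightarrow> real" where "f u = u ^ 3 - u"
definition f' :: "real \<Rightarrow> real" where "f' u = 3 * u ^ 2 - 1"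

definition U :: "real \<Rightarrow> real" where "U x = tanh (x / sqrt 2)"

definition rho :: "real \<Rightarrow> real \<Rightarrow> real" where "rho \<kappa>0 \<epsilon> = \<epsilon> powr \<kappa>0"

definition expsmall :: "real \<Rightarrow> real \<Rightarrow> real \<Rightarrow> real \<Rightarrow> real" where
  "expsmall \<kappa>0 \<epsilon> K k = K * exp (- k / rho \<kappa>0 \<epsilon>)"

definition ip :: "(real \<Rightarrow> real) \<Rightarrow> (real \<Rightarrow> real) \<Rightarrow> real" where
  "ip v w = (LINT x:{0..1}|lborel. v x * w x)"
definition nsq :: "(real \<Rightarrow> real) \<Rightarrow> real" where "nsq v = ip v v"

text \<open>Layer positions h = [h_1,...,h_(N+1)] are lists (0-indexed).
  Extended sequence: index 0 gives h_0 = -h_1, index j (1..N+1) gives h_j,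
  index N+2 gives 2 - h_(N+1).\<close>
definition hext :: "real list \<Rightarrow> nat \<Rightarrow> real" where
  "hext h j = (if j = 0 then - (h ! 0) else if j \<le> length h then h ! (j - 1) else 2 - last h)"

definition Omega :: "nat \<Rightarrow> real \<Rightarrow> real \<Rightarrow> real list \<Rightarrow> bool" where
  "Omega N \<kappa>0 \<epsilon> h \<longleftrightarrow> length h = N + 1 \<and> 0 < h ! 0 \<and> last h < 1 \<and>
     (\<forall>j<N. h ! j < h ! (j + 1)) \<and>
     (\<forall>j\<le>N + 1. \<bar>hext h (j + 1) - hext h j\<bar> > \<epsilon> / rho \<kappa>0 \<epsilon>)"

definition bN :: "nat \<Rightarrow> real" where "bN N = ((-1) ^ N - 1) / 2"

definition uh :: "real \<Rightarrow> (real list \<Rightarrow> real \<Rightarrow> real) \<Rightarrow> real list \<Rightarrow> real \<Rightarrow> real" where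
  "uh \<epsilon> \<beta> h x = (\<Sum>j<length h. (-1) ^ j * U ((x - h ! j) / \<epsilon>)) + \<beta> h x"

definition mass :: "real \<Rightarrow> (real list \<Rightarrow> real \<Rightarrow> real) \<Rightarrow> real list \<Rightarrow> real" where
  "mass \<epsilon> \<beta> h = (LINT x:{0..1}|lborel. uh \<epsilon> \<beta> h x)"

text \<open>Admissible correction beta_N (for a fixed eps), with O(exp) constants K, k:
  u^h(0) = -1, Neumann conditions, beta_N = ((-1)^N-1)/2 + O(exp), and the
  x-derivative and h-derivatives of beta_N are O(exp). The h-derivative is
  expressed along arbitrary differentiable curves in h-space (chain-rule form
  of C^1 dependence on h with gradient O(exp)).\<close>
definition beta_ok ::
  "nat \<Rightarrow> real \<Rightarrow> real \<Rightarrow> real \<Rightarrow> real \<Rightarrow> (real list \<Rightarrow> real \<Rightarrow> real) \<Rightarrow> bool" where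
  "beta_ok N \<kappa>0 K k \<epsilon> \<beta> \<longleftrightarrow>
    (\<forall>h. Omega N \<kappa>0 \<epsilon> h \<longrightarrow>
       (\<forall>x. (\<beta> h) differentiable (at x)) \<and>
       uh \<epsilon> \<beta> h 0 = -1 \<and>
       deriv (uh \<epsilon> \<beta> h) 0 = 0 \<and> deriv (uh \<epsilon> \<beta> h) 1 = 0 \<and>
       (\<forall>x\<in>{0..1}. \<bar>\<beta> h x - bN N\<bar> \<le> expsmall \<kappa>0 \<epsilon> K k) \<and>
       (\<forall>x\<in>{0..1}. \<bar>deriv (\<beta> h) x\<bar> \<le> expsmall \<kappa>0 \<epsilon> K k) \<and>
       (\<forall>x\<in>{0..1}. \<forall>(\<gamma> :: real \<Rightarrow> real list) (d :: nat \<Rightarrow> real).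
          (\<forall>t. length (\<gamma> t) = N + 1) \<and> \<gamma> 0 = h \<and>
          (\<forall>j<N + 1. ((\<lambda>t. \<gamma> t ! j) has_real_derivative d j) (at 0)) \<longrightarrow>
          (\<exists>D. ((\<lambda>t. \<beta> (\<gamma> t) x) has_real_derivative D) (at 0) \<and>
               \<bar>D\<bar> \<le> expsmall \<kappa>0 \<epsilon> K k * (\<Sum>j<N + 1. \<bar>d j\<bar>))))"

definition mass_map ::
  "nat \<Rightarrow> real \<Rightarrow> real \<Rightarrow> real \<Rightarrow> (real list \<Rightarrow> real \<Rightarrow> real) \<Rightarrow> (real list \<Rightarrow> real) \<Rightarrow> bool" where
  "mass_map N \<kappa>0 \<mu> \<epsilon> \<beta> H \<longleftrightarrow>
    (\<forall>h. Omega N \<kappa>0 \<epsilon> h \<longrightarrow> (mass \<epsilon> \<beta> h = \<mu> \<longleftrightarrow> last h = H (butlast h))) \<and>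
    (\<forall>\<xi>. length \<xi> = N \<and> (\<forall>j<N. 0 < \<xi> ! j \<and> \<xi> ! j < 1) \<longrightarrow>
       (\<forall>i<N. (\<lambda>t. H (\<xi>[i := \<xi> ! i + t])) differentiable (at 0)))"

definition uxi :: "real \<Rightarrow> (real list \<Rightarrow> real \<Rightarrow> real) \<Rightarrow> (real list \<Rightarrow> real) \<Rightarrow> real list \<Rightarrow> real \<Rightarrow> real" where
  "uxi \<epsilon> \<beta> H \<xi> = uh \<epsilon> \<beta> (\<xi> @ [H \<xi>])"

definition uxi_d :: "real \<Rightarrow> (real list \<Rightarrow> real \<Rightarrow> real) \<Rightarrow> (real list \<Rightarrow> real) \<Rightarrow> real list \<Rightarrow> nat \<Rightarrow> real \<Rightarrow> real" where
  "uxi_d \<epsilon> \<beta> H \<xi> i x = deriv (\<lambda>t. uxi \<epsilon> \<beta> H (\<xi>[i := \<xi> ! i + t]) x) 0"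

text \<open>H^1(0,1): v(x) = v(0) + int_0^x g with g \<in> L^2(0,1) (g the weak derivative).\<close>
definition H1 :: "(real \<Rightarrow> real) \<Rightarrow> (real \<Rightarrow> real) \<Rightarrow> bool" where
  "H1 v g \<longleftrightarrow> set_integrable lborel {0..1} g \<and> set_integrable lborel {0..1} (\<lambda>x. (g x)\<^sup>2) \<and>
     (\<forall>x\<in>{0..1}. v x = v 0 + (LINT t:{0..x}|lborel. g t))"

text \<open>The quadratic form <L^xi v, v> = -eps^2 ||v_x||^2 - <f'(u^xi) v, v>
  (integration by parts, v in H^1 with weak derivative g).\<close>
definition Lform :: "real \<Rightarrow> (real \<Rightarrow> real) \<Rightarrow> (real \<Rightarrow> real) \<Rightarrow> (real \<Rightarrow> real) \<Rightarrow> real" where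
  "Lform \<epsilon> u v g = - \<epsilon>\<^sup>2 * (LINT x:{0..1}|lborel. (g x)\<^sup>2) - (LINT x:{0..1}|lborel. f' (u x) * (v x)\<^sup>2)"

text \<open>Spectral property defining lambda_0 (H^1(R) with weak derivative g).\<close>
definition lambda0_prop :: "real \<Rightarrow> bool" where
  "lambda0_prop lam0 \<longleftrightarrow>
    (\<forall>w g :: real \<Rightarrow> real.
       integrable lborel (\<lambda>x. (w x)\<^sup>2) \<and> integrable lborel (\<lambda>x. (g x)\<^sup>2) \<and>
       (\<forall>a b. set_integrable lborel {a..b} g) \<and>
       (\<forall>x. w x = w 0 + (LBINT t=0..x. g t)) \<and>
       (w 0 = 0 \<or> (LINT x|lborel. w x * deriv U x) = 0) \<longrightarrow>
       (LINT x|lborel. - (g x)\<^sup>2 - f' (U x) * (w x)\<^sup>2) \<le> - lam0 * (LINT x|lborel. (w x)\<^sup>2))"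

end

theory Submission
  imports Defs "HOL-Real_Asymp.Real_Asymp"
begin

text \<open>
  Write \<open>\<phi>\<^sub>j\<close> for \<open>U'((x - h\<^sub>j)/\<epsilon>)\<close> times a cutoff \<open>\<chi>\<^sub>j\<close> supported around the \<open>j\<close>-th layer, and split
  \<open>v = \<Sigma> c\<^sub>j \<phi>\<^sub>j + w\<close> with \<open>w\<close> orthogonal to all \<open>\<phi>\<^sub>j\<close>. The \<open>\<phi>\<^sub>j\<close> have disjoint supports and are almost in
  the kernel of the operator, so the form of \<open>v\<close> is the form of \<open>w\<close> up to a negligible error. Since
  \<open>\<chi>\<^sub>j w\<close> is exactly orthogonal to \<open>U'((x - h\<^sub>j)/\<epsilon>)\<close>, the whole-line gap applies to it, and away from the layers
  the potential is at least \<open>1\<close>; hence the form of \<open>w\<close> is at most about \<open>- min 1 lam0 \<parallel>w\<parallel>\<^sup>2\<close>.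

  Differentiating the mass constraint shows that the tangent vectors of the manifold are close to multiples of
  \<open>U'((x - h\<^sub>i)/\<epsilon>) - U'((x - h\<^sub>N\<^sub>+\<^sub>1)/\<epsilon>)\<close>, so the orthogonality conditions force all \<open>c\<^sub>j\<close> to be almost equal to
  one number \<open>c\<close>. Then \<open>\<integral>v = 0\<close> says that \<open>\<integral>w\<close> is about \<open>- 2 (N + 1) \<epsilon> c\<close>, so that
  \<open>\<parallel>w\<parallel>\<^sup>2 \<ge> (\<integral>w)\<^sup>2\<close> is at least a constant times \<open>\<epsilon> \<parallel>v\<parallel>\<^sup>2\<close>: this is where the factor \<open>\<epsilon>\<close> comes from. A test function
  gives \<open>lam0 \<le> 3\<close>, and with this the constant is large enough to absorb all errors.
\<close>

section \<open>Integration by parts for absolutely continuous functions\<close>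

text \<open>The size of the final constant comes from having at least two layers. If all
  coefficients equal \<open>c\<close> and \<open>n = N + 1\<close>, then
  \<open>\<parallel>v\<parallel>\<^sup>2 - \<parallel>w\<parallel>\<^sup>2\<close> is
  \<open>n c\<^sup>2 \<epsilon> S\<close> and \<open>(\<integral>w)\<^sup>2\<close> is
  \<open>(n c \<epsilon> M)\<^sup>2\<close>, where \<open>M\<close> and \<open>S\<close> are the
  integrals of the truncated \<open>U'\<close> and of its square in the layer variable. The ratio is
  \<open>n \<epsilon> M\<^sup>2 / S\<close>. Since \<open>M\<close> is almost 2 and
  \<open>U' \<le> 1 / sqrt 2\<close> gives \<open>S \<le> M / sqrt 2\<close>, it exceeds
  \<open>5 \<epsilon>\<close> for \<open>n \<ge> 2\<close>, and \<open>24 / 5\<close> survives the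
  errors. The gap available for \<open>w\<close> is only about \<open>min 1 lam0\<close>, while the
  definition of \<open>lam0\<close> shows no upper bound; the test function yields
  \<open>min 1 lam0 \<ge> lam0 / 3\<close>. The surplus then takes up every error, so no exponential
  term is left at the end.

  All errors are measured by one number \<open>\<tau>\<close>, exponentially small in
  \<open>1 / rho\<close>. The coefficients \<open>c\<^sub>j\<close> are only bounded by a multiple
  of \<open>\<parallel>v\<parallel> / \<epsilon>\<close>, and the error has to stay below
  \<open>\<epsilon> \<parallel>v\<parallel>\<^sup>2\<close>; therefore \<open>\<tau>\<close> is
  compared with \<open>\<epsilon>\<^sup>2\<close>.\<close>

lemma set_integrable_continuous_mult:
  fixes g \<psi> :: "real \<Rightarrow> real"
  assumes g: "set_integrable lborel {a..b} g" and \<psi>: "continuous_on {a..b} \<psi>"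
  shows "set_integrable lborel {a..b} (\<lambda>x. \<psi> x * g x)"
proof -
  have "compact (\<psi> ` {a..b})" using \<psi> by (intro compact_continuous_image) auto
  then obtain B where B: "\<And>x. x \<in> {a..b} \<Longrightarrow> \<bar>\<psi> x\<bar> \<le> B"
    by (metis bounded_real compact_imp_bounded imageI)
  have m1: "set_borel_measurable lborel {a..b} \<psi>"
    using borel_integrable_atLeastAtMost'[OF \<psi>] unfolding set_borel_measurable_def set_integrable_def by auto
  have m2: "set_borel_measurable lborel {a..b} g"
    using g unfolding set_borel_measurable_def set_integrable_def by auto
  have "(\<lambda>x. (indicator {a..b} x *\<^sub>R \<psi> x) * (indicator {a..b} x *\<^sub>R g x)) \<in> borel_measurable lborel"
    using m1 m2 unfolding set_borel_measurable_def by (rule borel_measurable_times)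
  moreover have "(\<lambda>x. (indicator {a..b} x *\<^sub>R \<psi> x) * (indicator {a..b} x *\<^sub>R g x))
      = (\<lambda>x. indicator {a..b} x *\<^sub>R (\<psi> x * g x))" by (auto simp: indicator_def)
  ultimately have m: "set_borel_measurable lborel {a..b} (\<lambda>x. \<psi> x * g x)"
    unfolding set_borel_measurable_def by simp
  show ?thesis
  proof (rule set_integrable_bound)
    show "set_integrable lborel {a..b} (\<lambda>x. B * g x)" using g by simp
    show "AE x in lborel. x \<in> {a..b} \<longrightarrow> norm (\<psi> x * g x) \<le> norm (B * g x)"
    proof (intro AE_I2 impI)
      fix x assume "x \<in> {a..b}"
      then have "\<bar>\<psi> x\<bar> \<le> \<bar>B\<bar>" using B[of x] by linarith
      then show "norm (\<psi> x * g x) \<le> norm (B * g x)" by (simp add: abs_mult mult_right_mono)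
    qed
  qed (rule m)
qed

lemma set_integrable_continuous:
  fixes \<psi> :: "real \<Rightarrow> real"
  assumes "continuous_on {a..b} \<psi>"
  shows "set_integrable lborel {a..b} \<psi>"
  using assms by (rule borel_integrable_atLeastAtMost')

lemma set_integral_derivative:
  fixes \<psi> d :: "real \<Rightarrow> real"
  assumes "a \<le> b" and d: "continuous_on {a..b} d" and \<psi>: "\<And>x. (\<psi> has_real_derivative d x) (at x)"
  shows "(LINT x:{a..b}|lborel. d x) = \<psi> b - \<psi> a"
  unfolding set_lebesgue_integral_def
proof (rule integral_FTC_atLeastAtMost[OF assms(1) _ d])
  fix x show "(\<psi> has_vector_derivative d x) (at x within {a..b})"
    using \<psi>[of x] has_field_derivative_at_within has_real_derivative_iff_has_vector_derivative by blast
qed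

text \<open>Supplies the majorant for Fubini on a triangle in the next lemma.\<close>

lemma integrable_lborel_product:
  fixes p q :: "real \<Rightarrow> real"
  assumes p: "integrable lborel p" and q: "integrable lborel q"
  shows "integrable (lborel \<Otimes>\<^sub>M lborel) (\<lambda>(x, t). p x * q t)"
proof (rule lborel_pair.Fubini_integrable)
  have [measurable]: "p \<in> borel_measurable lborel" "q \<in> borel_measurable lborel" using p q by auto
  show "(\<lambda>(x, t). p x * q t) \<in> borel_measurable (lborel \<Otimes>\<^sub>M lborel)" by measurable
  have "(\<lambda>x. LINT y|lborel. norm (case (x, y) of (x, t) \<Rightarrow> p x * q t))
      = (\<lambda>x. \<bar>p x\<bar> * (LINT y|lborel. \<bar>q y\<bar>))" by (auto simp: abs_mult)
  then show "integrable lborel (\<lambda>x. LINT y|lborel. norm (case (x, y) of (x, t) \<Rightarrow> p x * q t))"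
    using p by simp
  show "AE x in lborel. integrable lborel (\<lambda>y. case (x, y) of (x, t) \<Rightarrow> p x * q t)"
    using q by simp
qed

text \<open>The function \<open>g\<close> is merely integrable, so its primitive has no pointwise
  derivative for the classical formula. Instead Fubini is applied to \<open>d x * g t\<close> on the
  triangle \<open>0 \<le> t \<le> x \<le> b\<close>: integrating over \<open>t\<close> first gives
  the primitive of \<open>g\<close>, integrating over \<open>x\<close> first gives
  \<open>\<psi> b - \<psi> t\<close>.\<close>

lemma integral_by_parts_absolutely_continuous:
  fixes g \<psi> d :: "real \<Rightarrow> real"
  assumes g: "set_integrable lborel {0..b} g" and b: "0 \<le> b"
    and d: "continuous_on {0..b} d" and \<psi>: "\<And>x. (\<psi> has_real_derivative d x) (at x)"
  shows "(LINT x:{0..b}|lborel. \<psi> x * g x)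
    = \<psi> b * (LINT x:{0..b}|lborel. g x) - (LINT x:{0..b}|lborel. d x * (LINT t:{0..x}|lborel. g t))"
proof -
  define p where "p = (\<lambda>x. indicator {0..b} x * d x)"
  define q where "q = (\<lambda>x. indicator {0..b} x * g x)"
  define k where "k = (\<lambda>x t. if t \<le> x then p x * q t else 0)"
  have q: "integrable lborel q" using g unfolding q_def set_integrable_def by simp
  have p: "integrable lborel p" using set_integrable_continuous[OF d] unfolding p_def set_integrable_def by simp
  have [measurable]: "p \<in> borel_measurable lborel" "q \<in> borel_measurable lborel" using p q by auto
  have ik: "integrable (lborel \<Otimes>\<^sub>M lborel) (case_prod k)"
  proof (rule Bochner_Integration.integrable_bound[OF integrable_lborel_product[OF p q]])
    show "case_prod k \<in> borel_measurable (lborel \<Otimes>\<^sub>M lborel)" unfolding k_def by measurable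
  qed (auto simp: k_def)
  have "(LINT t|lborel. (LINT x|lborel. k x t)) = (LINT x|lborel. (LINT t|lborel. k x t))"
    by (rule lborel_pair.Fubini_integral[OF ik])
  moreover have "(LINT x|lborel. (LINT t|lborel. k x t)) = (LINT x:{0..b}|lborel. d x * (LINT t:{0..x}|lborel. g t))"
  proof -
    have "(LINT t|lborel. k x t) = indicator {0..b} x *\<^sub>R (d x * (LINT t:{0..x}|lborel. g t))" for x
    proof (cases "x \<in> {0..b}")
      case True
      have "(LINT t|lborel. k x t) = (LINT t|lborel. d x * (indicator {0..x} t *\<^sub>R g t))"
        using True by (intro Bochner_Integration.integral_cong) (auto simp: k_def p_def q_def indicator_def)
      then show ?thesis using True by (simp add: set_lebesgue_integral_def)
    next
      case False
      then have "k x = (\<lambda>t. 0)" by (auto simp: k_def p_def indicator_def)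
      then show ?thesis using False by simp
    qed
    then show ?thesis by (simp add: set_lebesgue_integral_def)
  qed
  moreover have "(LINT t|lborel. (LINT x|lborel. k x t)) = (LINT t:{0..b}|lborel. (\<psi> b - \<psi> t) * g t)"
  proof -
    have "(LINT x|lborel. k x t) = indicator {0..b} t *\<^sub>R ((\<psi> b - \<psi> t) * g t)" for t
    proof (cases "t \<in> {0..b}")
      case True
      have "(LINT x|lborel. k x t) = (LINT x|lborel. g t * (indicator {t..b} x *\<^sub>R d x))"
        using True by (intro Bochner_Integration.integral_cong) (auto simp: k_def p_def q_def indicator_def)
      also have "\<dots> = g t * (\<psi> b - \<psi> t)"
      proof -
        have "continuous_on {t..b} d" by (rule continuous_on_subset[OF d]) (use True in auto)
        then have "(LINT x:{t..b}|lborel. d x) = \<psi> b - \<psi> t"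
          using True \<psi> by (intro set_integral_derivative) auto
        then have "(LBINT x. indicator {t..b} x *\<^sub>R d x) = \<psi> b - \<psi> t" by (simp only: set_lebesgue_integral_def)
        then show ?thesis by simp
      qed
      finally show ?thesis using True by simp
    next
      case False
      then have "(\<lambda>x. k x t) = (\<lambda>x. 0)" by (auto simp: k_def q_def indicator_def)
      then show ?thesis using False by simp
    qed
    then show ?thesis by (simp add: set_lebesgue_integral_def)
  qed
  moreover have "(LINT t:{0..b}|lborel. (\<psi> b - \<psi> t) * g t) = \<psi> b * (LINT x:{0..b}|lborel. g x) - (LINT x:{0..b}|lborel. \<psi> x * g x)"
  proof -
    have c: "continuous_on {0..b} \<psi>" by (intro continuous_at_imp_continuous_on ballI DERIV_isCont[OF \<psi>])
    have "(LINT t:{0..b}|lborel. \<psi> b * g t - \<psi> t * g t) = (LINT t:{0..b}|lborel. \<psi> b * g t) - (LINT x:{0..b}|lborel. \<psi> x * g x)"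
      by (intro set_integral_diff set_integrable_continuous_mult g c) (use g in simp_all)
    then show ?thesis by (simp add: left_diff_distrib)
  qed
  ultimately show ?thesis by linarith
qed

lemma H1_continuous_on:
  assumes "H1 v g" shows "continuous_on {0..1} v"
proof -
  have i: "set_integrable lborel {0..1} g" and v: "\<And>x. x \<in> {0..1} \<Longrightarrow> v x = v 0 + (LINT t:{0..x}|lborel. g t)"
    using assms(1) unfolding H1_def by blast+
  have "(LINT t:{0..x}|lborel. g t) = integral {0..x} g" if "x \<in> {0..1}" for x
    using that by (intro set_borel_integral_eq_integral set_integrable_subset[OF i]) auto
  then have *: "v 0 + integral {0..x} g = v x" if "x \<in> {0..1}" for x using v[OF that] that by simp
  have "continuous_on {0..1} (\<lambda>x. v 0 + integral {0..x} g)"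
    using i by (intro continuous_intros indefinite_integral_continuous_1 set_borel_integral_eq_integral)
  then show ?thesis by (rule continuous_on_eq) (rule *)
qed

text \<open>The upper end is left variable: \<open>b = x\<close> gives the product rule in
  \<open>H1\<close>, \<open>b = 1\<close> moves derivatives onto the kernel functions.\<close>

lemma H1_by_parts:
  assumes "H1 v g" and b: "0 \<le> b" "b \<le> 1"
    and d: "continuous_on {0..b} d" and \<psi>: "\<And>x. (\<psi> has_real_derivative d x) (at x)"
  shows "(LINT x:{0..b}|lborel. \<psi> x * g x) = \<psi> b * v b - \<psi> 0 * v 0 - (LINT x:{0..b}|lborel. d x * v x)"
proof -
  have i: "set_integrable lborel {0..1} g" and "\<forall>x\<in>{0..1}. v x = v 0 + (LINT t:{0..x}|lborel. g t)"
    using assms(1) unfolding H1_def by blast+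
  then have v: "(LINT t:{0..x}|lborel. g t) = v x - v 0" if "0 \<le> x" "x \<le> 1" for x
    using that by (metis add_diff_cancel_left' atLeastAtMost_iff)
  have ib: "set_integrable lborel {0..b} g" by (rule set_integrable_subset[OF i]) (use b in auto)
  have cv: "continuous_on {0..b} v" using H1_continuous_on[OF assms(1)] b by (auto elim: continuous_on_subset)
  have "(LINT x:{0..b}|lborel. d x * (LINT t:{0..x}|lborel. g t)) = (LINT x:{0..b}|lborel. d x * v x - v 0 * d x)"
    using b by (intro set_lebesgue_integral_cong) (auto simp: v right_diff_distrib mult.commute)
  also have "\<dots> = (LINT x:{0..b}|lborel. d x * v x) - (LINT x:{0..b}|lborel. v 0 * d x)"
    using cv d by (intro set_integral_diff set_integrable_continuous continuous_intros)
  also have "(LINT x:{0..b}|lborel. v 0 * d x) = v 0 * (\<psi> b - \<psi> 0)"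
  proof -
    have "(LINT x:{0..b}|lborel. d x) = \<psi> b - \<psi> 0"
      by (rule set_integral_derivative[OF b(1) d \<psi>])
    then show ?thesis by simp
  qed
  finally show ?thesis
    using integral_by_parts_absolutely_continuous[OF ib b(1) d \<psi>] unfolding v[OF b]
    by (simp add: right_diff_distrib mult.commute)
qed

section \<open>The kink profile and the cutoff\<close>

text \<open>The kink solves the first-order equation \<open>U' = (1 - U^2) / sqrt 2\<close>. Writing
  the derivative this way keeps all higher derivatives polynomial in \<open>U\<close>.\<close>

definition DU :: "real \<Rightarrow> real" where "DU x = (1 - U x ^ 2) / sqrt 2"

lemma U_has_derivative: "(U has_real_derivative DU x) (at x)"
  unfolding U_def[abs_def] DU_def
  by (auto intro!: derivative_eq_intros simp: field_simps)

lemma deriv_U: "deriv U = DU"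
  using DERIV_imp_deriv[OF U_has_derivative] by (auto simp: fun_eq_iff)

lemma DU_has_derivative: "(DU has_real_derivative - sqrt 2 * U x * DU x) (at x)"
proof -
  have "((\<lambda>x. (1 - U x ^ 2) / sqrt 2) has_real_derivative - sqrt 2 * U x * DU x) (at x)"
    by (rule derivative_eq_intros U_has_derivative refl | simp)+
  then show ?thesis by (simp add: DU_def[abs_def])
qed

text \<open>The kernel equation: \<open>DU\<close>, the translation mode, solves
  \<open>v'' = f'(U) v\<close>, the linearisation at the kink.\<close>

lemma DDU_has_derivative: "((\<lambda>x. - sqrt 2 * U x * DU x) has_real_derivative f' (U x) * DU x) (at x)"
proof -
  have s: "sqrt 2 * DU x = 1 - U x ^ 2" by (simp add: DU_def)
  have "((\<lambda>x. - sqrt 2 * U x * DU x) has_real_derivative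
      - sqrt 2 * U x * (- sqrt 2 * U x * DU x) + (- sqrt 2 * DU x) * DU x) (at x)"
    by (auto intro!: derivative_eq_intros U_has_derivative DU_has_derivative)
  moreover have "- sqrt 2 * U x * (- sqrt 2 * U x * DU x) + (- sqrt 2 * DU x) * DU x
      = 2 * U x ^ 2 * DU x - (sqrt 2 * DU x) * DU x"
    by (simp add: power2_eq_square algebra_simps)
  moreover have "\<dots> = f' (U x) * DU x" unfolding s f'_def by (simp add: algebra_simps)
  ultimately show ?thesis by (simp only:)
qed

lemma abs_U_less: "\<bar>U x\<bar> < 1"
  using tanh_real_bounds[of "x / sqrt 2"] by (auto simp: U_def)

lemma U_minus [simp]: "U (- x) = - U x"
  by (simp add: U_def)

lemma U_mono: "x \<le> y \<Longrightarrow> U x \<le> U y"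
  by (simp add: U_def divide_right_mono)

lemma one_minus_U: "1 - U x \<le> 2 * exp (- sqrt 2 * x)"
proof -
  have "2 * (x / sqrt 2) = sqrt 2 * x" by (simp add: field_simps)
  then have "U x = (1 - exp (- sqrt 2 * x)) / (1 + exp (- sqrt 2 * x))"
    unfolding U_def tanh_real_altdef by simp
  moreover have "1 - (1 - E) / (1 + E) \<le> 2 * E" if "0 < E" for E :: real
  proof -
    have "1 - (1 - E) / (1 + E) = 2 * E / (1 + E)" using that by (simp add: field_simps)
    also have "\<dots> \<le> 2 * E / 1" using that by (intro divide_left_mono) auto
    finally show ?thesis by simp
  qed
  ultimately show ?thesis by simp
qed

lemma DU_pos: "0 < DU x"
proof -
  have "U x ^ 2 < 1" using abs_U_less[of x] by (simp add: abs_square_less_1)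
  then show ?thesis by (simp add: DU_def)
qed

lemma DU_le: "DU x \<le> 1 / sqrt 2"
  by (simp add: DU_def divide_right_mono)

lemma DU_le_1: "DU x \<le> 1"
  by (rule order_trans[OF DU_le]) (simp add: real_le_rsqrt)

lemma DU_decay: assumes "d \<le> \<bar>x\<bar>" shows "DU x \<le> 3 * exp (- sqrt 2 * d)"
proof -
  have e: "DU x = DU \<bar>x\<bar>" by (cases "0 \<le> x") (auto simp: DU_def)
  have 1: "1 - U \<bar>x\<bar> \<le> 2 * exp (- sqrt 2 * d)"
    using one_minus_U[of "\<bar>x\<bar>"] assms by (smt (verit) exp_le_cancel_iff mult_left_mono mult_minus_left real_sqrt_ge_zero)
  \<comment> \<open>Turns the factor \<open>4 / sqrt 2\<close> that arises below into the 3 of the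
    statement.\<close>
  have s: "4 / 3 \<le> sqrt 2" by (rule real_le_rsqrt) (simp add: power2_eq_square)
  have "DU x * sqrt 2 = (1 - U \<bar>x\<bar>) * (1 + U \<bar>x\<bar>)"
  proof -
    have "DU \<bar>x\<bar> * sqrt 2 = 1 - U \<bar>x\<bar> ^ 2" by (simp add: DU_def)
    then show ?thesis unfolding e by (simp add: power2_eq_square algebra_simps)
  qed
  also have "\<dots> \<le> (2 * exp (- sqrt 2 * d)) * 2"
    using 1 abs_U_less[of "\<bar>x\<bar>"] by (intro mult_mono) auto
  finally have "DU x * sqrt 2 \<le> 4 * exp (- sqrt 2 * d)" by simp
  moreover have "DU x * (4 / 3) \<le> DU x * sqrt 2" using s DU_pos[of x] by (intro mult_left_mono) auto
  ultimately show ?thesis by simp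
qed

section \<open>Powers of the positive part and the twice differentiable cutoff\<close>

lemma max_power_has_derivative:
  "((\<lambda>t::real. (max 0 t) ^ Suc (Suc n)) has_real_derivative real (Suc (Suc n)) * (max 0 x) ^ Suc n) (at x)"
proof -
  consider "x < 0" | "x = 0" | "0 < x" by linarith
  then show ?thesis
  proof cases
    case 1
    have "((\<lambda>t::real. 0) has_real_derivative 0) (at x)" by simp
    then have "((\<lambda>t::real. (max 0 t) ^ Suc (Suc n)) has_real_derivative 0) (at x)"
      by (rule has_field_derivative_transform_within_open[of _ _ _ "{..<0}"]) (use 1 in auto)
    then show ?thesis using 1 by simp
  next
    case 2
    \<comment> \<open>Only here does it matter that the exponent is at least two: the difference
      quotient at the corner is of order \<open>\<bar>h\<bar> ^ Suc n\<close>.\<close>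
    have "((\<lambda>h::real. (max 0 h) ^ Suc (Suc n) / h) \<longlongrightarrow> 0) (at 0)"
    proof (rule Lim_null_comparison)
      show "\<forall>\<^sub>F h::real in at 0. norm ((max 0 h) ^ Suc (Suc n) / h) \<le> \<bar>h\<bar> ^ Suc n"
      proof (intro always_eventually allI)
        fix h :: real
        show "norm ((max 0 h) ^ Suc (Suc n) / h) \<le> \<bar>h\<bar> ^ Suc n"
        proof (cases "0 < h")
          case False
          then have "max 0 h = 0" by simp
          then show ?thesis by (simp del: power_Suc)
        qed auto
      qed
      show "((\<lambda>h::real. \<bar>h\<bar> ^ Suc n) \<longlongrightarrow> 0) (at 0)" by (auto intro!: tendsto_eq_intros)
    qed
    then show ?thesis using 2 by (simp add: DERIV_def)
  next
    case 3
    have "((\<lambda>t::real. t ^ Suc (Suc n)) has_real_derivative real (Suc (Suc n)) * x ^ Suc n) (at x)"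
      by (rule DERIV_cong[OF DERIV_pow]) simp
    then have "((\<lambda>t::real. (max 0 t) ^ Suc (Suc n)) has_real_derivative real (Suc (Suc n)) * x ^ Suc n) (at x)"
      by (rule has_field_derivative_transform_within_open[of _ _ _ "{0<..}"]) (use 3 in auto)
    then show ?thesis using 3 by simp
  qed
qed

lemma max_square_has_derivative: "((\<lambda>t::real. (max 0 t)\<^sup>2) has_real_derivative 2 * max 0 x) (at x)"
  using max_power_has_derivative[of 0 x] by (simp add: eval_nat_numeral)

lemma max_cube_has_derivative: "((\<lambda>t::real. (max 0 t) ^ 3) has_real_derivative 3 * (max 0 x)\<^sup>2) (at x)"
  using max_power_has_derivative[of 1 x] by (simp add: eval_nat_numeral)

text \<open>
  Cubes of positive parts are \<open>C\<^sup>2\<close>, so this composition is a \<open>C\<^sup>2\<close> cutoff given by one formula; two derivatives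
  are needed to apply the operator to the truncated kernel functions.
\<close>

definition bump :: "real \<Rightarrow> real" where
  "bump s = (max 0 (1 - (max 0 (s\<^sup>2 - 1)) ^ 3)) ^ 3"

definition bump1 :: "real \<Rightarrow> real" where
  "bump1 s = - 18 * s * (max 0 (1 - (max 0 (s\<^sup>2 - 1)) ^ 3))\<^sup>2 * (max 0 (s\<^sup>2 - 1))\<^sup>2"

definition bump2 :: "real \<Rightarrow> real" where
  "bump2 s = 216 * s\<^sup>2 * max 0 (1 - (max 0 (s\<^sup>2 - 1)) ^ 3) * (max 0 (s\<^sup>2 - 1)) ^ 4
     - (max 0 (1 - (max 0 (s\<^sup>2 - 1)) ^ 3))\<^sup>2 * (18 * (max 0 (s\<^sup>2 - 1))\<^sup>2 + 72 * s\<^sup>2 * max 0 (s\<^sup>2 - 1))"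

lemma bump_has_derivative: "(bump has_real_derivative bump1 s) (at s)"
proof -
  have 0: "((\<lambda>s. s\<^sup>2 - 1) has_real_derivative 2 * s) (at s)" for s :: real
    by (auto intro!: derivative_eq_intros)
  have 1: "((\<lambda>s. 1 - (max 0 (s\<^sup>2 - 1)) ^ 3) has_real_derivative - (3 * (max 0 (s\<^sup>2 - 1))\<^sup>2 * (2 * s))) (at s)"
    by (rule DERIV_cong[OF DERIV_diff[OF DERIV_const DERIV_chain2[OF max_cube_has_derivative 0]]]) simp
  show ?thesis unfolding bump_def[abs_def] bump1_def
    by (rule DERIV_cong[OF DERIV_chain2[OF max_cube_has_derivative 1]]) (simp add: algebra_simps)
qed

lemma bump1_has_derivative: "(bump1 has_real_derivative bump2 s) (at s)"
proof -
  have 0: "((\<lambda>s. s\<^sup>2 - 1) has_real_derivative 2 * s) (at s)"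
    by (auto intro!: derivative_eq_intros)
  have 1: "((\<lambda>s. 1 - (max 0 (s\<^sup>2 - 1)) ^ 3) has_real_derivative - (3 * (max 0 (s\<^sup>2 - 1))\<^sup>2 * (2 * s))) (at s)"
    by (rule DERIV_cong[OF DERIV_diff[OF DERIV_const DERIV_chain2[OF max_cube_has_derivative 0]]]) simp
  have 2: "((\<lambda>s. - 18 * s) has_real_derivative - 18) (at s)" by (auto intro!: derivative_eq_intros)
  show ?thesis unfolding bump1_def[abs_def] bump2_def
    by (rule DERIV_cong[OF DERIV_mult[OF DERIV_mult[OF 2 DERIV_chain2[OF max_square_has_derivative 1]]
          DERIV_chain2[OF max_square_has_derivative 0]]])
       (simp add: algebra_simps eval_nat_numeral)
qed

lemma continuous_on_bump: "continuous_on S bump" "continuous_on S bump1" "continuous_on S bump2"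
  unfolding bump_def[abs_def] bump1_def[abs_def] bump2_def[abs_def] by (intro continuous_intros)+

lemma bump_nonneg: "0 \<le> bump s" and bump_le_1: "bump s \<le> 1"
  by (auto simp: bump_def intro!: power_le_one)

lemma bump_inner:
  assumes "\<bar>s\<bar> \<le> 1" shows "bump s = 1" "bump1 s = 0" "bump2 s = 0"
proof -
  have "s\<^sup>2 \<le> 1" using assms by (simp add: abs_square_le_1)
  then have "max 0 (s\<^sup>2 - 1) = 0" by simp
  then show "bump s = 1" "bump1 s = 0" "bump2 s = 0" by (simp_all add: bump_def bump1_def bump2_def)
qed

lemma bump_outer:
  assumes "2 \<le> \<bar>s\<bar>" shows "bump s = 0" "bump1 s = 0" "bump2 s = 0"
proof -
  have "2\<^sup>2 \<le> s\<^sup>2" using power_mono[OF assms, of 2] by simp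
  then have "1 \<le> (max 0 (s\<^sup>2 - 1))" by simp
  then have "1 \<le> (max 0 (s\<^sup>2 - 1)) ^ 3" by (rule one_le_power)
  then have "max 0 (1 - (max 0 (s\<^sup>2 - 1)) ^ 3) = 0" by simp
  then show "bump s = 0" "bump1 s = 0" "bump2 s = 0" by (simp_all add: bump_def bump1_def bump2_def)
qed

lemma bump_derivatives_bounded:
  obtains B where "1 \<le> B" "\<And>s. \<bar>bump1 s\<bar> \<le> B" "\<And>s. \<bar>bump2 s\<bar> \<le> B"
proof -
  have b: "\<exists>B. \<forall>s\<in>{-2..2}. \<bar>p s\<bar> \<le> B" if "continuous_on {-2..2} p" for p :: "real \<Rightarrow> real"
  proof -
    have "compact (p ` {-2..2})" using that by (intro compact_continuous_image) auto
    then show ?thesis by (metis bounded_real compact_imp_bounded imageI)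
  qed
  obtain B1 where B1: "\<And>s. s \<in> {-2..2} \<Longrightarrow> \<bar>bump1 s\<bar> \<le> B1"
    using b[OF continuous_on_bump(2)] by blast
  obtain B2 where B2: "\<And>s. s \<in> {-2..2} \<Longrightarrow> \<bar>bump2 s\<bar> \<le> B2"
    using b[OF continuous_on_bump(3)] by blast
  show thesis
  proof
    fix s :: real
    \<comment> \<open>The bound is normalised to be at least 1 so that it can absorb plain constants
      in later estimates.\<close>
    show "1 \<le> max 1 (max B1 B2)" by simp
    show "\<bar>bump1 s\<bar> \<le> max 1 (max B1 B2)"
      using B1[of s] bump_outer(2)[of s] by (cases "s \<in> {-2..2}") (auto simp: le_max_iff_disj)
    show "\<bar>bump2 s\<bar> \<le> max 1 (max B1 B2)"
      using B2[of s] bump_outer(3)[of s] by (cases "s \<in> {-2..2}") (auto simp: le_max_iff_disj)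
  qed
qed

text \<open>In \<open>lambda0_prop\<close> the function \<open>w\<close> has type \<open>ereal \<Rightarrow> real\<close>; its values at \<open>\<plusminus>\<infinity>\<close>
  are determined by the representation formula and do not enter the inequality.\<close>

lemma lambda0_propD:
  fixes w g :: "real \<Rightarrow> real"
  assumes "lambda0_prop lam0"
    and "integrable lborel (\<lambda>x. (w x)\<^sup>2)" "integrable lborel (\<lambda>x. (g x)\<^sup>2)"
    and "\<And>a b. set_integrable lborel {a..b} g"
    and w: "\<And>x. w x = w 0 + (LBINT t=0..x. g t)"
    and o: "w 0 = 0 \<or> (LINT x|lborel. w x * DU x) = 0"
  shows "(LINT x|lborel. - (g x)\<^sup>2 - f' (U x) * (w x)\<^sup>2) \<le> - lam0 * (LINT x|lborel. (w x)\<^sup>2)"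
proof -
  define w' :: "ereal \<Rightarrow> real" where "w' = (\<lambda>x. w 0 + (LBINT t=0..x. g t))"
  have e: "w' (ereal x) = w x" for x unfolding w'_def by (rule w[symmetric])
  have 0: "w' 0 = w 0" using e[of 0] by (simp add: zero_ereal_def)
  have "\<forall>x. w' x = w' 0 + (LBINT t=0..x. g t)" unfolding 0 by (simp add: w'_def)
  then show ?thesis
    using assms(1)[unfolded lambda0_prop_def, rule_format, of w' g] assms(2-4) o unfolding e 0 deriv_U by blast
qed

text \<open>A function with \<open>w 0 = 0\<close> is admissible whatever its overlap with
  \<open>DU\<close>. Since \<open>f' (U x) \<le> 2\<close>, the constant is at most 2 plus the
  Rayleigh quotient of \<open>w'\<close>. The squared parabola on an interval of length
  \<open>L\<close> has quotient \<open>12 / L^2\<close>, which is 3/4 for \<open>L = 4\<close>; it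
  suffices below that this is at most 1.\<close>

lemma lambda0_le_3:
  assumes "lambda0_prop lam0" shows "lam0 \<le> 3"
proof -
  define w :: "real \<Rightarrow> real" where "w = (\<lambda>x. (max 0 (x * (4 - x)))\<^sup>2)"
  define g :: "real \<Rightarrow> real" where "g = (\<lambda>x. 2 * max 0 (x * (4 - x)) * (4 - 2 * x))"
  have wz: "w x = 0" "g x = 0" if "x \<notin> {0..4}" for x
  proof -
    have "x * (4 - x) \<le> 0" using that by (auto simp: mult_le_0_iff)
    then show "w x = 0" "g x = 0" by (simp_all add: w_def g_def)
  qed
  have cw: "continuous_on S w" and cg: "continuous_on S g" for S
    unfolding w_def g_def by (intro continuous_intros)+
  have D: "(w has_real_derivative g x) (at x)" for x
  proof -
    have 1: "((\<lambda>x. x * (4 - x)) has_real_derivative (4 - 2 * x)) (at x)" by (auto intro!: derivative_eq_intros)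
    show ?thesis unfolding w_def g_def by (rule DERIV_chain2[OF max_square_has_derivative 1])
  qed
  have int: "integrable lborel F" "(LINT x|lborel. F x) = (LINT x:{0..4}|lborel. F x)"
    if "continuous_on {0..4} F" "\<And>x. x \<notin> {0..4} \<Longrightarrow> F x = 0" for F :: "real \<Rightarrow> real"
  proof -
    have "(\<lambda>x. indicator {0..4} x *\<^sub>R F x) = F" using that(2) by (auto simp: indicator_def fun_eq_iff)
    then show "integrable lborel F" "(LINT x|lborel. F x) = (LINT x:{0..4}|lborel. F x)"
      using set_integrable_continuous[OF that(1)] by (simp_all add: set_integrable_def set_lebesgue_integral_def)
  qed
  have cU: "continuous_on S (\<lambda>x. f' (U x))" for S
    unfolding f'_def by (intro continuous_intros DERIV_continuous_on[OF has_field_derivative_at_within[OF U_has_derivative]])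
  have wg: "w x = w 0 + (LBINT t=0..x. g t)" for x
  proof -
    have "(LBINT t=ereal 0..ereal x. g t) = w x - w 0"
      by (rule interval_integral_FTC_finite[OF cg])
         (use D has_field_derivative_at_within has_real_derivative_iff_has_vector_derivative in blast)
    then show ?thesis by (simp add: zero_ereal_def)
  qed
  have "(LINT x|lborel. - (g x)\<^sup>2 - f' (U x) * (w x)\<^sup>2) \<le> - lam0 * (LINT x|lborel. (w x)\<^sup>2)"
  proof -
    have "integrable lborel (\<lambda>x. (w x)\<^sup>2)" "integrable lborel (\<lambda>x. (g x)\<^sup>2)"
      by (intro int continuous_intros cw cg; simp add: wz)+
    moreover have "\<forall>a b. set_integrable lborel {a..b} g" using set_integrable_continuous cg by blast
    moreover have "w 0 = 0" by (simp add: w_def)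
    ultimately show ?thesis by (intro lambda0_propD[OF assms _ _ _ wg]) auto
  qed
  moreover have "(LINT x|lborel. - (g x)\<^sup>2 - f' (U x) * (w x)\<^sup>2) = (LINT x:{0..4}|lborel. - (g x)\<^sup>2 - f' (U x) * (w x)\<^sup>2)"
    by (intro int continuous_intros cw cg cU) (simp add: wz)
  moreover have "(LINT x|lborel. (w x)\<^sup>2) = (LINT x:{0..4}|lborel. (w x)\<^sup>2)"
    by (intro int continuous_intros cw) (simp add: wz)
  moreover have "(LINT x:{0..4}|lborel. - (g x)\<^sup>2 - 2 * (w x)\<^sup>2) \<le> (LINT x:{0..4}|lborel. - (g x)\<^sup>2 - f' (U x) * (w x)\<^sup>2)"
  proof (intro set_integral_mono set_integrable_continuous continuous_intros cw cg cU)
    fix x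
    have "f' (U x) \<le> 2" using abs_U_less[of x] by (simp add: f'_def abs_square_le_1 less_imp_le)
    then have "f' (U x) * (w x)\<^sup>2 \<le> 2 * (w x)\<^sup>2" by (intro mult_right_mono) auto
    then show "- (g x)\<^sup>2 - 2 * (w x)\<^sup>2 \<le> - (g x)\<^sup>2 - f' (U x) * (w x)\<^sup>2" by linarith
  qed
  moreover have "(LINT x:{0..4}|lborel. - (g x)\<^sup>2 - 2 * (w x)\<^sup>2)
      = (LINT x:{0..4}|lborel. (w x)\<^sup>2 - (g x)\<^sup>2) - 3 * (LINT x:{0..4}|lborel. (w x)\<^sup>2)"
  proof -
    have "(LINT x:{0..4}|lborel. ((w x)\<^sup>2 - (g x)\<^sup>2) - 3 * (w x)\<^sup>2)
      = (LINT x:{0..4}|lborel. (w x)\<^sup>2 - (g x)\<^sup>2) - (LINT x:{0..4}|lborel. 3 * (w x)\<^sup>2)"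
      by (intro set_integral_diff set_integrable_continuous continuous_intros cw cg)
    moreover have "(\<lambda>x. ((w x)\<^sup>2 - (g x)\<^sup>2) - 3 * (w x)\<^sup>2) = (\<lambda>x. - (g x)\<^sup>2 - 2 * (w x)\<^sup>2)" by auto
    ultimately show ?thesis by simp
  qed
  moreover have "0 \<le> (LINT x:{0..4}|lborel. (w x)\<^sup>2 - (g x)\<^sup>2)"
  proof -
    define F :: "real \<Rightarrow> real" where
      "F = (\<lambda>x. - 1024 * x^3 / 3 + 384 * x^4 - 576 * x^5 / 5 - 32 * x^6 / 3 + 80 * x^7 / 7 - 2 * x^8 + x^9 / 9)"
    define q :: "real \<Rightarrow> real" where
      "q = (\<lambda>x. - 1024 * x^2 + 1536 * x^3 - 576 * x^4 - 64 * x^5 + 80 * x^6 - 16 * x^7 + x^8)"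
    have "(F has_real_derivative q x) (at x)" for x
      unfolding F_def q_def by (auto intro!: derivative_eq_intros)
    then have "(LINT x:{0..4}|lborel. q x) = F 4 - F 0"
      by (intro set_integral_derivative) (auto simp: q_def intro!: continuous_intros)
    moreover have "(LINT x:{0..4}|lborel. (w x)\<^sup>2 - (g x)\<^sup>2) = (LINT x:{0..4}|lborel. q x)"
    proof (intro set_lebesgue_integral_cong ballI allI impI)
      fix x :: real assume "x \<in> {0..4}"
      then have "max 0 (x * (4 - x)) = x * (4 - x)" by simp
      then show "(w x)\<^sup>2 - (g x)\<^sup>2 = q x" unfolding w_def g_def q_def
        by (simp add: eval_nat_numeral algebra_simps)
    qed simp
    ultimately show ?thesis by (simp add: F_def)
  qed
  moreover have "0 < (LINT x:{0..4}|lborel. (w x)\<^sup>2)"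
  proof -
    have "(LINT x:{1..3::real}|lborel. 1) \<le> (LINT x:{1..3}|lborel. (w x)\<^sup>2)"
    proof (intro set_integral_mono set_integrable_continuous continuous_intros cw)
      fix x :: real assume "x \<in> {1..3}"
      then have "1 * 1 \<le> x * (4 - x)" by (intro mult_mono) auto
      then show "1 \<le> (w x)\<^sup>2" unfolding w_def by (simp add: one_le_power)
    qed
    also have "\<dots> \<le> (LINT x:{0..4}|lborel. (w x)\<^sup>2)"
      unfolding set_lebesgue_integral_def
      by (rule integral_mono[OF set_integrable_continuous[unfolded set_integrable_def] set_integrable_continuous[unfolded set_integrable_def]])
         (auto intro!: continuous_intros cw simp: indicator_def)
    finally show ?thesis by (simp add: set_lebesgue_integral_def)
  qed
  ultimately have "lam0 * (LINT x|lborel. (w x)\<^sup>2) \<le> 3 * (LINT x|lborel. (w x)\<^sup>2)"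
    and "0 < (LINT x|lborel. (w x)\<^sup>2)"
    by - linarith+
  then show ?thesis by (rule mult_right_le_imp_le)
qed

section \<open>The spectral gap on a bounded interval\<close>

text \<open>The substitution \<open>x = h + \<epsilon> * y\<close> turns the layer at
  \<open>h\<close> into the standard kink. Representing \<open>z\<close> as an integral from minus
  infinity avoids a base point, so the affine change maps the representation to itself; the base
  point 0 of the spectral property is recovered by subtraction afterwards.\<close>

lemma lambda0_gap_rescaled:
  fixes z gz :: "real \<Rightarrow> real"
  assumes lam: "lambda0_prop lam0" and e: "0 < \<epsilon>"
    and z2: "integrable lborel (\<lambda>x. (z x)\<^sup>2)" and g2: "integrable lborel (\<lambda>x. (gz x)\<^sup>2)"
    and gi: "integrable lborel gz" and z: "\<And>x. z x = (LINT t:{..x}|lborel. gz t)"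
    and o: "(LINT x|lborel. z x * DU ((x - h) / \<epsilon>)) = 0"
  shows "lam0 * (LINT x|lborel. (z x)\<^sup>2) \<le> (LINT x|lborel. \<epsilon>\<^sup>2 * (gz x)\<^sup>2 + f' (U ((x - h) / \<epsilon>)) * (z x)\<^sup>2)"
proof -
  define w where "w = (\<lambda>y. z (h + \<epsilon> * y))"
  define g where "g = (\<lambda>y. \<epsilon> * gz (h + \<epsilon> * y))"
  have ne: "\<epsilon> \<noteq> 0" using e by simp
  have scale: "(LINT x|lborel. F x) = \<epsilon> * (LINT y|lborel. F (h + \<epsilon> * y))" for F :: "real \<Rightarrow> real"
    using lborel_integral_real_affine[OF ne, of F h] e by simp
  have gint: "integrable lborel g" unfolding g_def
    using lborel_integrable_real_affine[OF gi ne, of h] by simp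
  have wG: "w y = (LINT s:{..y}|lborel. g s)" for y
  proof -
    have "indicator {..h + \<epsilon> * y} (h + \<epsilon> * s) = (indicator {..y} s :: real)" for s
      using e by (auto simp: indicator_def)
    then show ?thesis
      unfolding w_def z g_def set_lebesgue_integral_def scale[of "\<lambda>t. indicator {..h + \<epsilon> * y} t *\<^sub>R gz t"]
      by (simp add: mult.left_commute)
  qed
  have si: "set_integrable lborel A g" if "A \<in> sets borel" for A
    using integrable_mult_indicator[OF _ gint, of A] that by (simp add: set_integrable_def)
  have incr: "(LINT s:{..y}|lborel. g s) = (LINT s:{..x}|lborel. g s) + (LINT s:{x<..y}|lborel. g s)" if "x \<le> y" for x y
  proof -
    have "{..y} = {..x} \<union> {x<..y}" using that by auto
    then show ?thesis by (simp only:) (intro set_integral_Un si; auto)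
  qed
  have w: "w y = w 0 + (LBINT t=0..y. g t)" for y
  proof (cases "0 \<le> y")
    case True
    then have "(LBINT t=ereal 0..ereal y. g t) = (LINT t:{0<..y}|lborel. g t)" by (rule interval_integral_Ioc)
    then show ?thesis using incr[OF True] by (simp add: wG zero_ereal_def)
  next
    case False
    then have "(LBINT t=ereal y..ereal 0. g t) = (LINT t:{y<..0}|lborel. g t)" by (intro interval_integral_Ioc) simp
    then show ?thesis using incr[of y 0] False interval_integral_endpoints_reverse[of "ereal 0" "ereal y" g]
      by (simp add: wG zero_ereal_def)
  qed
  have "(LINT x|lborel. - (g x)\<^sup>2 - f' (U x) * (w x)\<^sup>2) \<le> - lam0 * (LINT x|lborel. (w x)\<^sup>2)"
  proof (rule lambda0_propD[OF lam _ _ _ w])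
    show "integrable lborel (\<lambda>x. (w x)\<^sup>2)" unfolding w_def by (rule lborel_integrable_real_affine[OF z2 ne])
    show "integrable lborel (\<lambda>x. (g x)\<^sup>2)"
      unfolding g_def power_mult_distrib using lborel_integrable_real_affine[OF g2 ne, of h] by simp
    show "set_integrable lborel {a..b} g" for a b by (rule si) simp
    have "(LINT y|lborel. w y * DU y) = 0"
      using o e unfolding scale[of "\<lambda>x. z x * DU ((x - h) / \<epsilon>)"] by (simp add: w_def)
    then show "w 0 = 0 \<or> (LINT x|lborel. w x * DU x) = 0" ..
  qed
  moreover have "(LINT x|lborel. - (g x)\<^sup>2 - f' (U x) * (w x)\<^sup>2) = - (LINT x|lborel. (g x)\<^sup>2 + f' (U x) * (w x)\<^sup>2)"
    by (subst integral_minus[symmetric]) (simp add: algebra_simps)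
  ultimately have "\<epsilon> * (lam0 * (LINT x|lborel. (w x)\<^sup>2)) \<le> \<epsilon> * (LINT x|lborel. (g x)\<^sup>2 + f' (U x) * (w x)\<^sup>2)"
    using e by (intro mult_left_mono) auto
  then show ?thesis
    unfolding scale[of "\<lambda>x. (z x)\<^sup>2"] scale[of "\<lambda>x. \<epsilon>\<^sup>2 * (gz x)\<^sup>2 + f' (U ((x - h) / \<epsilon>)) * (z x)\<^sup>2"]
    using e by (simp add: w_def g_def power_mult_distrib mult.left_commute)
qed

lemma set_integral_alt: "(LINT x:A|M. F x) = (LINT x|M. indicator A x * F x)" for F :: "_ \<Rightarrow> real"
  by (simp add: set_lebesgue_integral_def)

text \<open>Because both end values vanish, extending \<open>z\<close> and \<open>g\<close> by zero
  to the whole line creates no jump: to the right of 1 the primitive of \<open>g\<close> stays at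
  \<open>z 1 = 0\<close>.\<close>

lemma lambda0_gap_Dirichlet:
  assumes lam: "lambda0_prop lam0" and e: "0 < \<epsilon>" and H: "H1 z g" and z0: "z 0 = 0" and z1: "z 1 = 0"
    and o: "(LINT x:{0..1}|lborel. z x * DU ((x - h) / \<epsilon>)) = 0"
  shows "lam0 * (LINT x:{0..1}|lborel. (z x)\<^sup>2)
    \<le> (LINT x:{0..1}|lborel. \<epsilon>\<^sup>2 * (g x)\<^sup>2 + f' (U ((x - h) / \<epsilon>)) * (z x)\<^sup>2)"
proof -
  define w where "w = (\<lambda>x. indicator {0..1} x * z x)"
  define q where "q = (\<lambda>x. indicator {0..1} x * g x)"
  have i: "set_integrable lborel {0..1} g" "set_integrable lborel {0..1} (\<lambda>x. (g x)\<^sup>2)"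
    and "\<forall>x\<in>{0..1}. z x = z 0 + (LINT t:{0..x}|lborel. g t)"
    using H unfolding H1_def by blast+
  then have zx: "(LINT t:{0..x}|lborel. g t) = z x" if "x \<in> {0..1}" for x using that z0 by auto
  have sq: "(w x)\<^sup>2 = indicator {0..1} x * (z x)\<^sup>2" "(q x)\<^sup>2 = indicator {0..1} x * (g x)\<^sup>2" for x
    by (simp_all add: w_def q_def indicator_def)
  have "lam0 * (LINT x|lborel. (w x)\<^sup>2) \<le> (LINT x|lborel. \<epsilon>\<^sup>2 * (q x)\<^sup>2 + f' (U ((x - h) / \<epsilon>)) * (w x)\<^sup>2)"
  proof (rule lambda0_gap_rescaled[OF lam e])
    show "integrable lborel (\<lambda>x. (w x)\<^sup>2)"
      using set_integrable_continuous[OF continuous_on_power[OF H1_continuous_on[OF H], of 2]]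
      unfolding sq set_integrable_def by simp
    show "integrable lborel (\<lambda>x. (q x)\<^sup>2)" using i(2) unfolding sq set_integrable_def by simp
    show "integrable lborel q" using i(1) unfolding q_def set_integrable_def by simp
    show "(LINT x|lborel. w x * DU ((x - h) / \<epsilon>)) = 0"
      using o by (simp add: w_def set_lebesgue_integral_def mult.assoc)
    fix x
    have q: "(LINT t:{..x}|lborel. q t) = (LINT t:{..x} \<inter> {0..1}|lborel. g t)"
      unfolding set_lebesgue_integral_def q_def
      by (intro Bochner_Integration.integral_cong) (auto simp: indicator_def)
    consider "x < 0" | "x \<in> {0..1}" | "1 < x" by fastforce
    then show "w x = (LINT t:{..x}|lborel. q t)"
    proof cases
      case 1
      then have "{..x} \<inter> {0..1} = {}" by auto
      then show ?thesis using 1 unfolding q by (simp add: w_def set_lebesgue_integral_def)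
    next
      case 2
      then have "{..x} \<inter> {0..1} = {0..x}" by auto
      then show ?thesis using 2 zx[OF 2] unfolding q by (simp add: w_def)
    next
      case 3
      then have "{..x} \<inter> {0..1} = {0..1}" by auto
      then show ?thesis using 3 zx[of 1] z1 unfolding q by (simp add: w_def)
    qed
  qed
  then show ?thesis unfolding sq set_integral_alt by (simp add: distrib_left mult.left_commute)
qed

section \<open>Products and differences of Sobolev functions with smooth functions\<close>

lemma H1_mult:
  assumes H: "H1 v g" and d: "continuous_on UNIV d" and \<psi>: "\<And>x. (\<psi> has_real_derivative d x) (at x)"
  shows "H1 (\<lambda>x. \<psi> x * v x) (\<lambda>x. d x * v x + \<psi> x * g x)"
proof -
  have i: "set_integrable lborel {0..1} g" "set_integrable lborel {0..1} (\<lambda>x. (g x)\<^sup>2)"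
    using H unfolding H1_def by blast+
  have d': "continuous_on S d" for S using d by (rule continuous_on_subset) simp
  have c\<psi>: "continuous_on S \<psi>" for S by (intro continuous_at_imp_continuous_on ballI DERIV_isCont[OF \<psi>])
  have cv: "continuous_on {0..1} v" by (rule H1_continuous_on[OF H])
  have i1: "set_integrable lborel {0..1} (\<lambda>x. d x * v x)" by (intro set_integrable_continuous continuous_intros d' cv)
  have i2: "set_integrable lborel {0..1} (\<lambda>x. \<psi> x * g x)" by (intro set_integrable_continuous_mult i c\<psi>)
  show ?thesis unfolding H1_def
  proof (intro conjI ballI)
    show "set_integrable lborel {0..1} (\<lambda>x. d x * v x + \<psi> x * g x)" by (intro set_integral_add i1 i2)
    \<comment> \<open>Multiplied out, the square contains only a continuous function and continuous
      multiples of \<open>g\<close> and of its square, each integrable by itself.\<close>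
    have "set_integrable lborel {0..1} (\<lambda>x. (d x * v x)\<^sup>2 + (2 * d x * v x * \<psi> x) * g x + (\<psi> x)\<^sup>2 * (g x)\<^sup>2)"
      by (intro set_integral_add set_integrable_continuous_mult i; intro set_integrable_continuous continuous_intros d' cv c\<psi>)
    then show "set_integrable lborel {0..1} (\<lambda>x. (d x * v x + \<psi> x * g x)\<^sup>2)"
      by (simp add: power2_eq_square algebra_simps)
    fix x :: real assume x: "x \<in> {0..1}"
    have "(LINT t:{0..x}|lborel. d t * v t + \<psi> t * g t) = (LINT t:{0..x}|lborel. d t * v t) + (LINT t:{0..x}|lborel. \<psi> t * g t)"
      by (intro set_integral_add set_integrable_subset[OF i1] set_integrable_subset[OF i2]) (use x in auto)
    also have "\<dots> = \<psi> x * v x - \<psi> 0 * v 0"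
      using H1_by_parts[OF H _ _ d' \<psi>, of x] x by simp
    finally show "\<psi> x * v x = \<psi> 0 * v 0 + (LINT t:{0..x}|lborel. d t * v t + \<psi> t * g t)" by simp
  qed
qed

lemma H1_diff_smooth:
  assumes H: "H1 v g" and d: "continuous_on UNIV d" and \<psi>: "\<And>x. (\<psi> has_real_derivative d x) (at x)"
  shows "H1 (\<lambda>x. v x - \<psi> x) (\<lambda>x. g x - d x)"
proof -
  have i: "set_integrable lborel {0..1} g" "set_integrable lborel {0..1} (\<lambda>x. (g x)\<^sup>2)"
    and v: "\<forall>x\<in>{0..1}. v x = v 0 + (LINT t:{0..x}|lborel. g t)"
    using H unfolding H1_def by blast+
  have d': "continuous_on S d" for S using d by (rule continuous_on_subset) simp
  have i1: "set_integrable lborel {a..b} d" for a b by (intro set_integrable_continuous d')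
  show ?thesis unfolding H1_def
  proof (intro conjI ballI)
    show "set_integrable lborel {0..1} (\<lambda>x. g x - d x)" by (intro set_integral_diff i i1)
    have "set_integrable lborel {0..1} (\<lambda>x. (g x)\<^sup>2 - (2 * d x) * g x + (d x)\<^sup>2)"
      by (intro set_integral_add set_integral_diff set_integrable_continuous_mult i; intro set_integrable_continuous continuous_intros d')
    then show "set_integrable lborel {0..1} (\<lambda>x. (g x - d x)\<^sup>2)"
      by (simp add: power2_eq_square algebra_simps)
    fix x :: real assume x: "x \<in> {0..1}"
    have "(LINT t:{0..x}|lborel. g t - d t) = (LINT t:{0..x}|lborel. g t) - (LINT t:{0..x}|lborel. d t)"
      by (intro set_integral_diff set_integrable_subset[OF i(1)] i1) (use x in auto)
    also have "(LINT t:{0..x}|lborel. d t) = \<psi> x - \<psi> 0"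
      using x by (intro set_integral_derivative d' \<psi>) auto
    finally show "v x - \<psi> x = v 0 - \<psi> 0 + (LINT t:{0..x}|lborel. g t - d t)" using bspec[OF v x] by linarith
  qed
qed

section \<open>Truncated kernel functions in the layer variable\<close>

definition loc :: "real \<Rightarrow> real \<Rightarrow> real" where "loc a y = bump (y / a) * DU y"
definition loc1 :: "real \<Rightarrow> real \<Rightarrow> real" where
  "loc1 a y = bump1 (y / a) / a * DU y + bump (y / a) * (- sqrt 2 * U y * DU y)"
text \<open>The second derivative of \<open>loc\<close>; in its last term \<open>U'''\<close> has
  been replaced by \<open>f'(U) U'\<close>, so that this term cancels against the potential.\<close>

definition loc2 :: "real \<Rightarrow> real \<Rightarrow> real" where
  "loc2 a y = bump2 (y / a) / a\<^sup>2 * DU y + 2 * (bump1 (y / a) / a) * (- sqrt 2 * U y * DU y)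
     + bump (y / a) * (f' (U y) * DU y)"

lemma continuous_on_U: "continuous_on S U" and continuous_on_DU: "continuous_on S DU"
  by (intro continuous_at_imp_continuous_on ballI DERIV_isCont[OF U_has_derivative])
     (intro continuous_at_imp_continuous_on ballI DERIV_isCont[OF DU_has_derivative])

lemma continuous_on_f'_comp: "continuous_on S p \<Longrightarrow> continuous_on S (\<lambda>x. f' (p x))"
  unfolding f'_def by (intro continuous_intros)

lemmas profile_continuous_intros = continuous_on_f'_comp
  continuous_on_compose2[OF continuous_on_U _ subset_UNIV]
  continuous_on_compose2[OF continuous_on_DU _ subset_UNIV]
  continuous_on_compose2[OF continuous_on_bump(1) _ subset_UNIV]
  continuous_on_compose2[OF continuous_on_bump(2) _ subset_UNIV]
  continuous_on_compose2[OF continuous_on_bump(3) _ subset_UNIV]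

lemma continuous_on_loc: "0 < a \<Longrightarrow> continuous_on S (loc a)" "0 < a \<Longrightarrow> continuous_on S (loc1 a)" "0 < a \<Longrightarrow> continuous_on S (loc2 a)"
  unfolding loc_def[abs_def] loc1_def[abs_def] loc2_def[abs_def]
  by (auto intro!: continuous_intros profile_continuous_intros)

context
  fixes a :: real assumes a: "1 \<le> a"
begin

lemma bump_scaled_derivative:
  "((\<lambda>y. bump (y / a)) has_real_derivative bump1 (y / a) / a) (at y)"
  "((\<lambda>y. bump1 (y / a) / a) has_real_derivative bump2 (y / a) / a\<^sup>2) (at y)"
proof -
  have "((\<lambda>y. y / a) has_real_derivative 1 / a) (at y)" using a by (auto intro!: derivative_eq_intros)
  note D = DERIV_chain2[OF bump_has_derivative this] DERIV_chain2[OF bump1_has_derivative this]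
  show "((\<lambda>y. bump (y / a)) has_real_derivative bump1 (y / a) / a) (at y)" using D(1) by simp
  show "((\<lambda>y. bump1 (y / a) / a) has_real_derivative bump2 (y / a) / a\<^sup>2) (at y)"
    using DERIV_cdivide[OF D(2), of a] by (simp add: power2_eq_square)
qed

lemma loc_has_derivative: "(loc a has_real_derivative loc1 a y) (at y)"
  unfolding loc_def[abs_def] loc1_def
  by (rule DERIV_cong[OF DERIV_mult[OF bump_scaled_derivative(1) DU_has_derivative]]) simp

lemma loc1_has_derivative: "(loc1 a has_real_derivative loc2 a y) (at y)"
  unfolding loc1_def[abs_def] loc2_def
  by (rule DERIV_cong[OF DERIV_add[OF DERIV_mult[OF bump_scaled_derivative(2) DU_has_derivative]
      DERIV_mult[OF bump_scaled_derivative(1) DDU_has_derivative]]]) (simp add: algebra_simps)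

lemma loc_outer:
  assumes "2 * a \<le> \<bar>y\<bar>" shows "loc a y = 0" "loc1 a y = 0" "loc2 a y = 0"
proof -
  have "2 \<le> \<bar>y / a\<bar>" using assms a by (simp add: field_simps)
  then show "loc a y = 0" "loc1 a y = 0" "loc2 a y = 0"
    by (simp_all add: loc_def loc1_def loc2_def bump_outer)
qed

lemma loc_nonneg: "0 \<le> loc a y" and loc_le_DU: "loc a y \<le> DU y"
  using bump_nonneg[of "y / a"] bump_le_1[of "y / a"] DU_pos[of y]
  by (auto simp: loc_def mult_left_le_one_le)

lemma loc_le_1: "loc a y \<le> 1"
  using loc_le_DU DU_le_1 by (rule order_trans)

lemma loc_approx_DU: "\<bar>DU y - loc a y\<bar> \<le> 3 * exp (- sqrt 2 * a)"
proof (cases "\<bar>y\<bar> \<le> a")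
  case True
  then have "bump (y / a) = 1" using a by (intro bump_inner) (simp add: field_simps)
  then show ?thesis by (simp add: loc_def)
next
  case False
  then have "DU y \<le> 3 * exp (- sqrt 2 * a)" by (intro DU_decay) simp
  then show ?thesis using loc_nonneg[of y] loc_le_DU[of y] by simp
qed

text \<open>On the plateau of the cutoff the kernel equation makes the residual vanish. Elsewhere
  only terms with a derivative of the cutoff remain, and they multiply \<open>DU\<close> or its
  derivative at distance more than \<open>a\<close> from the centre. The bounds \<open>3\<close> and
  \<open>2 * 6\<close> for these two terms add up to 15.\<close>

lemma loc_residual:
  assumes B: "1 \<le> B" "\<And>s. \<bar>bump1 s\<bar> \<le> B" "\<And>s. \<bar>bump2 s\<bar> \<le> B"
  shows "\<bar>loc2 a y - f' (U y) * loc a y\<bar> \<le> 15 * B * exp (- sqrt 2 * a)"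
proof (cases "\<bar>y\<bar> \<le> a")
  case True
  then have "\<bar>y / a\<bar> \<le> 1" using a by (simp add: field_simps)
  then have "loc2 a y - f' (U y) * loc a y = 0" by (simp add: loc_def loc2_def bump_inner)
  then show ?thesis using B(1) by simp
next
  case False
  let ?e = "exp (- sqrt 2 * a)"
  have D: "\<bar>DU y\<bar> \<le> 3 * ?e" using DU_decay[of a y] False DU_pos[of y] by simp
  have s: "sqrt 2 \<le> 2" by (rule real_le_lsqrt) auto
  have "\<bar>- sqrt 2 * U y * DU y\<bar> = (sqrt 2 * \<bar>U y\<bar>) * \<bar>DU y\<bar>" by (simp add: abs_mult)
  also have "\<dots> \<le> (2 * 1) * (3 * ?e)" using D s abs_U_less[of y] by (intro mult_mono) auto
  finally have D2: "\<bar>- sqrt 2 * U y * DU y\<bar> \<le> 6 * ?e" by simp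
  have b1: "\<bar>bump1 (y / a) / a\<bar> \<le> B / 1" unfolding abs_divide using a B(1) by (intro frac_le B(2)) auto
  have "1 \<le> a\<^sup>2" using a by (simp add: one_le_power)
  then have b2: "\<bar>bump2 (y / a) / a\<^sup>2\<bar> \<le> B / 1" unfolding abs_divide using B(1) by (intro frac_le B(3)) auto
  have "loc2 a y - f' (U y) * loc a y = bump2 (y / a) / a\<^sup>2 * DU y + 2 * (bump1 (y / a) / a * (- sqrt 2 * U y * DU y))"
    by (simp add: loc_def loc2_def)
  moreover have "\<bar>bump2 (y / a) / a\<^sup>2 * DU y\<bar> \<le> B * (3 * ?e)"
    unfolding abs_mult using b2 D B(1) by (intro mult_mono) auto
  moreover have "\<bar>bump1 (y / a) / a * (- sqrt 2 * U y * DU y)\<bar> \<le> B * (6 * ?e)"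
    unfolding abs_mult[of "bump1 (y / a) / a"] using b1 D2 B(1) by (intro mult_mono) auto
  moreover have "\<bar>p + 2 * q\<bar> \<le> 15 * B * ?e" if "\<bar>p\<bar> \<le> B * (3 * ?e)" "\<bar>q\<bar> \<le> B * (6 * ?e)" for p q :: real
    using that unfolding abs_le_iff by (simp add: algebra_simps)
  ultimately show ?thesis by (simp only:)
qed

lemma integrable_of_support:
  fixes F :: "real \<Rightarrow> real"
  assumes "continuous_on UNIV F" "\<And>y. 2 * a \<le> \<bar>y\<bar> \<Longrightarrow> F y = 0"
  shows "integrable lborel F"
proof -
  have "set_integrable lborel {- (2 * a)..2 * a} F"
    by (intro set_integrable_continuous continuous_on_subset[OF assms(1)]) simp
  moreover have "(\<lambda>y. indicator {- (2 * a)..2 * a} y *\<^sub>R F y) = F"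
    using assms(2) by (force simp: indicator_def fun_eq_iff)
  ultimately show ?thesis by (simp add: set_integrable_def)
qed

lemma integrable_loc: "integrable lborel (loc a)" "integrable lborel (\<lambda>y. (loc a y)\<^sup>2)"
  using a by (auto intro!: integrable_of_support continuous_on_loc continuous_intros simp: loc_outer)

lemma integral_loc_ge: "2 * U a \<le> (LINT y|lborel. loc a y)"
proof -
  have "(LINT y:{-a..a}|lborel. DU y) = U a - U (- a)"
    using a by (intro set_integral_derivative continuous_on_DU U_has_derivative) simp
  moreover have "(LINT y:{-a..a}|lborel. DU y) \<le> (LINT y|lborel. loc a y)"
    unfolding set_lebesgue_integral_def
  proof (intro integral_mono integrable_loc)
    show "integrable lborel (\<lambda>y. indicator {-a..a} y *\<^sub>R DU y)"
      using set_integrable_continuous[OF continuous_on_DU] unfolding set_integrable_def .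
    fix y
    show "indicator {-a..a} y *\<^sub>R DU y \<le> loc a y"
    proof (cases "y \<in> {-a..a}")
      case True
      then have "bump (y / a) = 1" using a by (intro bump_inner) (auto simp: field_simps abs_le_iff)
      then show ?thesis using True by (simp add: loc_def)
    qed (simp add: loc_nonneg)
  qed
  ultimately show ?thesis by simp
qed

text \<open>Only the pointwise maximum \<open>1 / sqrt 2\<close> of \<open>DU\<close> is used. The
  comparison of the square with the mean that results is sharp enough for the constant in front of
  \<open>\<epsilon>\<close>, without computing the integral of the square.\<close>

lemma integral_loc_square_le: "(LINT y|lborel. (loc a y)\<^sup>2) \<le> (LINT y|lborel. loc a y) / sqrt 2"
proof -
  have "(LINT y|lborel. (loc a y)\<^sup>2) \<le> (LINT y|lborel. loc a y / sqrt 2)"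
  proof (intro integral_mono integrable_loc)
    show "integrable lborel (\<lambda>y. loc a y / sqrt 2)" using integrable_loc(1) by simp
    fix y
    have "loc a y * loc a y \<le> loc a y * (1 / sqrt 2)"
      using loc_le_DU[of y] DU_le[of y] loc_nonneg[of y] by (intro mult_left_mono) auto
    then show "(loc a y)\<^sup>2 \<le> loc a y / sqrt 2" by (simp add: power2_eq_square)
  qed
  then show ?thesis by simp
qed

text \<open>A positive lower bound independent of \<open>a\<close>, hence of
  \<open>\<epsilon>\<close>, for the denominators of the layer coefficients. On
  \<open>{0..1}\<close> the cutoff equals 1 and \<open>DU\<close> is smallest at the right
  end.\<close>

lemma integral_loc_square_ge: "(DU 1)\<^sup>2 \<le> (LINT y|lborel. (loc a y)\<^sup>2)"
proof -
  have "(LINT y:{0..1::real}|lborel. (DU 1)\<^sup>2) \<le> (LINT y|lborel. (loc a y)\<^sup>2)"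
    unfolding set_lebesgue_integral_def
  proof (intro integral_mono integrable_loc)
    show "integrable lborel (\<lambda>y. indicator {0..1::real} y *\<^sub>R (DU 1)\<^sup>2)"
      by (rule integrable_scaleR_left) simp
    fix y :: real
    show "indicator {0..1} y *\<^sub>R (DU 1)\<^sup>2 \<le> (loc a y)\<^sup>2"
    proof (cases "y \<in> {0..1}")
      case True
      then have "bump (y / a) = 1" using a by (intro bump_inner) (auto simp: field_simps abs_le_iff)
      moreover have "(U y)\<^sup>2 \<le> (U 1)\<^sup>2" using True U_mono[of 0 y] U_mono[of y 1] by (intro power_mono) (auto simp: U_def)
      then have "DU 1 \<le> DU y" by (simp add: DU_def divide_right_mono)
      ultimately show ?thesis using True DU_pos[of 1] by (simp add: loc_def power_mono)
    qed simp
  qed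
  then show ?thesis by (simp add: set_lebesgue_integral_def)
qed

text \<open>An equality and not an estimate, since the support of radius
  \<open>2 * a * \<epsilon>\<close> around \<open>h\<close> lies inside the unit interval and no
  tail is lost.\<close>

lemma set_integral_rescale:
  fixes F :: "real \<Rightarrow> real"
  assumes F: "\<And>y. 2 * a \<le> \<bar>y\<bar> \<Longrightarrow> F y = 0" and e: "0 < \<epsilon>" and h: "2 * a * \<epsilon> \<le> h" "2 * a * \<epsilon> \<le> 1 - h"
  shows "(LINT x:{0..1}|lborel. F ((x - h) / \<epsilon>)) = \<epsilon> * (LINT y|lborel. F y)"
proof -
  have "indicator {0..1} x *\<^sub>R F ((x - h) / \<epsilon>) = F ((x - h) / \<epsilon>)" for x
  proof (cases "x \<in> {0..1}")
    case False
    then have "2 * a * \<epsilon> \<le> \<bar>x - h\<bar>" using h by auto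
    then have "F ((x - h) / \<epsilon>) = 0" using e by (intro F) (simp add: field_simps abs_divide)
    then show ?thesis by simp
  qed simp
  then have "(LINT x:{0..1}|lborel. F ((x - h) / \<epsilon>)) = (LINT x|lborel. F ((x - h) / \<epsilon>))"
    unfolding set_lebesgue_integral_def by (simp only:)
  then show ?thesis
    using lborel_integral_real_affine[of \<epsilon> "\<lambda>x. F ((x - h) / \<epsilon>)" h] e by simp
qed

end

section \<open>Localisation around the layers\<close>

text \<open>
  No complementary cutoff is needed: the part of \<open>q\<^sup>2\<close> not seen by \<open>b\<close> is simply dropped, because
  where \<open>b \<noteq> 1\<close> the potential \<open>G\<close> alone provides the gap.
\<close>

lemma localisation_scalar:
  fixes F G b b1 w q :: real
  assumes \<delta>: "0 < \<delta>" and b: "0 \<le> b" "b \<le> 1" and b1: "\<bar>b1\<bar> \<le> m"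
    and FG: "G - t \<le> F" and G: "- 1 \<le> G" "b = 1 \<or> 1 \<le> G"
    and lam: "0 \<le> lam" and c: "(1 + \<delta>) * (t + m\<^sup>2 / \<delta> + l) \<le> min 1 lam - \<delta>"
  shows "(b1 * w + b * q)\<^sup>2 + (G - lam) * (b * w)\<^sup>2 \<le> (1 + \<delta>) * (q\<^sup>2 + F * w\<^sup>2 - l * w\<^sup>2)"
proof -
  \<comment> \<open>Weighted Young inequality: the gradient of the cutoff pays
    \<open>1 / \<delta>\<close>, so that \<open>q\<close> is charged only the factor
    \<open>1 + \<delta>\<close>.\<close>
  have cross: "(x + y)\<^sup>2 \<le> (1 + \<delta>) * (x\<^sup>2 / \<delta> + y\<^sup>2)" for x y :: real
  proof -
    have "0 \<le> (x - \<delta> * y)\<^sup>2 / \<delta>" using \<delta> by simp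
    also have "\<dots> = (1 + \<delta>) * (x\<^sup>2 / \<delta> + y\<^sup>2) - (x + y)\<^sup>2"
      using \<delta> by (simp add: field_simps power2_eq_square)
    finally show ?thesis by simp
  qed
  have b2: "0 \<le> b\<^sup>2" "b\<^sup>2 \<le> 1" using b by (auto intro: power_le_one)
  have m2: "b1\<^sup>2 \<le> m\<^sup>2" using power_mono[OF b1, of 2] by simp
  have "(b1 * w + b * q)\<^sup>2 \<le> (1 + \<delta>) * ((b1 * w)\<^sup>2 / \<delta> + (b * q)\<^sup>2)" by (rule cross)
  also have "\<dots> \<le> (1 + \<delta>) * (m\<^sup>2 / \<delta> * w\<^sup>2 + q\<^sup>2)"
  proof (intro mult_left_mono add_mono)
    have "b1\<^sup>2 * w\<^sup>2 / \<delta> \<le> m\<^sup>2 * w\<^sup>2 / \<delta>" using m2 \<delta> by (intro divide_right_mono mult_right_mono) auto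
    then show "(b1 * w)\<^sup>2 / \<delta> \<le> m\<^sup>2 / \<delta> * w\<^sup>2" by (simp add: power_mult_distrib)
    show "(b * q)\<^sup>2 \<le> q\<^sup>2" unfolding power_mult_distrib using b2 by (simp add: mult_left_le_one_le)
  qed (use \<delta> in auto)
  finally have 1: "(b1 * w + b * q)\<^sup>2 \<le> (1 + \<delta>) * (m\<^sup>2 / \<delta> * w\<^sup>2 + q\<^sup>2)" .
  define K where "K = (1 + \<delta>) * (t + m\<^sup>2 / \<delta> + l)"
  define M where "M = min 1 lam"
  have M: "M \<le> 1" "M \<le> lam" "K \<le> M - \<delta>" using c by (simp_all add: M_def K_def)
  \<comment> \<open>On the plateau the subtracted \<open>lam\<close> pays for \<open>K\<close>, and
    \<open>G \<ge> - 1\<close> limits the loss from the factor \<open>1 + \<delta>\<close> to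
    \<open>\<delta>\<close>. Off the plateau the minimum \<open>M\<close> is distributed with
    weights \<open>b\<^sup>2\<close> and \<open>1 - b\<^sup>2\<close> between \<open>lam\<close> and
    \<open>G\<close>.\<close>
  have 2: "(G - lam) * b\<^sup>2 + K \<le> (1 + \<delta>) * G"
  proof (cases "b = 1")
    case True
    have "\<delta> * (- 1) \<le> \<delta> * G" using \<delta> G by (intro mult_left_mono) auto
    then show ?thesis using M True by (simp add: algebra_simps)
  next
    case False
    then have G1: "1 \<le> G" using G by simp
    have "M * (1 - b\<^sup>2) \<le> G * (1 - b\<^sup>2)" "M * b\<^sup>2 \<le> lam * b\<^sup>2"
      using G1 b2 M by (auto intro!: mult_right_mono)
    moreover have "0 \<le> \<delta> * G" using \<delta> G1 by simp
    ultimately show ?thesis using M \<delta> by (simp add: algebra_simps)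
  qed
  have "(1 + \<delta>) * (G - t) \<le> (1 + \<delta>) * F" using FG \<delta> by (intro mult_left_mono) auto
  with 2 have "(G - lam) * b\<^sup>2 + (1 + \<delta>) * (m\<^sup>2 / \<delta> + l) \<le> (1 + \<delta>) * F" by (simp add: K_def algebra_simps)
  then have "((G - lam) * b\<^sup>2 + (1 + \<delta>) * (m\<^sup>2 / \<delta> + l)) * w\<^sup>2 \<le> ((1 + \<delta>) * F) * w\<^sup>2"
    by (rule mult_right_mono) simp
  with 1 show ?thesis by (simp add: algebra_simps power_mult_distrib)
qed

lemma set_integral_sum:
  fixes F :: "'i \<Rightarrow> 'a \<Rightarrow> real"
  assumes "\<And>j. j \<in> S \<Longrightarrow> set_integrable M A (F j)"
  shows "set_integrable M A (\<lambda>x. \<Sum>j\<in>S. F j x)"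
    and "(LINT x:A|M. \<Sum>j\<in>S. F j x) = (\<Sum>j\<in>S. LINT x:A|M. F j x)"
  using assms unfolding set_lebesgue_integral_def set_integrable_def scaleR_sum_right
  by (auto intro!: Bochner_Integration.integrable_sum Bochner_Integration.integral_sum simp del: real_scaleR_def)

text \<open>Here \<open>a\<close> is the cutoff radius in layer widths. A support has radius
  \<open>2 * a * \<epsilon>\<close>, so the separation \<open>4 * a * \<epsilon>\<close> makes
  supports disjoint and the end conditions keep them inside the unit interval. The single error
  \<open>\<tau>\<close> dominates the tails of all \<open>N + 1\<close> kinks, each at most
  \<open>2 * exp (- sqrt 2 * a)\<close>, together with the error \<open>E\<close> of the
  correction.\<close>

locale layers =
  fixes N :: nat and h :: "nat \<Rightarrow> real" and a \<epsilon> E \<tau> B :: real and u :: "real \<Rightarrow> real"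
  assumes eps: "0 < \<epsilon>" and a: "1 \<le> a"
    and separated: "\<And>i j. i < j \<Longrightarrow> j \<le> N \<Longrightarrow> 4 * a * \<epsilon> \<le> h j - h i"
    and left: "2 * a * \<epsilon> \<le> h 0" and right: "2 * a * \<epsilon> \<le> 1 - h N"
    and u_continuous: "continuous_on {0..1} u"
    and u_approx: "\<And>x. x \<in> {0..1} \<Longrightarrow> \<bar>u x - ((\<Sum>j\<le>N. (- 1) ^ j * U ((x - h j) / \<epsilon>)) + bN N)\<bar> \<le> E"
    and E: "0 \<le> E" and tau: "2 * (real N + 1) * exp (- sqrt 2 * a) + E \<le> \<tau>" "\<tau> \<le> 1 / 100"
    and B: "1 \<le> B" "\<And>s. \<bar>bump1 s\<bar> \<le> B" "\<And>s. \<bar>bump2 s\<bar> \<le> B"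
begin

abbreviation y where "y j x \<equiv> (x - h j) / \<epsilon>"

lemma exp_le_tau: "exp (- sqrt 2 * a) \<le> \<tau> / 2" and tau_pos: "0 < \<tau>"
proof -
  have "2 * exp (- sqrt 2 * a) \<le> 2 * (real N + 1) * exp (- sqrt 2 * a)" by (intro mult_right_mono) auto
  then show "exp (- sqrt 2 * a) \<le> \<tau> / 2" using tau(1) E by linarith
  then show "0 < \<tau>" using exp_gt_zero[of "- sqrt 2 * a"] by linarith
qed

lemma a_eps_pos: "0 < a * \<epsilon>"
  using a eps by simp

lemma layer_inside: assumes "j \<le> N" shows "2 * a * \<epsilon> \<le> h j" "2 * a * \<epsilon> \<le> 1 - h j"
proof -
  show "2 * a * \<epsilon> \<le> h j" using separated[of 0 j] left assms a_eps_pos by (cases "j = 0") auto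
  show "2 * a * \<epsilon> \<le> 1 - h j" using separated[of j N] right assms a_eps_pos by (cases "j = N") auto
qed

text \<open>For a layer at minimal distance, \<open>x\<close> lies on the near side of the midpoint
  to every other layer, and midpoints are at least \<open>2 * a * \<epsilon>\<close> away from the
  layers. The distances are signed because the side decides whether another kink is close to 1 or to
  -1.\<close>

lemma nearest_layer:
  obtains j where "j \<le> N" "\<And>i. i < j \<Longrightarrow> 2 * a * \<epsilon> \<le> x - h i" "\<And>i. j < i \<Longrightarrow> i \<le> N \<Longrightarrow> 2 * a * \<epsilon> \<le> h i - x"
proof -
  have "Min ((\<lambda>j. \<bar>x - h j\<bar>) ` {..N}) \<in> (\<lambda>j. \<bar>x - h j\<bar>) ` {..N}" by (intro Min_in) auto
  then obtain j where j: "j \<le> N" "Min ((\<lambda>j. \<bar>x - h j\<bar>) ` {..N}) = \<bar>x - h j\<bar>" by blast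
  have m: "\<bar>x - h j\<bar> \<le> \<bar>x - h i\<bar>" if "i \<le> N" for i
    unfolding j(2)[symmetric] using that by (intro Min_le) auto
  show thesis
  proof
    show "2 * a * \<epsilon> \<le> x - h i" if "i < j" for i
      using m[of i] separated[of i j] that j(1) a_eps_pos by (simp add: abs_if split: if_splits)
    show "2 * a * \<epsilon> \<le> h i - x" if "j < i" "i \<le> N" for i
      using m[of i] separated[of j i] that a_eps_pos by (simp add: abs_if split: if_splits)
  qed (rule j)
qed

text \<open>Explains the constant \<open>bN\<close>: it cancels exactly the kinks that have
  saturated at 1 on the left and at -1 on the right. In the induction, which starts at
  \<open>j\<close>, the new term is offset by the change of \<open>bN\<close>.\<close>

lemma alternating_sum_saturated:
  assumes "j \<le> M"
  shows "(\<Sum>i\<le>M. (- 1) ^ i * (if i < j then 1 else if i = j then c else - 1)) + bN M = (- 1) ^ j * c"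
  using assms
proof (induction M rule: dec_induct)
  case base
  have "(\<Sum>i<j. (- 1) ^ i) = (1 - (- 1) ^ j) / (2 :: real)" by (induction j) (auto simp: field_simps)
  moreover have "(\<Sum>i\<le>j. (- 1) ^ i * (if i < j then 1 else if i = j then c else - 1)) = (\<Sum>i<j. (- 1) ^ i) + (- 1) ^ j * c"
    unfolding lessThan_Suc_atMost[symmetric] by (simp add: lessThan_Suc)
  ultimately show ?case by (simp add: bN_def field_simps)
next
  case (step M)
  then show ?case by (simp add: bN_def field_simps)
qed

lemma u_near_layer:
  assumes x: "x \<in> {0..1}" and j: "j \<le> N"
    and l: "\<And>i. i < j \<Longrightarrow> 2 * a * \<epsilon> \<le> x - h i" and r: "\<And>i. j < i \<Longrightarrow> i \<le> N \<Longrightarrow> 2 * a * \<epsilon> \<le> h i - x"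
  shows "\<bar>u x - (- 1) ^ j * U (y j x)\<bar> \<le> \<tau>"
proof -
  define s where "s i = (if i < j then 1 else if i = j then U (y j x) else - 1)" for i
  have b: "\<bar>U (y i x) - s i\<bar> \<le> 2 * exp (- sqrt 2 * a)" if "i \<le> N" for i
  proof -
    have sat: "1 - U z \<le> 2 * exp (- sqrt 2 * a)" if "a \<le> z" for z
    proof -
      have "exp (- sqrt 2 * z) \<le> exp (- sqrt 2 * a)" using that by simp
      then show ?thesis using one_minus_U[of z] by linarith
    qed
    consider "i < j" | "i = j" | "j < i" by linarith
    then show ?thesis
    proof cases
      case 1
      then have "a \<le> y i x" using l[of i] eps a_eps_pos by (simp add: field_simps)
      then show ?thesis using sat[of "y i x"] abs_U_less[of "y i x"] 1 by (simp add: s_def)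
    next
      case 2
      then show ?thesis by (simp add: s_def)
    next
      case 3
      then have "a \<le> - y i x" using r[of i] that eps a_eps_pos by (simp add: field_simps)
      then have "1 + U (y i x) \<le> 2 * exp (- sqrt 2 * a)" using sat[of "- y i x"] U_minus[of "y i x"] by linarith
      then show ?thesis using abs_U_less[of "y i x"] 3 by (simp add: s_def)
    qed
  qed
  have "(\<Sum>i\<le>N. (- 1) ^ i * U (y i x)) + bN N - (- 1) ^ j * U (y j x)
      = (\<Sum>i\<le>N. (- 1) ^ i * U (y i x)) - (\<Sum>i\<le>N. (- 1) ^ i * s i)"
    using alternating_sum_saturated[OF j, of "U (y j x)"] unfolding s_def by linarith
  also have "\<dots> = (\<Sum>i\<le>N. (- 1) ^ i * (U (y i x) - s i))" by (simp add: sum_subtractf right_diff_distrib)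
  finally have eq: "(\<Sum>i\<le>N. (- 1) ^ i * U (y i x)) + bN N - (- 1) ^ j * U (y j x) = \<dots>" .
  have "\<bar>\<Sum>i\<le>N. (- 1) ^ i * (U (y i x) - s i)\<bar> \<le> (\<Sum>i\<le>N. \<bar>(- 1) ^ i * (U (y i x) - s i)\<bar>)" by (rule sum_abs)
  also have "\<dots> \<le> (\<Sum>i\<le>N. 2 * exp (- sqrt 2 * a))"
    using b by (intro sum_mono) (auto simp: abs_mult power_abs)
  also have "\<dots> = 2 * (real N + 1) * exp (- sqrt 2 * a)" by simp
  finally show ?thesis using eq u_approx[OF x] tau(1) by linarith
qed

text \<open>As \<open>f'\<close> is even, the orientation of the layer drops out. The difference of
  squares factors, and the sum of the two arguments is at most \<open>2 + \<tau> \<le> 3\<close>,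
  which gives \<open>3 * 3\<close>.\<close>

lemma f'_near_layer:
  assumes "\<bar>v - (- 1) ^ j * U z\<bar> \<le> \<tau>"
  shows "\<bar>f' v - f' (U z)\<bar> \<le> 9 * \<tau>"
proof -
  define s :: real where "s = (- 1) ^ j * U z"
  have s2: "s\<^sup>2 = (U z)\<^sup>2" by (simp add: s_def power_mult_distrib flip: power_mult)
  have s1: "\<bar>s\<bar> \<le> 1" using abs_U_less[of z] by (simp add: s_def abs_mult power_abs)
  have "f' v - f' (U z) = 3 * ((v - s) * (v + s))"
    unfolding f'_def s2[symmetric] by (simp add: power2_eq_square algebra_simps)
  then have "\<bar>f' v - f' (U z)\<bar> = 3 * (\<bar>v - s\<bar> * \<bar>v + s\<bar>)" by (simp add: abs_mult)
  also have "\<dots> \<le> 3 * (\<tau> * 3)"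
    using assms s1 tau(2) tau_pos by (intro mult_left_mono mult_mono) (auto simp: s_def[symmetric])
  finally show ?thesis by simp
qed

lemma f'_bounds:
  "- 1 \<le> f' (U z)" "a \<le> \<bar>z\<bar> \<Longrightarrow> 1 \<le> f' (U z)"
proof -
  show "- 1 \<le> f' (U z)" by (simp add: f'_def)
  assume z: "a \<le> \<bar>z\<bar>"
  have "exp (- sqrt 2 * \<bar>z\<bar>) \<le> exp (- sqrt 2 * a)" using z by simp
  then have "1 - U \<bar>z\<bar> \<le> 1 / 100" using one_minus_U[of "\<bar>z\<bar>"] exp_le_tau tau(2) by linarith
  then have "(99 / 100)\<^sup>2 \<le> (U \<bar>z\<bar>)\<^sup>2" by (intro power_mono) auto
  moreover have "(U \<bar>z\<bar>)\<^sup>2 = (U z)\<^sup>2" by (cases "0 \<le> z") auto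
  ultimately show "1 \<le> f' (U z)" by (simp add: f'_def power2_eq_square)
qed

lemma far_from_other_layers:
  assumes j: "\<And>i. i < j \<Longrightarrow> 2 * a * \<epsilon> \<le> x - h i" "\<And>i. j < i \<Longrightarrow> i \<le> N \<Longrightarrow> 2 * a * \<epsilon> \<le> h i - x"
    and i: "i \<le> N" "i \<noteq> j"
  shows "2 * a \<le> \<bar>y i x\<bar>"
proof -
  have "2 * a * \<epsilon> \<le> \<bar>x - h i\<bar>" using j(1)[of i] j(2)[of i] i by (cases "i < j") auto
  then show ?thesis using eps by (simp add: abs_divide field_simps)
qed

section \<open>Combinations of truncated kernel functions\<close>

definition kernel :: "(nat \<Rightarrow> real) \<Rightarrow> real \<Rightarrow> real" where
  "kernel c x = (\<Sum>j\<le>N. c j * loc a (y j x))"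
definition kernel1 :: "(nat \<Rightarrow> real) \<Rightarrow> real \<Rightarrow> real" where
  "kernel1 c x = (\<Sum>j\<le>N. c j * (loc1 a (y j x) / \<epsilon>))"
definition kernel2 :: "(nat \<Rightarrow> real) \<Rightarrow> real \<Rightarrow> real" where
  "kernel2 c x = (\<Sum>j\<le>N. c j * (loc2 a (y j x) / \<epsilon>\<^sup>2))"

lemma y_has_derivative: "((\<lambda>x. y j x) has_real_derivative 1 / \<epsilon>) (at x)"
  using eps by (auto intro!: derivative_eq_intros)

lemma kernel_has_derivative: "(kernel c has_real_derivative kernel1 c x) (at x)"
  unfolding kernel_def[abs_def] kernel1_def
  by (intro DERIV_sum DERIV_cmult DERIV_cong[OF DERIV_chain2[OF loc_has_derivative[OF a] y_has_derivative]]) simp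

lemma kernel1_has_derivative: "(kernel1 c has_real_derivative kernel2 c x) (at x)"
  unfolding kernel1_def[abs_def] kernel2_def
  by (intro DERIV_sum DERIV_cmult DERIV_cong[OF DERIV_cdivide[OF DERIV_chain2[OF loc1_has_derivative[OF a] y_has_derivative]]])
     (simp add: power2_eq_square)

lemma continuous_on_loc_y:
  "continuous_on S (\<lambda>x. loc a (y j x))" "continuous_on S (\<lambda>x. loc1 a (y j x))" "continuous_on S (\<lambda>x. loc2 a (y j x))"
  using a eps by (auto intro!: continuous_on_compose2[OF continuous_on_loc(1) _ subset_UNIV]
    continuous_on_compose2[OF continuous_on_loc(2) _ subset_UNIV]
    continuous_on_compose2[OF continuous_on_loc(3) _ subset_UNIV] continuous_intros)

lemma continuous_on_kernel: "continuous_on S (kernel c)" "continuous_on S (kernel1 c)" "continuous_on S (kernel2 c)"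
  unfolding kernel_def[abs_def] kernel1_def[abs_def] kernel2_def[abs_def] using eps
  by (intro continuous_intros continuous_on_loc_y; simp)+

text \<open>A general \<open>v\<close> satisfies no boundary condition; the boundary terms of the
  integration by parts vanish because the kernel functions do so near both ends.\<close>

lemma kernel_boundary: "kernel1 c 0 = 0" "kernel1 c 1 = 0"
proof -
  have "2 * a \<le> \<bar>y j 0\<bar>" "2 * a \<le> \<bar>y j 1\<bar>" if "j \<le> N" for j
    using layer_inside[OF that] eps by (auto simp: abs_divide field_simps abs_if)
  then show "kernel1 c 0 = 0" "kernel1 c 1 = 0"
    unfolding kernel1_def using loc_outer(2)[OF a] by (auto intro!: sum.neutral)
qed

text \<open>At each point only the nearest layer contributes, so there is no factor
  \<open>N\<close>. Of the 24, a part 15 comes from the cutoff and 9 from exchanging the potential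
  of \<open>u\<close> for that of a single kink.\<close>

lemma kernel_residual:
  assumes x: "x \<in> {0..1}" and c: "\<And>j. j \<le> N \<Longrightarrow> \<bar>c j\<bar> \<le> C"
  shows "\<bar>\<epsilon>\<^sup>2 * kernel2 c x - f' (u x) * kernel c x\<bar> \<le> C * (24 * B * \<tau>)"
proof -
  obtain j where j: "j \<le> N" "\<And>i. i < j \<Longrightarrow> 2 * a * \<epsilon> \<le> x - h i" "\<And>i. j < i \<Longrightarrow> i \<le> N \<Longrightarrow> 2 * a * \<epsilon> \<le> h i - x"
    using nearest_layer[of x] by blast
  have z: "loc a (y i x) = 0" "loc2 a (y i x) = 0" if "i \<le> N" "i \<noteq> j" for i
    using loc_outer[OF a far_from_other_layers[OF j(2,3) that]] by auto
  have single: "(\<Sum>i\<le>N. p i) = p j" if "\<And>i. i \<le> N \<Longrightarrow> i \<noteq> j \<Longrightarrow> p i = 0" for p :: "nat \<Rightarrow> real"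
    using j(1) that by (subst sum.remove[of _ j]) (auto intro!: sum.neutral)
  have "\<epsilon>\<^sup>2 * kernel2 c x - f' (u x) * kernel c x
      = c j * ((loc2 a (y j x) - f' (U (y j x)) * loc a (y j x)) - (f' (u x) - f' (U (y j x))) * loc a (y j x))"
    unfolding kernel_def kernel2_def using eps
    by (subst (1 2) single) (auto simp: z algebra_simps)
  then have eq: "\<bar>\<epsilon>\<^sup>2 * kernel2 c x - f' (u x) * kernel c x\<bar>
      = \<bar>c j\<bar> * \<bar>(loc2 a (y j x) - f' (U (y j x)) * loc a (y j x)) - (f' (u x) - f' (U (y j x))) * loc a (y j x)\<bar>"
    by (simp add: abs_mult)
  have 1: "\<bar>loc2 a (y j x) - f' (U (y j x)) * loc a (y j x)\<bar> \<le> 15 * B * exp (- sqrt 2 * a)"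
    by (rule loc_residual[OF a B])
  have 2: "\<bar>(f' (u x) - f' (U (y j x))) * loc a (y j x)\<bar> \<le> 9 * \<tau> * 1" unfolding abs_mult
    using f'_near_layer[OF u_near_layer[OF x j(1-3)]] loc_nonneg[OF a, of "y j x"] loc_le_1[OF a, of "y j x"] tau_pos
    by (intro mult_mono) auto
  have "15 * B * exp (- sqrt 2 * a) \<le> 15 * B * \<tau>"
    using exp_le_tau tau_pos B(1) by (intro mult_left_mono) auto
  moreover have "9 * \<tau> * 1 \<le> 9 * \<tau> * B" using B(1) tau_pos by (intro mult_left_mono) auto
  ultimately have "\<bar>(loc2 a (y j x) - f' (U (y j x)) * loc a (y j x)) - (f' (u x) - f' (U (y j x))) * loc a (y j x)\<bar> \<le> 24 * B * \<tau>"
    using 1 2 by (simp add: algebra_simps)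
  then show ?thesis unfolding eq using c[OF j(1)] by (intro mult_mono) auto
qed

section \<open>Coercivity on the complement of the kernel functions\<close>

definition cut :: "nat \<Rightarrow> real \<Rightarrow> real" where "cut j x = bump (y j x / a)"
definition cut1 :: "nat \<Rightarrow> real \<Rightarrow> real" where "cut1 j x = bump1 (y j x / a) / a / \<epsilon>"

lemma cut_has_derivative: "(cut j has_real_derivative cut1 j x) (at x)"
  unfolding cut_def[abs_def] cut1_def
  by (rule DERIV_cong[OF DERIV_chain2[OF bump_scaled_derivative(1)[OF a] y_has_derivative]]) simp

lemma continuous_on_cut: "continuous_on S (cut j)" "continuous_on S (cut1 j)"
  unfolding cut_def[abs_def] cut1_def[abs_def] using a eps
  by (auto intro!: continuous_intros profile_continuous_intros)

lemma cut_outer: assumes "2 * a \<le> \<bar>y j x\<bar>" shows "cut j x = 0" "cut1 j x = 0"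
proof -
  have "2 \<le> \<bar>z / a\<bar>" if "2 * a \<le> \<bar>z\<bar>" for z using that a by (simp add: field_simps)
  from this[OF assms] have "2 \<le> \<bar>y j x / a\<bar>" .
  then show "cut j x = 0" "cut1 j x = 0" by (simp_all add: cut_def cut1_def bump_outer)
qed

text \<open>Each \<open>T j\<close> has nonnegative integral by the whole-line gap. At each point at
  most the term of the nearest layer is nonzero, and the scalar inequality bounds it by
  \<open>1 + \<delta>\<close> times the integrand of \<open>- Lform - l * nsq\<close>. Integrating
  the sum therefore shows that this last quantity is nonnegative.\<close>

lemma localised_coercivity:
  assumes lam: "lambda0_prop lam" "0 \<le> lam" and H: "H1 w q"
    and orth: "\<And>j. j \<le> N \<Longrightarrow> (LINT x:{0..1}|lborel. w x * loc a (y j x)) = 0"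
    and \<delta>: "0 < \<delta>" and c: "(1 + \<delta>) * (9 * \<tau> + (B / a)\<^sup>2 / \<delta> + l) \<le> min 1 lam - \<delta>"
  shows "Lform \<epsilon> u w q \<le> - l * nsq w"
proof -
  define T where "T j x = \<epsilon>\<^sup>2 * (cut1 j x * w x + cut j x * q x)\<^sup>2 + f' (U (y j x)) * (cut j x * w x)\<^sup>2
    - lam * (cut j x * w x)\<^sup>2" for j x
  have i: "set_integrable lborel {0..1} (\<lambda>x. (q x)\<^sup>2)" using H unfolding H1_def by blast
  have cw: "continuous_on {0..1} w" by (rule H1_continuous_on[OF H])
  have cy: "continuous_on S (\<lambda>x. y j x)" for S j using eps by (intro continuous_intros) simp
  have Hj: "H1 (\<lambda>x. cut j x * w x) (\<lambda>x. cut1 j x * w x + cut j x * q x)" for j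
    by (rule H1_mult[OF H continuous_on_cut(2) cut_has_derivative])
  have ij: "set_integrable lborel {0..1} (\<lambda>x. (cut1 j x * w x + cut j x * q x)\<^sup>2)" for j
    using Hj unfolding H1_def by blast
  have i1: "set_integrable lborel {0..1} (\<lambda>x. \<epsilon>\<^sup>2 * (cut1 j x * w x + cut j x * q x)\<^sup>2 + f' (U (y j x)) * (cut j x * w x)\<^sup>2)" for j
    by (intro set_integral_add set_integrable_mult_right ij set_integrable_continuous continuous_intros
        profile_continuous_intros cy cw continuous_on_cut)
  have i2: "set_integrable lborel {0..1} (\<lambda>x. lam * (cut j x * w x)\<^sup>2)" for j
    by (intro set_integrable_continuous continuous_intros cw continuous_on_cut)
  have iT: "set_integrable lborel {0..1} (T j)" for j
    unfolding T_def[abs_def] by (intro set_integral_diff i1 i2)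
  have T: "0 \<le> (LINT x:{0..1}|lborel. T j x)" if j: "j \<le> N" for j
  proof -
    have "2 * a \<le> \<bar>y j 0\<bar>" "2 * a \<le> \<bar>y j 1\<bar>"
      using layer_inside[OF j] eps by (auto simp: abs_divide field_simps abs_if)
    then have "cut j 0 * w 0 = 0" "cut j 1 * w 1 = 0" by (simp_all add: cut_outer)
    moreover have "(LINT x:{0..1}|lborel. (cut j x * w x) * DU (y j x)) = 0"
      using orth[OF j] by (simp add: loc_def cut_def ac_simps)
    ultimately have "lam * (LINT x:{0..1}|lborel. (cut j x * w x)\<^sup>2)
      \<le> (LINT x:{0..1}|lborel. \<epsilon>\<^sup>2 * (cut1 j x * w x + cut j x * q x)\<^sup>2 + f' (U (y j x)) * (cut j x * w x)\<^sup>2)"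
      by (rule lambda0_gap_Dirichlet[OF lam(1) eps Hj])
    moreover have "(LINT x:{0..1}|lborel. T j x)
      = (LINT x:{0..1}|lborel. \<epsilon>\<^sup>2 * (cut1 j x * w x + cut j x * q x)\<^sup>2 + f' (U (y j x)) * (cut j x * w x)\<^sup>2)
       - lam * (LINT x:{0..1}|lborel. (cut j x * w x)\<^sup>2)"
      unfolding T_def using set_integral_diff(2)[OF i1 i2] by simp
    ultimately show ?thesis by simp
  qed
  have pointwise: "(\<Sum>j\<le>N. T j x) \<le> (1 + \<delta>) * (\<epsilon>\<^sup>2 * (q x)\<^sup>2 + f' (u x) * (w x)\<^sup>2 - l * (w x)\<^sup>2)"
    if x: "x \<in> {0..1}" for x
  proof -
    obtain j where j: "j \<le> N" "\<And>i. i < j \<Longrightarrow> 2 * a * \<epsilon> \<le> x - h i" "\<And>i. j < i \<Longrightarrow> i \<le> N \<Longrightarrow> 2 * a * \<epsilon> \<le> h i - x"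
      using nearest_layer[of x] by blast
    have "T i x = 0" if "i \<le> N" "i \<noteq> j" for i
      using cut_outer[OF far_from_other_layers[OF j(2,3) that]] by (auto simp: T_def)
    then have "(\<Sum>i\<le>N. T i x) = T j x"
      using j(1) by (subst sum.remove[of _ j]) (auto intro!: sum.neutral)
    \<comment> \<open>The factor \<open>\<epsilon>\<close> is moved into the derivatives, where it
      cancels the \<open>1 / \<epsilon>\<close> in \<open>cut1\<close> and leaves a gradient of size
      \<open>B / a\<close>.\<close>
    also have "\<dots> = ((\<epsilon> * cut1 j x) * w x + cut j x * (\<epsilon> * q x))\<^sup>2 + (f' (U (y j x)) - lam) * (cut j x * w x)\<^sup>2"
      by (simp add: T_def power2_eq_square algebra_simps)
    also have "\<dots> \<le> (1 + \<delta>) * ((\<epsilon> * q x)\<^sup>2 + f' (u x) * (w x)\<^sup>2 - l * (w x)\<^sup>2)"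
    proof (rule localisation_scalar[OF \<delta> _ _ _ _ f'_bounds(1) _ lam(2) c])
      show "0 \<le> cut j x" "cut j x \<le> 1" by (simp_all add: cut_def bump_nonneg bump_le_1)
      show "\<bar>\<epsilon> * cut1 j x\<bar> \<le> B / a" using B(2)[of "y j x / a"] eps a
        by (simp add: cut1_def abs_mult abs_divide divide_right_mono)
      show "f' (U (y j x)) - 9 * \<tau> \<le> f' (u x)"
        using f'_near_layer[OF u_near_layer[OF x j]] by linarith
      show "cut j x = 1 \<or> 1 \<le> f' (U (y j x))"
      proof (cases "\<bar>y j x\<bar> \<le> a")
        case True
        have "\<bar>z / a\<bar> \<le> 1" if "\<bar>z\<bar> \<le> a" for z using that a by (simp add: field_simps)
        from this[OF True] have "\<bar>y j x / a\<bar> \<le> 1" .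
        then show ?thesis by (simp add: cut_def bump_inner)
      next
        case False
        then show ?thesis using f'_bounds(2) by simp
      qed
    qed
    finally show ?thesis by (simp add: power_mult_distrib)
  qed
  have iu: "set_integrable lborel {0..1} (\<lambda>x. f' (u x) * (w x)\<^sup>2)"
    by (intro set_integrable_continuous continuous_intros continuous_on_f'_comp u_continuous cw)
  have iw: "set_integrable lborel {0..1} (\<lambda>x. (w x)\<^sup>2)" by (intro set_integrable_continuous continuous_intros cw)
  have "0 \<le> (\<Sum>j\<le>N. (LINT x:{0..1}|lborel. T j x))" by (intro sum_nonneg T) simp
  also have "\<dots> = (LINT x:{0..1}|lborel. (\<Sum>j\<le>N. T j x))"
    by (intro set_integral_sum(2)[symmetric] iT)
  also have "\<dots> \<le> (LINT x:{0..1}|lborel. (1 + \<delta>) * (\<epsilon>\<^sup>2 * (q x)\<^sup>2 + f' (u x) * (w x)\<^sup>2 - l * (w x)\<^sup>2))"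
  proof (rule set_integral_mono[OF _ _ pointwise])
    show "set_integrable lborel {0..1} (\<lambda>x. \<Sum>j\<le>N. T j x)"
      by (intro set_integral_sum(1) iT)
    show "set_integrable lborel {0..1} (\<lambda>x. (1 + \<delta>) * (\<epsilon>\<^sup>2 * (q x)\<^sup>2 + f' (u x) * (w x)\<^sup>2 - l * (w x)\<^sup>2))"
      by (intro set_integrable_mult_right set_integral_add set_integral_diff i iu iw)
  qed
  also have "\<dots> = (1 + \<delta>) * (- Lform \<epsilon> u w q - l * nsq w)"
  proof -
    have "(LINT x:{0..1}|lborel. \<epsilon>\<^sup>2 * (q x)\<^sup>2 + f' (u x) * (w x)\<^sup>2 - l * (w x)\<^sup>2)
      = \<epsilon>\<^sup>2 * (LINT x:{0..1}|lborel. (q x)\<^sup>2) + (LINT x:{0..1}|lborel. f' (u x) * (w x)\<^sup>2) - l * (LINT x:{0..1}|lborel. (w x)\<^sup>2)"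
    proof -
      have "(LINT x:{0..1}|lborel. \<epsilon>\<^sup>2 * (q x)\<^sup>2 + f' (u x) * (w x)\<^sup>2 - l * (w x)\<^sup>2)
        = (LINT x:{0..1}|lborel. \<epsilon>\<^sup>2 * (q x)\<^sup>2 + f' (u x) * (w x)\<^sup>2) - (LINT x:{0..1}|lborel. l * (w x)\<^sup>2)"
        by (intro set_integral_diff set_integral_add set_integrable_mult_right i iu iw)
      moreover have "(LINT x:{0..1}|lborel. \<epsilon>\<^sup>2 * (q x)\<^sup>2 + f' (u x) * (w x)\<^sup>2)
        = (LINT x:{0..1}|lborel. \<epsilon>\<^sup>2 * (q x)\<^sup>2) + (LINT x:{0..1}|lborel. f' (u x) * (w x)\<^sup>2)"
        by (intro set_integral_add set_integrable_mult_right i iu)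
      ultimately show ?thesis by simp
    qed
    then show ?thesis by (simp add: Lform_def nsq_def ip_def power2_eq_square)
  qed
  finally have "0 \<le> - Lform \<epsilon> u w q - l * nsq w" using \<delta> by (simp add: zero_le_mult_iff)
  then show ?thesis by simp
qed

end

section \<open>The form on functions with nearly equal layer components\<close>

lemma set_integral_const_01: "(LINT x:{0..1::real}|lborel. c) = (c::real)"
  by (simp add: set_lebesgue_integral_def)

lemma nsq_alt: "nsq p = (LINT x:{0..1}|lborel. (p x)\<^sup>2)"
  by (simp add: nsq_def ip_def power2_eq_square)

lemma nsq_nonneg: "0 \<le> nsq p"
  unfolding nsq_alt set_lebesgue_integral_def by (intro Bochner_Integration.integral_nonneg) (simp add: indicator_def)

text \<open>The variance of \<open>p\<close> over the unit interval is nonnegative.\<close>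

lemma integral_square_le_nsq:
  assumes p: "continuous_on {0..1} p"
  shows "(LINT x:{0..1}|lborel. p x)\<^sup>2 \<le> nsq p"
proof -
  define t where "t = (LINT x:{0..1}|lborel. p x)"
  have i1: "set_integrable lborel {0..1} (\<lambda>x. (p x)\<^sup>2)" "set_integrable lborel {0..1} (\<lambda>x. (2 * t) * p x)"
    "set_integrable lborel {0..1} (\<lambda>x::real. t\<^sup>2)"
    by (intro set_integrable_continuous continuous_intros p)+
  have "0 \<le> nsq (\<lambda>x. p x - t)" by (rule nsq_nonneg)
  also have "nsq (\<lambda>x. p x - t) = (LINT x:{0..1}|lborel. (p x)\<^sup>2 - (2 * t) * p x + t\<^sup>2)"
    unfolding nsq_alt by (simp add: power2_eq_square algebra_simps)
  also have "\<dots> = (LINT x:{0..1}|lborel. (p x)\<^sup>2 - (2 * t) * p x) + (LINT x:{0..1::real}|lborel. t\<^sup>2)"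
    by (intro set_integral_add(2) set_integral_diff(1) i1)
  also have "(LINT x:{0..1}|lborel. (p x)\<^sup>2 - (2 * t) * p x) = (LINT x:{0..1}|lborel. (p x)\<^sup>2) - (LINT x:{0..1}|lborel. (2 * t) * p x)"
    by (intro set_integral_diff(2) i1)
  finally show ?thesis by (simp add: set_integral_const_01 nsq_alt t_def[symmetric] power2_eq_square)
qed

text \<open>Integrability of the product is assumed in place of continuity of \<open>R\<close>,
  because \<open>R\<close> will also be the parameter derivative of \<open>\<beta>\<close>, which is
  only shown to be measurable and bounded.\<close>

lemma abs_integral_mult_le:
  assumes p: "continuous_on {0..1} p" and i: "set_integrable lborel {0..1} (\<lambda>x. R x * p x)"
    and R: "\<And>x. x \<in> {0..1} \<Longrightarrow> \<bar>R x\<bar> \<le> S"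
  shows "\<bar>LINT x:{0..1}|lborel. R x * p x\<bar> \<le> S * sqrt (nsq p)"
proof -
  have S: "0 \<le> S" using R[of 0] by simp
  have "\<bar>LINT x:{0..1}|lborel. R x * p x\<bar> \<le> (LINT x:{0..1}|lborel. \<bar>R x * p x\<bar>)"
    using integral_abs_bound[of lborel "\<lambda>x. indicator {0..1} x *\<^sub>R (R x * p x)"]
    by (simp add: set_lebesgue_integral_def abs_mult)
  also have "\<dots> \<le> (LINT x:{0..1}|lborel. S * \<bar>p x\<bar>)"
  proof (intro set_integral_mono set_integrable_abs i)
    show "set_integrable lborel {0..1} (\<lambda>x. S * \<bar>p x\<bar>)" by (intro set_integrable_continuous continuous_intros p)
    show "\<bar>R x * p x\<bar> \<le> S * \<bar>p x\<bar>" if "x \<in> {0..1}" for x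
      unfolding abs_mult by (intro mult_right_mono R that) simp
  qed
  also have "\<dots> = S * (LINT x:{0..1}|lborel. \<bar>p x\<bar>)" by simp
  also have "\<dots> \<le> S * sqrt (nsq p)"
  proof (intro mult_left_mono S real_le_rsqrt)
    have "nsq (\<lambda>x. \<bar>p x\<bar>) = nsq p" by (simp add: nsq_alt)
    then show "(LINT x:{0..1}|lborel. \<bar>p x\<bar>)\<^sup>2 \<le> nsq p"
      using integral_square_le_nsq[of "\<lambda>x. \<bar>p x\<bar>"] p by (simp add: continuous_intros)
  qed
  finally show ?thesis .
qed

text \<open>The sum of squared deviations is smallest around the mean, so it may be estimated around
  any \<open>t\<close> instead.\<close>

lemma sum_squares_le_of_nearly_equal:
  fixes b :: "nat \<Rightarrow> real"
  assumes "\<And>j. j \<le> N \<Longrightarrow> \<bar>b j - t\<bar> \<le> r"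
  shows "(\<Sum>j\<le>N. (b j)\<^sup>2) \<le> (\<Sum>j\<le>N. b j)\<^sup>2 / (real N + 1) + (real N + 1) * r\<^sup>2"
proof -
  let ?n = "real N + 1"
  have c: "(\<Sum>j\<le>N. b j - t) = (\<Sum>j\<le>N. b j) - ?n * t" by (simp add: sum_subtractf)
  have "(\<Sum>j\<le>N. (b j - t)\<^sup>2) = (\<Sum>j\<le>N. (b j)\<^sup>2 - (2 * t) * b j + t\<^sup>2)"
    by (simp add: power2_eq_square algebra_simps)
  also have "\<dots> = (\<Sum>j\<le>N. (b j)\<^sup>2) - (2 * t) * (\<Sum>j\<le>N. b j) + ?n * t\<^sup>2"
    by (simp add: sum.distrib sum_subtractf sum_distrib_left)
  finally have d: "(\<Sum>j\<le>N. (b j - t)\<^sup>2) = \<dots>" .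
  have "(\<Sum>j\<le>N. (b j - t)\<^sup>2) \<le> (\<Sum>j\<le>N. r\<^sup>2)"
    using assms by (intro sum_mono) (metis abs_ge_zero atMost_iff power2_abs power_mono)
  then have 1: "(\<Sum>j\<le>N. (b j - t)\<^sup>2) \<le> ?n * r\<^sup>2" by (simp add: add.commute)
  have "0 \<le> ((\<Sum>j\<le>N. b j) - ?n * t)\<^sup>2 / ?n" by simp
  also have "\<dots> = (\<Sum>j\<le>N. b j)\<^sup>2 / ?n - (2 * t) * (\<Sum>j\<le>N. b j) + ?n * t\<^sup>2"
    by (simp add: field_simps power2_eq_square)
  finally show ?thesis using 1 d by linarith
qed

context layers
begin

lemma loc_orthogonal:
  assumes "i \<le> N" "j \<le> N"
  shows "(LINT x:{0..1}|lborel. loc a (y i x) * loc a (y j x)) = (if i = j then \<epsilon> * (LINT z|lborel. (loc a z)\<^sup>2) else 0)"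
proof (cases "i = j")
  case True
  have "(LINT x:{0..1}|lborel. (loc a (y j x))\<^sup>2) = \<epsilon> * (LINT z|lborel. (loc a z)\<^sup>2)"
    by (rule set_integral_rescale[OF a _ eps layer_inside[OF assms(2)]]) (simp add: loc_outer(1)[OF a])
  then show ?thesis using True by (simp add: power2_eq_square)
next
  case False
  have "loc a (y i x) * loc a (y j x) = 0" for x
  proof -
    obtain k where k: "k \<le> N" "\<And>i. i < k \<Longrightarrow> 2 * a * \<epsilon> \<le> x - h i" "\<And>i. k < i \<Longrightarrow> i \<le> N \<Longrightarrow> 2 * a * \<epsilon> \<le> h i - x"
      using nearest_layer[of x] by blast
    consider "i \<noteq> k" | "j \<noteq> k" using False by blast
    then show ?thesis
    proof cases
      case 1
      show ?thesis by (simp add: loc_outer(1)[OF a far_from_other_layers[OF k(2,3) assms(1) 1]])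
    next
      case 2
      show ?thesis by (simp add: loc_outer(1)[OF a far_from_other_layers[OF k(2,3) assms(2) 2]])
    qed
  qed
  then show ?thesis using False unfolding set_lebesgue_integral_def by (simp only: if_False) simp
qed

lemma integral_loc_y: "j \<le> N \<Longrightarrow> (LINT x:{0..1}|lborel. loc a (y j x)) = \<epsilon> * (LINT z|lborel. loc a z)"
  by (rule set_integral_rescale[OF a _ eps layer_inside]) (simp_all add: loc_outer(1)[OF a])

lemma integral_mult_kernel:
  assumes p: "continuous_on {0..1} p"
  shows "(LINT x:{0..1}|lborel. p x * kernel c x) = (\<Sum>j\<le>N. c j * (LINT x:{0..1}|lborel. p x * loc a (y j x)))"
proof -
  have "(LINT x:{0..1}|lborel. p x * kernel c x) = (LINT x:{0..1}|lborel. (\<Sum>j\<le>N. c j * (p x * loc a (y j x))))"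
    by (simp add: kernel_def sum_distrib_left mult.left_commute)
  also have "\<dots> = (\<Sum>j\<le>N. (LINT x:{0..1}|lborel. c j * (p x * loc a (y j x))))"
    by (intro set_integral_sum(2) set_integrable_continuous continuous_intros p continuous_on_loc_y)
  finally show ?thesis by simp
qed

text \<open>Like a difference of squares, the form of \<open>v\<close> minus that of
  \<open>w\<close> pairs \<open>kernel c\<close> with \<open>v + w\<close>. Integration by parts
  puts both derivatives on \<open>kernel c\<close>, where the small residual appears.\<close>

lemma Lform_perturb:
  fixes c :: "nat \<Rightarrow> real"
  assumes H: "H1 v g"
  defines "w \<equiv> \<lambda>x. v x - kernel c x" and "q \<equiv> \<lambda>x. g x - kernel1 c x"
  shows "Lform \<epsilon> u v g = Lform \<epsilon> u w q + (LINT x:{0..1}|lborel. (\<epsilon>\<^sup>2 * kernel2 c x - f' (u x) * kernel c x) * v x)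
    + (LINT x:{0..1}|lborel. (\<epsilon>\<^sup>2 * kernel2 c x - f' (u x) * kernel c x) * w x)"
proof -
  have Hw: "H1 w q" unfolding w_def q_def
    by (rule H1_diff_smooth[OF H continuous_on_kernel(2) kernel_has_derivative])
  have cv: "continuous_on {0..1} v" and cw: "continuous_on {0..1} w" using H Hw by (auto intro: H1_continuous_on)
  have ig: "set_integrable lborel {0..1} g" "set_integrable lborel {0..1} (\<lambda>x. (g x)\<^sup>2)"
    and iq: "set_integrable lborel {0..1} q" "set_integrable lborel {0..1} (\<lambda>x. (q x)\<^sup>2)"
    using H Hw unfolding H1_def by blast+
  note ic = set_integrable_continuous
  note cs = continuous_intros continuous_on_f'_comp u_continuous cv cw continuous_on_kernel
  have parts: "(LINT x:{0..1}|lborel. kernel1 c x * g x) = - (LINT x:{0..1}|lborel. kernel2 c x * v x)"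
      "(LINT x:{0..1}|lborel. kernel1 c x * q x) = - (LINT x:{0..1}|lborel. kernel2 c x * w x)"
    using H1_by_parts[where b = 1, OF H _ _ continuous_on_kernel(3) kernel1_has_derivative[of c]]
      H1_by_parts[where b = 1, OF Hw _ _ continuous_on_kernel(3) kernel1_has_derivative[of c]]
    by (simp_all add: kernel_boundary)
  have "(LINT x:{0..1}|lborel. (g x)\<^sup>2) - (LINT x:{0..1}|lborel. (q x)\<^sup>2) = (LINT x:{0..1}|lborel. (g x)\<^sup>2 - (q x)\<^sup>2)"
    by (intro set_integral_diff(2)[symmetric] ig iq)
  also have "\<dots> = (LINT x:{0..1}|lborel. kernel1 c x * g x + kernel1 c x * q x)"
    by (simp add: q_def power2_eq_square algebra_simps)
  also have "\<dots> = (LINT x:{0..1}|lborel. kernel1 c x * g x) + (LINT x:{0..1}|lborel. kernel1 c x * q x)"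
    by (intro set_integral_add(2) set_integrable_continuous_mult ig iq continuous_on_kernel)
  finally have 1: "(LINT x:{0..1}|lborel. (g x)\<^sup>2) - (LINT x:{0..1}|lborel. (q x)\<^sup>2)
      = - (LINT x:{0..1}|lborel. kernel2 c x * v x) - (LINT x:{0..1}|lborel. kernel2 c x * w x)"
    by (simp add: parts)
  have "(LINT x:{0..1}|lborel. f' (u x) * (v x)\<^sup>2) - (LINT x:{0..1}|lborel. f' (u x) * (w x)\<^sup>2)
      = (LINT x:{0..1}|lborel. f' (u x) * (v x)\<^sup>2 - f' (u x) * (w x)\<^sup>2)"
    by (intro set_integral_diff(2)[symmetric] ic cs)
  also have "\<dots> = (LINT x:{0..1}|lborel. f' (u x) * kernel c x * v x + f' (u x) * kernel c x * w x)"
    by (simp add: w_def power2_eq_square algebra_simps)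
  also have "\<dots> = (LINT x:{0..1}|lborel. f' (u x) * kernel c x * v x) + (LINT x:{0..1}|lborel. f' (u x) * kernel c x * w x)"
    by (intro set_integral_add(2) ic cs)
  finally have 2: "(LINT x:{0..1}|lborel. f' (u x) * (v x)\<^sup>2) - (LINT x:{0..1}|lborel. f' (u x) * (w x)\<^sup>2) = \<dots>" .
  have 3: "(LINT x:{0..1}|lborel. (\<epsilon>\<^sup>2 * kernel2 c x - f' (u x) * kernel c x) * p x)
      = \<epsilon>\<^sup>2 * (LINT x:{0..1}|lborel. kernel2 c x * p x) - (LINT x:{0..1}|lborel. f' (u x) * kernel c x * p x)"
    if p: "continuous_on {0..1} p" for p
  proof -
    have "(LINT x:{0..1}|lborel. \<epsilon>\<^sup>2 * (kernel2 c x * p x) - f' (u x) * kernel c x * p x)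
      = (LINT x:{0..1}|lborel. \<epsilon>\<^sup>2 * (kernel2 c x * p x)) - (LINT x:{0..1}|lborel. f' (u x) * kernel c x * p x)"
      by (intro set_integral_diff(2) ic cs p)
    then show ?thesis by (simp add: left_diff_distrib mult.assoc)
  qed
  have "\<epsilon>\<^sup>2 * (LINT x:{0..1}|lborel. (g x)\<^sup>2) - \<epsilon>\<^sup>2 * (LINT x:{0..1}|lborel. (q x)\<^sup>2)
      = - (\<epsilon>\<^sup>2 * (LINT x:{0..1}|lborel. kernel2 c x * v x)) - \<epsilon>\<^sup>2 * (LINT x:{0..1}|lborel. kernel2 c x * w x)"
    unfolding right_diff_distrib[symmetric] 1 by (simp add: algebra_simps)
  then show ?thesis using 2 unfolding Lform_def 3[OF cv] 3[OF cw] by simp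
qed

text \<open>The tangent conditions enter only through \<open>equal\<close>, so the estimate does not
  see how the manifold is parametrised; \<open>\<kappa>\<close> will be 10.\<close>

lemma Lform_le:
  assumes N: "1 \<le> N" and lam: "lambda0_prop lam" "0 < lam" and H: "H1 v g"
    and mean: "(LINT x:{0..1}|lborel. v x) = 0"
    and equal: "\<And>j. j \<le> N \<Longrightarrow> \<bar>ip v (\<lambda>x. loc a (y j x)) - ip v (\<lambda>x. loc a (y N x))\<bar> \<le> \<kappa> * \<tau> * sqrt (nsq v)"
    and \<delta>: "0 < \<delta>" and gap: "(1 + \<delta>) * (9 * \<tau> + (B / a)\<^sup>2 / \<delta> + 9 / 10 * min 1 lam) \<le> min 1 lam - \<delta>"
    and small: "\<epsilon> \<le> 1 / 500" "(real N + 1) * (\<kappa> * \<tau>)\<^sup>2 \<le> \<epsilon> * (DU 1)\<^sup>2 / 100"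
      "48 * B * \<tau> \<le> 2 / 5 * lam * \<epsilon>\<^sup>2 * (DU 1)\<^sup>2"
  shows "Lform \<epsilon> u v g \<le> - lam * \<epsilon> * nsq v"
proof -
  define nn where "nn = (LINT z|lborel. (loc a z)\<^sup>2)"
  define mm where "mm = (LINT z|lborel. loc a z)"
  define b where "b j = ip v (\<lambda>x. loc a (y j x))" for j
  define c where "c j = b j / (\<epsilon> * nn)" for j
  define w where "w = (\<lambda>x. v x - kernel c x)"
  define q where "q = (\<lambda>x. g x - kernel1 c x)"
  define \<nu> where "\<nu> = (DU 1)\<^sup>2"
  have \<nu>: "0 < \<nu>" "\<nu> \<le> nn" using DU_pos[of 1] integral_loc_square_ge[OF a] by (simp_all add: \<nu>_def nn_def)
  then have nn: "0 < nn" by simp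
  \<comment> \<open>Almost the whole jump 2 of the kink:
    \<open>2 * U a \<ge> 2 - 2 * \<tau>\<close>.\<close>
  have mm: "99 / 50 \<le> mm"
    using integral_loc_ge[OF a] one_minus_U[of a] exp_le_tau tau(2) unfolding mm_def by linarith
  have nm: "nn * sqrt 2 \<le> mm" using integral_loc_square_le[OF a] by (simp add: nn_def mm_def field_simps)
  have Hw: "H1 w q" unfolding w_def q_def
    by (rule H1_diff_smooth[OF H continuous_on_kernel(2) kernel_has_derivative])
  have cv: "continuous_on {0..1} v" and cw: "continuous_on {0..1} w" using H Hw by (auto intro: H1_continuous_on)
  note ic = set_integrable_continuous
  note cs = continuous_intros continuous_on_f'_comp u_continuous cv cw continuous_on_kernel continuous_on_loc_y

  have orth: "(LINT x:{0..1}|lborel. w x * loc a (y j x)) = 0" if j: "j \<le> N" for j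
  proof -
    have "(LINT x:{0..1}|lborel. w x * loc a (y j x)) = (LINT x:{0..1}|lborel. v x * loc a (y j x) - loc a (y j x) * kernel c x)"
      by (simp add: w_def algebra_simps)
    also have "\<dots> = (LINT x:{0..1}|lborel. v x * loc a (y j x)) - (LINT x:{0..1}|lborel. loc a (y j x) * kernel c x)"
      by (intro set_integral_diff(2) ic cs)
    also have "(LINT x:{0..1}|lborel. loc a (y j x) * kernel c x) = (\<Sum>i\<le>N. c i * (if j = i then \<epsilon> * nn else 0))"
      unfolding integral_mult_kernel[OF continuous_on_loc_y(1)] nn_def
      by (intro sum.cong arg_cong2[of _ _ _ _ "(*)"] loc_orthogonal refl) (use j in auto)
    also have "\<dots> = (\<Sum>i\<le>N. if j = i then c i * (\<epsilon> * nn) else 0)" by (intro sum.cong) auto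
    also have "\<dots> = b j" using j nn eps by (simp add: c_def)
    finally show ?thesis by (simp add: b_def ip_def)
  qed

  \<comment> \<open>Pythagoras: the truncated kernel functions are mutually orthogonal and
    \<open>c\<close> consists of the projection coefficients.\<close>
  have split: "nsq v = nsq w + (\<Sum>j\<le>N. (b j)\<^sup>2) / (\<epsilon> * nn)"
  proof -
    have "nsq v - nsq w = (LINT x:{0..1}|lborel. (v x)\<^sup>2 - (w x)\<^sup>2)"
      unfolding nsq_alt by (intro set_integral_diff(2)[symmetric] ic cs)
    also have "\<dots> = (LINT x:{0..1}|lborel. v x * kernel c x + w x * kernel c x)"
      by (simp add: w_def power2_eq_square algebra_simps)
    also have "\<dots> = (LINT x:{0..1}|lborel. v x * kernel c x) + (LINT x:{0..1}|lborel. w x * kernel c x)"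
      by (intro set_integral_add(2) ic cs)
    also have "\<dots> = (\<Sum>j\<le>N. c j * b j)"
      using orth by (simp add: integral_mult_kernel cv cw b_def ip_def)
    finally show ?thesis by (simp add: c_def power2_eq_square sum_divide_distrib)
  qed
  have nw: "nsq w \<le> nsq v" using nn eps by (simp add: split sum_nonneg)

  have "(LINT x:{0..1}|lborel. w x) = (LINT x:{0..1}|lborel. v x) - (LINT x:{0..1}|lborel. kernel c x)"
    unfolding w_def by (intro set_integral_diff(2) ic cs)
  also have "(LINT x:{0..1}|lborel. kernel c x) = (\<Sum>j\<le>N. c j * (\<epsilon> * mm))"
    using integral_mult_kernel[of "\<lambda>x. 1" c] by (simp add: integral_loc_y mm_def)
  also have "\<dots> = mm / nn * (\<Sum>j\<le>N. b j)"
    using eps by (simp add: c_def sum_distrib_left mult.commute)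
  finally have "(mm / nn * (\<Sum>j\<le>N. b j))\<^sup>2 \<le> nsq w"
    using integral_square_le_nsq[OF cw] by (simp add: mean)
  then have sb: "(\<Sum>j\<le>N. b j)\<^sup>2 \<le> (nn / mm)\<^sup>2 * nsq w"
    using nn mm by (simp add: power_mult_distrib power_divide field_simps)

  have "(\<Sum>j\<le>N. (b j)\<^sup>2) \<le> (\<Sum>j\<le>N. b j)\<^sup>2 / (real N + 1) + (real N + 1) * (\<kappa> * \<tau> * sqrt (nsq v))\<^sup>2"
    by (rule sum_squares_le_of_nearly_equal[of _ _ "b N"]) (simp add: b_def equal)
  also have "(real N + 1) * (\<kappa> * \<tau> * sqrt (nsq v))\<^sup>2 = ((real N + 1) * (\<kappa> * \<tau>)\<^sup>2) * nsq v"
    by (simp add: power_mult_distrib nsq_nonneg)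
  also have "\<dots> \<le> (\<epsilon> * \<nu> / 100) * nsq v"
    using small(2) by (intro mult_right_mono nsq_nonneg) (simp add: \<nu>_def)
  also have "\<dots> \<le> (\<epsilon> * nn / 100) * nsq v"
    using \<nu> eps by (intro mult_right_mono nsq_nonneg) simp
  \<comment> \<open>The denominator 2 is the least possible number of layers; this factor is
    indispensable for reaching \<open>lam\<close>.\<close>
  also have "(\<Sum>j\<le>N. b j)\<^sup>2 / (real N + 1) \<le> (nn / mm)\<^sup>2 * nsq w / 2"
    using N sb by (intro frac_le) (auto intro!: mult_nonneg_nonneg nsq_nonneg)
  also have "\<dots> \<le> (nn / 5) * nsq w"
  proof -
    have "7 / 5 \<le> sqrt 2" by (rule real_le_rsqrt) (simp add: power2_eq_square)
    then have "nn * (7 / 5) \<le> nn * sqrt 2" using nn by (intro mult_left_mono) auto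
    then have "nn * (7 / 5) \<le> mm" using nm by linarith
    then have "nn * (7 / 5) * (99 / 50) \<le> mm * mm" using mm nn by (intro mult_mono) auto
    then have "5 * nn \<le> 2 * (mm * mm)" using nn by simp
    then have "nn * (5 * nn) \<le> nn * (2 * (mm * mm))" using nn by (intro mult_left_mono) auto
    then have "(nn / mm)\<^sup>2 / 2 \<le> nn / 5" using mm nn by (simp add: power2_eq_square field_simps)
    then have "(nn / mm)\<^sup>2 / 2 * nsq w \<le> nn / 5 * nsq w" by (intro mult_right_mono nsq_nonneg)
    then show ?thesis by simp
  qed
  finally have "(\<Sum>j\<le>N. (b j)\<^sup>2) / (\<epsilon> * nn) \<le> (nn / 5 * nsq w + \<epsilon> * nn / 100 * nsq v) / (\<epsilon> * nn)"
    using eps nn by (intro divide_right_mono) auto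
  also have "\<dots> = nsq w / (5 * \<epsilon>) + nsq v / 100"
    using eps nn by (simp add: field_simps)
  finally have "99 / 100 * nsq v \<le> nsq w + nsq w / (5 * \<epsilon>)" using split by linarith
  then have "99 / 20 * \<epsilon> * nsq v \<le> (5 * \<epsilon> + 1) * nsq w" using eps by (simp add: field_simps)
  also have "\<dots> \<le> 101 / 100 * nsq w" using small(1) by (intro mult_right_mono nsq_nonneg) simp
  finally have wv: "24 / 5 * \<epsilon> * nsq v \<le> nsq w"
    using mult_nonneg_nonneg[OF less_imp_le[OF eps] nsq_nonneg[of v]] by simp

  \<comment> \<open>The bound by 1 on the kernel functions is crude and costs
    \<open>1 / \<epsilon>\<close>. Hence the residual has to beat \<open>\<epsilon>\<^sup>2\<close>,
    which is the last smallness condition.\<close>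
  define C where "C = sqrt (nsq v) / (\<epsilon> * \<nu>)"
  have C: "\<bar>c j\<bar> \<le> C" for j
  proof -
    have "\<bar>LINT x:{0..1}|lborel. loc a (y j x) * v x\<bar> \<le> 1 * sqrt (nsq v)"
      using loc_nonneg[OF a] loc_le_1[OF a] by (intro abs_integral_mult_le cv ic cs) auto
    then have "\<bar>b j\<bar> \<le> sqrt (nsq v)" by (simp add: b_def ip_def mult.commute)
    then have "\<bar>b j\<bar> / (\<epsilon> * nn) \<le> sqrt (nsq v) / (\<epsilon> * \<nu>)"
      using eps \<nu> nsq_nonneg[of v] by (intro frac_le) auto
    then show ?thesis using eps nn by (simp add: c_def C_def abs_mult)
  qed
  have R: "\<bar>LINT x:{0..1}|lborel. (\<epsilon>\<^sup>2 * kernel2 c x - f' (u x) * kernel c x) * p x\<bar> \<le> C * (24 * B * \<tau>) * sqrt (nsq v)"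
    if p: "continuous_on {0..1} p" and "nsq p \<le> nsq v" for p
  proof -
    have "\<bar>LINT x:{0..1}|lborel. (\<epsilon>\<^sup>2 * kernel2 c x - f' (u x) * kernel c x) * p x\<bar> \<le> C * (24 * B * \<tau>) * sqrt (nsq p)"
      by (intro abs_integral_mult_le p ic cs kernel_residual C)
    also have "\<dots> \<le> C * (24 * B * \<tau>) * sqrt (nsq v)"
      using that(2) B(1) tau_pos eps \<nu> nsq_nonneg[of v] by (intro mult_left_mono) (auto simp: C_def)
    finally show ?thesis .
  qed
  have "Lform \<epsilon> u v g \<le> Lform \<epsilon> u w q + 2 * (C * (24 * B * \<tau>) * sqrt (nsq v))"
  proof -
    have "Lform \<epsilon> u v g = Lform \<epsilon> u w q + (LINT x:{0..1}|lborel. (\<epsilon>\<^sup>2 * kernel2 c x - f' (u x) * kernel c x) * v x)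
        + (LINT x:{0..1}|lborel. (\<epsilon>\<^sup>2 * kernel2 c x - f' (u x) * kernel c x) * w x)"
      using Lform_perturb[OF H, of c] by (simp only: w_def q_def)
    then show ?thesis using R[OF cv order_refl] R[OF cw nw] by linarith
  qed
  also have "2 * (C * (24 * B * \<tau>) * sqrt (nsq v)) = 48 * B * \<tau> / (\<epsilon> * \<nu>) * nsq v"
    using nsq_nonneg[of v] by (simp add: C_def)
  also have "\<dots> \<le> 2 / 5 * lam * \<epsilon> * nsq v"
    using small(3) eps \<nu>(1) by (intro mult_right_mono nsq_nonneg) (simp add: \<nu>_def field_simps power2_eq_square)
  also have "Lform \<epsilon> u w q \<le> - (9 / 10 * min 1 lam) * nsq w"
    using lam by (intro localised_coercivity[OF lam(1) _ Hw orth \<delta> gap]) auto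
  also have "\<dots> \<le> - (9 / 10 * min 1 lam) * (24 / 5 * \<epsilon> * nsq v)"
    using wv lam(2) by (intro mult_left_mono_neg) auto
  \<comment> \<open>From \<open>lam \<le> 3\<close> follows
    \<open>min 1 lam \<ge> lam / 3\<close>.\<close>
  also have "\<dots> \<le> - (9 / 10 * (lam / 3)) * (24 / 5 * \<epsilon> * nsq v)"
    using lambda0_le_3[OF lam(1)] lam(2) eps nsq_nonneg[of v] by (intro mult_right_mono) auto
  \<comment> \<open>The gap yields 36/25, the residual takes 2/5, and 26/25 is left, still above
    1.\<close>
  also have "- (9 / 10 * (lam / 3)) * (24 / 5 * \<epsilon> * nsq v) + 2 / 5 * lam * \<epsilon> * nsq v = - (lam * \<epsilon> * nsq v) * (26 / 25)"
    by simp
  also have "\<dots> \<le> - (lam * \<epsilon> * nsq v) * 1"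
    using lam(2) eps nsq_nonneg[of v] by (intro mult_left_mono_neg) auto
  finally show ?thesis by simp
qed

end

section \<open>Tangent vectors to the mass-constrained manifold\<close>

lemma hext_Suc: "length l = N + 1 \<Longrightarrow> j \<le> N \<Longrightarrow> hext l (Suc j) = l ! j"
  by (simp add: hext_def)

lemma last_eq_nth: "length l = N + 1 \<Longrightarrow> last l = l ! N"
  by (subst last_conv_nth) auto

lemma hext_last: "length l = N + 1 \<Longrightarrow> hext l (Suc (Suc N)) = 2 - l ! N"
  by (simp add: hext_def last_eq_nth)

text \<open>\<open>Omega\<close> is given by finitely many strict inequalities, each stable under
  convergence. The filter is arbitrary since neighbourhoods in a two-parameter family are
  needed.\<close>

lemma eventually_Omega:
  assumes O: "Omega N \<kappa> \<epsilon> h" and len: "\<And>t. length (\<gamma> t) = N + 1"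
    and lim: "\<And>j. j \<le> N \<Longrightarrow> ((\<lambda>t. \<gamma> t ! j) \<longlongrightarrow> h ! j) F"
  shows "eventually (\<lambda>t. Omega N \<kappa> \<epsilon> (\<gamma> t)) F"
proof -
  have lh: "length h = N + 1" using O by (simp add: Omega_def)
  have last: "last l = l ! N" if "length l = N + 1" for l :: "real list"
    using that by (rule last_eq_nth)
  have hl: "((\<lambda>t. hext (\<gamma> t) j) \<longlongrightarrow> hext h j) F" if "j \<le> N + 2" for j
    using that lh len last unfolding hext_def
    by (cases "j = 0"; cases "j \<le> N + 1") (auto intro!: tendsto_intros lim)
  have 1: "eventually (\<lambda>t. 0 < \<gamma> t ! 0) F"
    using O by (intro order_tendstoD(1)[OF lim]) (auto simp: Omega_def)
  have 2: "eventually (\<lambda>t. \<gamma> t ! N < 1) F"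
    using O last[OF lh] by (intro order_tendstoD(2)[OF lim]) (auto simp: Omega_def)
  have 3: "eventually (\<lambda>t. \<forall>j\<in>{..<N}. \<gamma> t ! j < \<gamma> t ! (j + 1)) F"
  proof (intro eventually_ball_finite ballI)
    fix j assume j: "j \<in> {..<N}"
    have "((\<lambda>t. \<gamma> t ! (j + 1) - \<gamma> t ! j) \<longlongrightarrow> h ! (j + 1) - h ! j) F" using j by (intro tendsto_diff lim) auto
    then have "eventually (\<lambda>t. 0 < \<gamma> t ! (j + 1) - \<gamma> t ! j) F"
      by (rule order_tendstoD(1)) (use O j in \<open>auto simp: Omega_def\<close>)
    then show "eventually (\<lambda>t. \<gamma> t ! j < \<gamma> t ! (j + 1)) F" by simp
  qed simp
  have 4: "eventually (\<lambda>t. \<forall>j\<in>{..N + 1}. \<bar>hext (\<gamma> t) (j + 1) - hext (\<gamma> t) j\<bar> > \<epsilon> / rho \<kappa> \<epsilon>) F"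
  proof (intro eventually_ball_finite ballI)
    fix j assume j: "j \<in> {..N + 1}"
    have "((\<lambda>t. \<bar>hext (\<gamma> t) (j + 1) - hext (\<gamma> t) j\<bar>) \<longlongrightarrow> \<bar>hext h (j + 1) - hext h j\<bar>) F"
      using j by (intro tendsto_intros hl) auto
    then show "eventually (\<lambda>t. \<bar>hext (\<gamma> t) (j + 1) - hext (\<gamma> t) j\<bar> > \<epsilon> / rho \<kappa> \<epsilon>) F"
      by (rule order_tendstoD(1)) (use O j in \<open>auto simp: Omega_def\<close>)
  qed simp
  show ?thesis using 1 2 3 4 by eventually_elim (auto simp: Omega_def len last)
qed

text \<open>The reflected positions turn the gap condition at the two extreme indices into distances
  to the endpoints, whence the factor 2 there.\<close>

lemma Omega_separated:
  assumes O: "Omega N \<kappa> \<epsilon> h" and e: "0 \<le> \<epsilon> / rho \<kappa> \<epsilon>"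
  shows "i < j \<Longrightarrow> j \<le> N \<Longrightarrow> \<epsilon> / rho \<kappa> \<epsilon> \<le> h ! j - h ! i"
    and "\<epsilon> / rho \<kappa> \<epsilon> \<le> 2 * h ! 0" and "\<epsilon> / rho \<kappa> \<epsilon> \<le> 2 * (1 - h ! N)"
proof -
  have len: "length h = N + 1" using O by (simp add: Omega_def)
  have d: "\<epsilon> / rho \<kappa> \<epsilon> < \<bar>hext h (Suc j) - hext h j\<bar>" if "j \<le> N + 1" for j
    using O that unfolding Omega_def by simp
  have step: "\<epsilon> / rho \<kappa> \<epsilon> \<le> h ! Suc j - h ! j" if "j < N" for j
  proof -
    have "h ! j < h ! Suc j" using O that unfolding Omega_def by simp
    then show ?thesis using d[of "Suc j"] that by (simp add: hext_Suc[OF len])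
  qed
  show "\<epsilon> / rho \<kappa> \<epsilon> \<le> h ! j - h ! i" if "i < j" "j \<le> N"
    using that
  proof (induction j)
    case (Suc j)
    then show ?case using step[of j] e by (cases "i = j") auto
  qed simp
  have "0 < h ! 0" using O by (simp add: Omega_def)
  then show "\<epsilon> / rho \<kappa> \<epsilon> \<le> 2 * h ! 0" using d[of 0] by (simp add: hext_Suc[OF len]) (simp add: hext_def)
  have "h ! N < 1" using O last_eq_nth[OF len] by (simp add: Omega_def)
  then show "\<epsilon> / rho \<kappa> \<epsilon> \<le> 2 * (1 - h ! N)" using d[of "Suc N"] by (simp add: hext_Suc[OF len] hext_last[OF len])
qed

text \<open>Mean value theorem along the straight segment \<open>\<sigma>\<close>. As
  \<open>beta_ok\<close> speaks of derivatives at parameter 0 only, it is applied for each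
  \<open>r\<close> to the shifted curve \<open>\<sigma> (t + r)\<close>; this is why the whole
  segment has to lie in \<open>Omega\<close>.\<close>

lemma beta_increment:
  assumes b: "beta_ok N \<kappa> K k \<epsilon> \<beta>" and len: "length l0 = N + 1" "length l1 = N + 1" and x: "x \<in> {0..1}"
    and seg: "\<And>r. 0 \<le> r \<Longrightarrow> r \<le> 1 \<Longrightarrow> Omega N \<kappa> \<epsilon> (map (\<lambda>j. l0 ! j + r * (l1 ! j - l0 ! j)) [0..<N + 1])"
  shows "\<bar>\<beta> l1 x - \<beta> l0 x\<bar> \<le> expsmall \<kappa> \<epsilon> K k * (\<Sum>j<N + 1. \<bar>l1 ! j - l0 ! j\<bar>)"
proof -
  define \<sigma> where "\<sigma> r = map (\<lambda>j. l0 ! j + r * (l1 ! j - l0 ! j)) [0..<N + 1]" for r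
  have ends: "\<sigma> 0 = l0" "\<sigma> 1 = l1" using len by (auto simp: \<sigma>_def intro!: nth_equalityI simp del: upt_Suc)
  have D: "\<exists>D. ((\<lambda>r. \<beta> (\<sigma> r) x) has_real_derivative D) (at r) \<and> \<bar>D\<bar> \<le> expsmall \<kappa> \<epsilon> K k * (\<Sum>j<N + 1. \<bar>l1 ! j - l0 ! j\<bar>)"
    if r: "0 \<le> r" "r \<le> 1" for r
  proof -
    have "Omega N \<kappa> \<epsilon> (\<sigma> r)" using seg[OF r] by (simp add: \<sigma>_def)
    moreover have "(\<forall>t. length (\<sigma> (t + r)) = N + 1) \<and> \<sigma> (0 + r) = \<sigma> r \<and>
       (\<forall>j<N + 1. ((\<lambda>t. \<sigma> (t + r) ! j) has_real_derivative l1 ! j - l0 ! j) (at 0))"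
      by (auto simp: \<sigma>_def simp del: upt_Suc intro!: derivative_eq_intros)
    ultimately have "\<exists>D. ((\<lambda>t. \<beta> (\<sigma> (t + r)) x) has_real_derivative D) (at 0) \<and>
        \<bar>D\<bar> \<le> expsmall \<kappa> \<epsilon> K k * (\<Sum>j<N + 1. \<bar>l1 ! j - l0 ! j\<bar>)"
      using b[unfolded beta_ok_def, rule_format, of "\<sigma> r", THEN conjunct2, THEN conjunct2, THEN conjunct2, THEN conjunct2,
          THEN conjunct2, THEN conjunct2, rule_format, OF _ x, of "\<lambda>t. \<sigma> (t + r)" "\<lambda>j. l1 ! j - l0 ! j"] by blast
    then show ?thesis using DERIV_shift[of "\<lambda>r. \<beta> (\<sigma> r) x" _ 0 r] by simp
  qed
  have "((\<lambda>r. \<beta> (\<sigma> r) x) has_real_derivative deriv (\<lambda>r. \<beta> (\<sigma> r) x) r) (at r)" if "0 \<le> r" "r \<le> 1" for r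
    using D[OF that] DERIV_imp_deriv by metis
  then obtain z where z: "0 < z" "z < 1" "\<beta> (\<sigma> 1) x - \<beta> (\<sigma> 0) x = (1 - 0) * deriv (\<lambda>r. \<beta> (\<sigma> r) x) z"
    using MVT2[of 0 1 "\<lambda>r. \<beta> (\<sigma> r) x" "deriv (\<lambda>r. \<beta> (\<sigma> r) x)"] by auto
  obtain D where "((\<lambda>r. \<beta> (\<sigma> r) x) has_real_derivative D) (at z)" "\<bar>D\<bar> \<le> expsmall \<kappa> \<epsilon> K k * (\<Sum>j<N + 1. \<bar>l1 ! j - l0 ! j\<bar>)"
    using D[of z] z by auto
  then show ?thesis using z(3) DERIV_imp_deriv by (fastforce simp: ends)
qed

text \<open>The explicit primitive \<open>V\<close> of the kink replaces differentiation under the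
  integral sign.\<close>

lemma integral_U_has_derivative:
  assumes e: "0 < \<epsilon>"
  shows "((\<lambda>s. LINT x:{0..1}|lborel. U ((x - s) / \<epsilon>)) has_real_derivative - (U ((1 - s) / \<epsilon>) + U (s / \<epsilon>))) (at s)"
proof -
  define V where "V x = sqrt 2 * ln (cosh (x / sqrt 2))" for x :: real
  have V: "(V has_real_derivative U x) (at x)" for x
  proof -
    have "((\<lambda>z. ln (cosh z)) has_real_derivative tanh z) (at z)" for z :: real
      by (auto intro!: derivative_eq_intros simp: tanh_def)
    moreover have "((\<lambda>x. x / sqrt 2) has_real_derivative 1 / sqrt 2) (at x)"
      by (rule DERIV_cdivide[OF DERIV_ident])
    ultimately have "((\<lambda>x. sqrt 2 * ln (cosh (x / sqrt 2))) has_real_derivative sqrt 2 * (tanh (x / sqrt 2) * (1 / sqrt 2))) (at x)"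
      by (intro DERIV_cmult DERIV_chain2)
    moreover have "sqrt 2 * (t * (1 / sqrt 2)) = t" for t :: real by simp
    ultimately show ?thesis unfolding V_def[abs_def] U_def by (simp only:)
  qed
  have "(LINT x:{0..1}|lborel. U ((x - s) / \<epsilon>)) = \<epsilon> * V ((1 - s) / \<epsilon>) - \<epsilon> * V ((0 - s) / \<epsilon>)" for s
  proof (rule set_integral_derivative)
    show "continuous_on {0..1} (\<lambda>x. U ((x - s) / \<epsilon>))"
      using e by (intro profile_continuous_intros continuous_intros) simp
    have "((\<lambda>x. (x - s) / \<epsilon>) has_real_derivative 1 / \<epsilon>) (at x)" for x
      using e by (auto intro!: derivative_eq_intros)
    from DERIV_cmult[OF DERIV_chain2[OF V this], of \<epsilon>]
    show "((\<lambda>x. \<epsilon> * V ((x - s) / \<epsilon>)) has_real_derivative U ((x - s) / \<epsilon>)) (at x)" for x using e by simp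
  qed simp
  then have eq: "(\<lambda>s. LINT x:{0..1}|lborel. U ((x - s) / \<epsilon>)) = (\<lambda>s. \<epsilon> * V ((1 - s) / \<epsilon>) - \<epsilon> * V ((0 - s) / \<epsilon>))" by auto
  have d: "((\<lambda>s. (c - s) / \<epsilon>) has_real_derivative - 1 / \<epsilon>) (at s)" for c
    using e by (auto intro!: derivative_eq_intros)
  have m: "U (- s / \<epsilon>) = - U (s / \<epsilon>)" using U_minus[of "s / \<epsilon>"] by simp
  show ?thesis unfolding eq
    by (rule DERIV_cong[OF DERIV_diff[OF DERIV_cmult[OF DERIV_chain2[OF V d]] DERIV_cmult[OF DERIV_chain2[OF V d]]]])
       (use e m in \<open>simp add: algebra_simps\<close>)
qed

section \<open>Coordinate curves on the mass-constrained manifold\<close>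

locale layer_manifold = layers N "(!) (\<xi> @ [H \<xi>])" a \<epsilon> E \<tau> B "uxi \<epsilon> \<beta> H \<xi>"
  for N \<xi> H a \<epsilon> E \<tau> B \<beta> +
  fixes \<kappa>0 K k \<mu> :: real
  assumes omega: "Omega N \<kappa>0 \<epsilon> (\<xi> @ [H \<xi>])" and beta: "beta_ok N \<kappa>0 K k \<epsilon> \<beta>"
    and mass_map: "mass_map N \<kappa>0 \<mu> \<epsilon> \<beta> H" and len: "length \<xi> = N"
    and E_eq: "E = expsmall \<kappa>0 \<epsilon> K k" and eps_le_1: "\<epsilon> \<le> 1"
begin

abbreviation "hs \<equiv> \<xi> @ [H \<xi>]"

definition curve :: "nat \<Rightarrow> real \<Rightarrow> real list" where
  "curve i t = \<xi>[i := \<xi> ! i + t] @ [H (\<xi>[i := \<xi> ! i + t])]"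

definition Hd :: "nat \<Rightarrow> real" where "Hd i = deriv (\<lambda>t. H (\<xi>[i := \<xi> ! i + t])) 0"

definition speed :: "nat \<Rightarrow> nat \<Rightarrow> real" where
  "speed i j = (if j = i then 1 else if j = N then Hd i else 0)"

lemma H_has_derivative:
  assumes "i < N" shows "((\<lambda>t. H (\<xi>[i := \<xi> ! i + t])) has_real_derivative Hd i) (at 0)"
proof -
  have "0 < \<xi> ! j \<and> \<xi> ! j < 1" if "j < N" for j
    using layer_inside[of j] that a_eps_pos len by (simp add: nth_append)
  then have "(\<lambda>t. H (\<xi>[i := \<xi> ! i + t])) differentiable (at 0)"
    using mass_map len assms unfolding mass_map_def by blast
  then show ?thesis unfolding Hd_def by (simp add: DERIV_deriv_iff_real_differentiable)
qed

lemma curve_simps: "length (curve i t) = N + 1" "curve i 0 = hs"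
  using len by (simp_all add: curve_def)

lemma curve_nth:
  "i < N \<Longrightarrow> j \<le> N \<Longrightarrow> curve i t ! j = (if j = i then \<xi> ! i + t else if j = N then H (\<xi>[i := \<xi> ! i + t]) else \<xi> ! j)"
  using len by (auto simp: curve_def nth_append nth_list_update)

lemma curve_has_derivative:
  assumes "i < N" "j \<le> N" shows "((\<lambda>t. curve i t ! j) has_real_derivative speed i j) (at 0)"
  using H_has_derivative[OF assms(1)] assms by (auto simp: curve_nth speed_def intro!: derivative_eq_intros)

lemma sum_abs_speed: "i < N \<Longrightarrow> (\<Sum>j<N + 1. \<bar>speed i j\<bar>) = 1 + \<bar>Hd i\<bar>"
proof -
  assume i: "i < N"
  have "(\<Sum>j<N. \<bar>speed i j\<bar>) = (\<Sum>j<N. if j = i then 1 else 0)"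
    by (intro sum.cong) (auto simp: speed_def)
  then show ?thesis using i by (simp add: speed_def)
qed

lemma beta_has_derivative:
  assumes i: "i < N" and x: "x \<in> {0..1}"
  shows "((\<lambda>t. \<beta> (curve i t) x) has_real_derivative deriv (\<lambda>t. \<beta> (curve i t) x) 0) (at 0)"
    and "\<bar>deriv (\<lambda>t. \<beta> (curve i t) x) 0\<bar> \<le> E * (1 + \<bar>Hd i\<bar>)"
proof -
  have "(\<forall>t. length (curve i t) = N + 1) \<and> curve i 0 = hs \<and>
       (\<forall>j<N + 1. ((\<lambda>t. curve i t ! j) has_real_derivative speed i j) (at 0))"
    using curve_has_derivative[OF i] by (simp add: curve_simps)
  then have "\<exists>D. ((\<lambda>t. \<beta> (curve i t) x) has_real_derivative D) (at 0) \<and>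
        \<bar>D\<bar> \<le> expsmall \<kappa>0 \<epsilon> K k * (\<Sum>j<N + 1. \<bar>speed i j\<bar>)"
    using beta[unfolded beta_ok_def, rule_format, of hs, OF omega, THEN conjunct2, THEN conjunct2, THEN conjunct2, THEN conjunct2,
        THEN conjunct2, THEN conjunct2, rule_format, OF x, of "curve i" "speed i"] by blast
  then obtain D where D: "((\<lambda>t. \<beta> (curve i t) x) has_real_derivative D) (at 0)" "\<bar>D\<bar> \<le> E * (1 + \<bar>Hd i\<bar>)"
    unfolding sum_abs_speed[OF i] E_eq by blast
  have e: "deriv (\<lambda>t. \<beta> (curve i t) x) 0 = D" by (rule DERIV_imp_deriv[OF D(1)])
  show "((\<lambda>t. \<beta> (curve i t) x) has_real_derivative deriv (\<lambda>t. \<beta> (curve i t) x) 0) (at 0)"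
    and "\<bar>deriv (\<lambda>t. \<beta> (curve i t) x) 0\<bar> \<le> E * (1 + \<bar>Hd i\<bar>)" unfolding e by (rule D)+
qed

text \<open>The two parameters are independent because the straight segment from \<open>hs\<close>
  to a point of the curve need not follow the graph of \<open>H\<close>.\<close>

lemma segment_in_Omega:
  assumes i: "i < N"
  shows "\<exists>d>0. \<forall>t s. \<bar>t\<bar> < d \<and> \<bar>s\<bar> < d \<longrightarrow> Omega N \<kappa>0 \<epsilon> (\<xi>[i := \<xi> ! i + t] @ [H \<xi> + s])"
proof -
  have "eventually (\<lambda>p. Omega N \<kappa>0 \<epsilon> (\<xi>[i := \<xi> ! i + fst p] @ [H \<xi> + snd p])) (nhds (0 :: real \<times> real))"
  proof (rule eventually_Omega[OF omega])
    have lim: "((\<lambda>p. fst p) \<longlongrightarrow> 0) (nhds (0 :: real \<times> real))" "((\<lambda>p. snd p) \<longlongrightarrow> 0) (nhds (0 :: real \<times> real))"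
      using tendsto_fst[of "\<lambda>p. p" "0 :: real \<times> real" "nhds 0"] tendsto_snd[of "\<lambda>p. p" "0 :: real \<times> real" "nhds 0"]
      by (simp_all add: filterlim_ident)
    have shift: "((\<lambda>p. c + fst p) \<longlongrightarrow> c) (nhds (0 :: real \<times> real))" "((\<lambda>p. c + snd p) \<longlongrightarrow> c) (nhds (0 :: real \<times> real))" for c
      using tendsto_add[OF tendsto_const[of c] lim(1)] tendsto_add[OF tendsto_const[of c] lim(2)] by simp_all
    fix j assume j: "j \<le> N"
    consider "j = N" | "j = i" | "j < N" "j \<noteq> i" using j by linarith
    then show "((\<lambda>p. (\<xi>[i := \<xi> ! i + fst p] @ [H \<xi> + snd p]) ! j) \<longlongrightarrow> hs ! j) (nhds (0 :: real \<times> real))"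
      using i len by cases (simp_all add: nth_append shift)
  qed (simp add: len)
  then obtain d where d: "0 < d" "\<And>p :: real \<times> real. dist p 0 < d \<Longrightarrow> Omega N \<kappa>0 \<epsilon> (\<xi>[i := \<xi> ! i + fst p] @ [H \<xi> + snd p])"
    unfolding eventually_nhds_metric by auto
  show ?thesis
  proof (intro exI[of _ "d / 2"] conjI allI impI)
    fix t s :: real assume "\<bar>t\<bar> < d / 2 \<and> \<bar>s\<bar> < d / 2"
    then have "dist (t, s) 0 < d"
      using sqrt_sum_squares_le_sum_abs[of t s] by (simp add: zero_prod_def dist_Pair_Pair)
    from d(2)[OF this] show "Omega N \<kappa>0 \<epsilon> (\<xi>[i := \<xi> ! i + t] @ [H \<xi> + s])" by simp
  qed (use d in simp)
qed

text \<open>One neighbourhood of parameters serves all \<open>x\<close>, so the bound can be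
  integrated over \<open>x\<close> before dividing by \<open>t\<close>.\<close>

lemma eventually_near_curve:
  assumes i: "i < N"
  shows "eventually (\<lambda>t. Omega N \<kappa>0 \<epsilon> (curve i t) \<and> (\<forall>x\<in>{0..1}.
    \<bar>\<beta> (curve i t) x - \<beta> hs x\<bar> \<le> E * (\<bar>t\<bar> + \<bar>H (\<xi>[i := \<xi> ! i + t]) - H \<xi>\<bar>))) (nhds 0)"
proof -
  obtain d where d: "0 < d" "\<And>t s. \<bar>t\<bar> < d \<Longrightarrow> \<bar>s\<bar> < d \<Longrightarrow> Omega N \<kappa>0 \<epsilon> (\<xi>[i := \<xi> ! i + t] @ [H \<xi> + s])"
    using segment_in_Omega[OF i] by blast
  have "isCont (\<lambda>t. H (\<xi>[i := \<xi> ! i + t])) 0" by (rule DERIV_isCont[OF H_has_derivative[OF i]])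
  then have "((\<lambda>t. H (\<xi>[i := \<xi> ! i + t])) \<longlongrightarrow> H (\<xi>[i := \<xi> ! i + 0])) (nhds 0)"
    using tendsto_at_iff_tendsto_nhds[of "\<lambda>t. H (\<xi>[i := \<xi> ! i + t])" 0] unfolding isCont_def by blast
  then have "((\<lambda>t. H (\<xi>[i := \<xi> ! i + t])) \<longlongrightarrow> H \<xi>) (nhds 0)" by simp
  then have "eventually (\<lambda>t. \<bar>H (\<xi>[i := \<xi> ! i + t]) - H \<xi>\<bar> < d) (nhds 0)"
    using d(1) by (simp add: tendsto_iff dist_real_def)
  moreover have "eventually (\<lambda>t::real. \<bar>t\<bar> < d) (nhds 0)"
    unfolding eventually_nhds_metric using d(1) by (auto simp: dist_real_def)
  ultimately show ?thesis
  proof eventually_elim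
    case (elim t)
    let ?s = "H (\<xi>[i := \<xi> ! i + t]) - H \<xi>"
    show ?case
    proof (intro conjI ballI)
      show "Omega N \<kappa>0 \<epsilon> (curve i t)" using d(2)[OF elim(2,1)] by (simp add: curve_def)
      fix x :: real assume x: "x \<in> {0..1}"
      have nth: "curve i t ! j - hs ! j = (if j = i then t else if j = N then ?s else 0)" if "j \<le> N" for j
        using that i len by (auto simp: curve_nth nth_append)
      have "\<bar>\<beta> (curve i t) x - \<beta> hs x\<bar> \<le> expsmall \<kappa>0 \<epsilon> K k * (\<Sum>j<N + 1. \<bar>curve i t ! j - hs ! j\<bar>)"
      proof (rule beta_increment[OF beta _ curve_simps(1) x])
        fix r :: real assume r: "0 \<le> r" "r \<le> 1"
        have "map (\<lambda>j. hs ! j + r * (curve i t ! j - hs ! j)) [0..<N + 1] = \<xi>[i := \<xi> ! i + r * t] @ [H \<xi> + r * ?s]"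
        proof (rule nth_equalityI)
          fix j assume "j < length (map (\<lambda>j. hs ! j + r * (curve i t ! j - hs ! j)) [0..<N + 1])"
          then have j: "j \<le> N" by simp
          then have "map (\<lambda>j. hs ! j + r * (curve i t ! j - hs ! j)) [0..<N + 1] ! j
              = hs ! j + r * (if j = i then t else if j = N then ?s else 0)"
            unfolding nth[OF j, symmetric] by (subst nth_map) (simp_all del: upt_Suc)
          then show "map (\<lambda>j. hs ! j + r * (curve i t ! j - hs ! j)) [0..<N + 1] ! j
              = (\<xi>[i := \<xi> ! i + r * t] @ [H \<xi> + r * ?s]) ! j"
            using i len j by (auto simp: nth_append nth_list_update)
        qed (simp add: len)
        moreover have "\<bar>r * t\<bar> < d" "\<bar>r * ?s\<bar> < d"
          using elim r mult_left_le_one_le[of "\<bar>t\<bar>" r] mult_left_le_one_le[of "\<bar>?s\<bar>" r] by (auto simp: abs_mult)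
        ultimately show "Omega N \<kappa>0 \<epsilon> (map (\<lambda>j. hs ! j + r * (curve i t ! j - hs ! j)) [0..<N + 1])" using d(2) by simp
      qed (simp add: len)
      also have "(\<Sum>j<N + 1. \<bar>curve i t ! j - hs ! j\<bar>) = \<bar>t\<bar> + \<bar>?s\<bar>"
      proof -
        have "(\<Sum>j<N. \<bar>curve i t ! j - hs ! j\<bar>) = (\<Sum>j<N. if j = i then \<bar>t\<bar> else 0)"
          by (intro sum.cong) (auto simp: nth)
        then show ?thesis using i by (simp add: nth)
      qed
      finally show "\<bar>\<beta> (curve i t) x - \<beta> hs x\<bar> \<le> E * (\<bar>t\<bar> + \<bar>?s\<bar>)" by (simp add: E_eq)
    qed
  qed
qed

lemma beta_continuous: "Omega N \<kappa>0 \<epsilon> l \<Longrightarrow> continuous_on S (\<beta> l)"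
  using beta unfolding beta_ok_def
  by (intro continuous_at_imp_continuous_on ballI) (metis differentiable_imp_continuous_within)

text \<open>Minus the rate at which the integral of a kink changes when the kink is shifted; close
  to 2, the height of its jump.\<close>

definition flux :: "nat \<Rightarrow> real" where "flux j = U ((1 - hs ! j) / \<epsilon>) + U (hs ! j / \<epsilon>)"

lemma mass_Omega:
  assumes "Omega N \<kappa>0 \<epsilon> l"
  shows "mass \<epsilon> \<beta> l = (\<Sum>j\<le>N. (- 1) ^ j * (LINT x:{0..1}|lborel. U ((x - l ! j) / \<epsilon>))) + (LINT x:{0..1}|lborel. \<beta> l x)"
proof -
  have l: "length l = N + 1" using assms by (simp add: Omega_def)
  have c: "set_integrable lborel {0..1} (\<lambda>x. (- 1) ^ j * U ((x - l ! j) / \<epsilon>))" for j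
    using eps by (intro set_integrable_continuous continuous_intros profile_continuous_intros) simp
  have "mass \<epsilon> \<beta> l = (LINT x:{0..1}|lborel. (\<Sum>j\<le>N. (- 1) ^ j * U ((x - l ! j) / \<epsilon>)) + \<beta> l x)"
    unfolding mass_def uh_def l by (simp add: lessThan_Suc_atMost)
  also have "\<dots> = (LINT x:{0..1}|lborel. (\<Sum>j\<le>N. (- 1) ^ j * U ((x - l ! j) / \<epsilon>))) + (LINT x:{0..1}|lborel. \<beta> l x)"
    by (intro set_integral_add(2) set_integral_sum(1) c set_integrable_continuous beta_continuous assms)
  also have "(LINT x:{0..1}|lborel. (\<Sum>j\<le>N. (- 1) ^ j * U ((x - l ! j) / \<epsilon>)))
      = (\<Sum>j\<le>N. (LINT x:{0..1}|lborel. (- 1) ^ j * U ((x - l ! j) / \<epsilon>)))"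
    by (rule set_integral_sum(2)[OF c])
  finally show ?thesis by simp
qed

text \<open>
  \<open>H\<close> is not assumed to be \<open>C\<^sup>1\<close>, so the mass cannot be differentiated along the curve under the integral.
  The increments of \<open>\<beta>\<close> along straight segments are controlled instead.
\<close>

lemma flux_balance:
  assumes i: "i < N"
  shows "\<bar>(- 1) ^ i * flux i + (- 1) ^ N * Hd i * flux N\<bar> \<le> E * (1 + \<bar>Hd i\<bar>)"
proof -
  define J where "J s = (LINT x:{0..1}|lborel. U ((x - s) / \<epsilon>))" for s
  define Q where "Q t = (\<Sum>j\<le>N. (- 1) ^ j * J (curve i t ! j))" for t
  have J: "(J has_real_derivative - flux j) (at (hs ! j))" for j
    using integral_U_has_derivative[OF eps] by (simp add: J_def[abs_def] flux_def)
  have "((\<lambda>t. (- 1) ^ j * J (curve i t ! j)) has_real_derivative (- 1) ^ j * (- flux j * speed i j)) (at 0)" if "j \<le> N" for j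
    by (intro DERIV_cmult DERIV_chain2[where f = J] curve_has_derivative i that) (simp add: curve_simps J)
  then have "(Q has_real_derivative (\<Sum>j\<le>N. (- 1) ^ j * (- flux j * speed i j))) (at 0)"
    unfolding Q_def[abs_def] by (intro DERIV_sum) simp
  also have "(\<Sum>j\<le>N. (- 1) ^ j * (- flux j * speed i j)) = - ((- 1) ^ i * flux i + (- 1) ^ N * Hd i * flux N)"
  proof -
    have "(\<Sum>j<N. (- 1) ^ j * (- flux j * speed i j)) = (\<Sum>j<N. if j = i then - ((- 1) ^ i * flux i) else 0)"
      by (intro sum.cong) (auto simp: speed_def)
    then show ?thesis using i unfolding lessThan_Suc_atMost[symmetric] by (simp add: speed_def)
  qed
  finally have QD: "((\<lambda>t. (Q t - Q 0) / t) \<longlongrightarrow> - ((- 1) ^ i * flux i + (- 1) ^ N * Hd i * flux N)) (at 0)"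
    by (simp add: DERIV_def)
  have HD: "((\<lambda>t. (H (\<xi>[i := \<xi> ! i + t]) - H \<xi>) / t) \<longlongrightarrow> Hd i) (at 0)"
    using H_has_derivative[OF i] by (simp add: DERIV_def)
  have ev: "eventually (\<lambda>t. \<bar>(Q t - Q 0) / t\<bar> \<le> E * (1 + \<bar>(H (\<xi>[i := \<xi> ! i + t]) - H \<xi>) / t\<bar>)) (at 0)"
    using eventually_near_curve[OF i, unfolded eventually_nhds_conv_at, THEN conjunct1] eventually_neq_at_within[of 0 0 UNIV]
  proof eventually_elim
    case (elim t)
    let ?s = "H (\<xi>[i := \<xi> ! i + t]) - H \<xi>"
    have "mass \<epsilon> \<beta> (curve i t) = \<mu>" "mass \<epsilon> \<beta> hs = \<mu>"
      using mass_map omega elim(1) unfolding mass_map_def by (auto simp: curve_def)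
    \<comment> \<open>Both configurations have mass \<open>\<mu>\<close>, so the kinks can change
      the mass only by what the correction gives back.\<close>
    then have "Q t - Q 0 = - ((LINT x:{0..1}|lborel. \<beta> (curve i t) x) - (LINT x:{0..1}|lborel. \<beta> hs x))"
      using mass_Omega[of "curve i t"] mass_Omega[OF omega] elim(1) by (simp add: Q_def J_def curve_simps)
    also have "(LINT x:{0..1}|lborel. \<beta> (curve i t) x) - (LINT x:{0..1}|lborel. \<beta> hs x)
        = (LINT x:{0..1}|lborel. (\<beta> (curve i t) x - \<beta> hs x) * 1)"
      using elim(1) omega by (subst set_integral_diff(2)[symmetric]) (auto intro!: set_integrable_continuous beta_continuous)
    finally have "\<bar>Q t - Q 0\<bar> = \<bar>LINT x:{0..1}|lborel. (\<beta> (curve i t) x - \<beta> hs x) * 1\<bar>" by simp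
    also have "\<dots> \<le> E * (\<bar>t\<bar> + \<bar>?s\<bar>) * sqrt (nsq (\<lambda>x. 1))"
      using elim(1) omega
      by (intro abs_integral_mult_le) (auto intro!: set_integrable_continuous continuous_intros beta_continuous)
    also have "nsq (\<lambda>x. 1) = 1" by (simp add: nsq_alt set_integral_const_01)
    finally have "\<bar>Q t - Q 0\<bar> / \<bar>t\<bar> \<le> E * (\<bar>t\<bar> + \<bar>?s\<bar>) / \<bar>t\<bar>" by (simp add: divide_right_mono)
    then show ?case using elim(2) by (simp add: abs_divide add_divide_distrib distrib_left)
  qed
  have "\<bar>- ((- 1) ^ i * flux i + (- 1) ^ N * Hd i * flux N)\<bar> \<le> E * (1 + \<bar>Hd i\<bar>)"
    by (rule tendsto_le[OF _ tendsto_mult[OF tendsto_const tendsto_add[OF tendsto_const tendsto_rabs[OF HD]]] tendsto_rabs[OF QD] ev]) simp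
  then show ?thesis by simp
qed

text \<open>With all fluxes within \<open>2 * \<tau>\<close> of 2, the balance nearly reads
  \<open>2 * z = 0\<close> for the quantity \<open>z\<close> below. The error contains
  \<open>\<bar>Hd i\<bar>\<close> itself, but
  \<open>\<bar>Hd i\<bar> \<le> 1 + \<bar>z\<bar>\<close>, and \<open>\<tau> \<le> 1 / 100\<close>
  lets the term with \<open>\<bar>z\<bar>\<close> be absorbed on the left.\<close>

lemma Hd_bounds:
  assumes i: "i < N"
  shows "\<bar>(- 1) ^ i + (- 1) ^ N * Hd i\<bar> \<le> 4 * \<tau>" and "\<bar>Hd i\<bar> \<le> 2"
proof -
  define A where "A = (- 1) ^ i * flux i"
  have sat: "1 - \<tau> \<le> U z" if "2 * a \<le> z" for z
  proof -
    have "exp (- sqrt 2 * z) \<le> exp (- sqrt 2 * a)" using that a by simp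
    then show ?thesis using one_minus_U[of z] exp_le_tau by linarith
  qed
  have fl: "\<bar>2 - flux j\<bar> \<le> 2 * \<tau>" if "j \<le> N" for j
  proof -
    have "2 * a \<le> (1 - hs ! j) / \<epsilon>" "2 * a \<le> hs ! j / \<epsilon>"
      using layer_inside[OF that] eps by (simp_all add: field_simps)
    from this[THEN sat] show ?thesis
      using abs_U_less[of "(1 - hs ! j) / \<epsilon>"] abs_U_less[of "hs ! j / \<epsilon>"] unfolding flux_def by linarith
  qed
  have E: "E \<le> \<tau>"
  proof -
    have "0 \<le> 2 * (real N + 1) * exp (- sqrt 2 * a)" by simp
    then show ?thesis using tau(1) by linarith
  qed
  define z where "z = (- 1) ^ i + (- 1) ^ N * Hd i"
  have "2 * z = ((- 1) ^ i * flux i + (- 1) ^ N * Hd i * flux N) + ((- 1) ^ i * (2 - flux i) + (- 1) ^ N * Hd i * (2 - flux N))"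
    by (simp add: z_def algebra_simps)
  then have "2 * \<bar>z\<bar> \<le> \<bar>(- 1) ^ i * flux i + (- 1) ^ N * Hd i * flux N\<bar> + (\<bar>(- 1) ^ i * (2 - flux i)\<bar> + \<bar>(- 1) ^ N * Hd i * (2 - flux N)\<bar>)"
    by linarith
  also have "\<bar>(- 1) ^ i * (2 - flux i)\<bar> = \<bar>2 - flux i\<bar>" by (simp add: abs_mult power_abs)
  also have "\<bar>(- 1) ^ N * Hd i * (2 - flux N)\<bar> = \<bar>Hd i\<bar> * \<bar>2 - flux N\<bar>" by (simp add: abs_mult power_abs)
  also have "\<bar>(- 1) ^ i * flux i + (- 1) ^ N * Hd i * flux N\<bar> + (\<bar>2 - flux i\<bar> + \<bar>Hd i\<bar> * \<bar>2 - flux N\<bar>)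
      \<le> \<tau> * (1 + \<bar>Hd i\<bar>) + (2 * \<tau> + \<bar>Hd i\<bar> * (2 * \<tau>))"
  proof (intro add_mono mult_left_mono fl)
    show "\<bar>(- 1) ^ i * flux i + (- 1) ^ N * Hd i * flux N\<bar> \<le> \<tau> * (1 + \<bar>Hd i\<bar>)"
      using flux_balance[OF i] mult_right_mono[OF E, of "1 + \<bar>Hd i\<bar>"] by linarith
  qed (use i in auto)
  finally have 1: "2 * \<bar>z\<bar> \<le> 3 * \<tau> * (1 + \<bar>Hd i\<bar>)" by (simp add: algebra_simps)
  have "\<bar>Hd i\<bar> = \<bar>(- 1) ^ N * Hd i\<bar>" by (simp add: abs_mult power_abs)
  also have "\<dots> = \<bar>z - (- 1) ^ i\<bar>" by (simp add: z_def)
  also have "\<dots> \<le> \<bar>z\<bar> + \<bar>(- 1) ^ i\<bar>" by (rule abs_triangle_ineq4)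
  finally have 2: "\<bar>Hd i\<bar> \<le> 1 + \<bar>z\<bar>" by (simp add: power_abs)
  have "3 * \<tau> * (1 + \<bar>Hd i\<bar>) \<le> 3 * \<tau> * (2 + \<bar>z\<bar>)" using 2 tau_pos by (intro mult_left_mono) auto
  moreover have "3 * \<tau> * \<bar>z\<bar> \<le> 3 / 100 * \<bar>z\<bar>" using tau(2) by (intro mult_right_mono) auto
  ultimately have "\<bar>z\<bar> \<le> 4 * \<tau>" using 1 by (simp add: algebra_simps)
  then show "\<bar>(- 1) ^ i + (- 1) ^ N * Hd i\<bar> \<le> 4 * \<tau>" "\<bar>Hd i\<bar> \<le> 2"
    using 2 tau(2) unfolding z_def by linarith+
qed

lemma uxi_d_eq:
  assumes i: "i < N" and x: "x \<in> {0..1}"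
  shows "uxi_d \<epsilon> \<beta> H \<xi> i x = - ((- 1) ^ i * DU (y i x) + (- 1) ^ N * Hd i * DU (y N x)) / \<epsilon> + deriv (\<lambda>t. \<beta> (curve i t) x) 0"
proof -
  have "((\<lambda>t. (- 1) ^ j * U ((x - curve i t ! j) / \<epsilon>)) has_real_derivative (- 1) ^ j * (DU (y j x) * (- speed i j / \<epsilon>))) (at 0)"
    if j: "j \<le> N" for j
  proof (intro DERIV_cmult DERIV_chain2[where f = U])
    show "(U has_real_derivative DU (y j x)) (at ((x - curve i 0 ! j) / \<epsilon>))"
      using U_has_derivative by (simp add: curve_simps)
    show "((\<lambda>t. (x - curve i t ! j) / \<epsilon>) has_real_derivative - speed i j / \<epsilon>) (at 0)"
      using curve_has_derivative[OF i j] eps by (auto intro!: derivative_eq_intros)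
  qed
  then have "((\<lambda>t. (\<Sum>j\<le>N. (- 1) ^ j * U ((x - curve i t ! j) / \<epsilon>)) + \<beta> (curve i t) x) has_real_derivative
      (\<Sum>j\<le>N. (- 1) ^ j * (DU (y j x) * (- speed i j / \<epsilon>))) + deriv (\<lambda>t. \<beta> (curve i t) x) 0) (at 0)"
    by (intro DERIV_add DERIV_sum beta_has_derivative(1) i x) simp
  moreover have "(\<lambda>t. (\<Sum>j\<le>N. (- 1) ^ j * U ((x - curve i t ! j) / \<epsilon>)) + \<beta> (curve i t) x)
      = (\<lambda>t. uxi \<epsilon> \<beta> H (\<xi>[i := \<xi> ! i + t]) x)"
    unfolding uxi_def uh_def curve_def using len by (simp add: lessThan_Suc_atMost)
  moreover have "(\<Sum>j\<le>N. (- 1) ^ j * (DU (y j x) * (- speed i j / \<epsilon>)))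
      = - ((- 1) ^ i * DU (y i x) + (- 1) ^ N * Hd i * DU (y N x)) / \<epsilon>"
  proof -
    have "(\<Sum>j<N. (- 1) ^ j * (DU (y j x) * (- speed i j / \<epsilon>))) = (\<Sum>j<N. if j = i then - ((- 1) ^ i * DU (y i x)) / \<epsilon> else 0)"
      by (intro sum.cong) (auto simp: speed_def)
    moreover have "(\<Sum>j<N. if j = i then - ((- 1) ^ i * DU (y i x)) / \<epsilon> else 0) = - ((- 1) ^ i * DU (y i x)) / \<epsilon>"
      using i by simp
    moreover have "(\<Sum>j\<le>N. F j) = (\<Sum>j<N. F j) + F N" for F :: "nat \<Rightarrow> real"
      unfolding lessThan_Suc_atMost[symmetric] by simp
    ultimately have "(\<Sum>j\<le>N. (- 1) ^ j * (DU (y j x) * (- speed i j / \<epsilon>)))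
        = - ((- 1) ^ i * DU (y i x)) / \<epsilon> + (- 1) ^ N * (DU (y N x) * (- speed i N / \<epsilon>))"
      by (simp only:)
    then show ?thesis using i by (simp add: speed_def diff_divide_distrib mult.commute mult.left_commute)
  qed
  ultimately have "((\<lambda>t. uxi \<epsilon> \<beta> H (\<xi>[i := \<xi> ! i + t]) x) has_real_derivative
      - ((- 1) ^ i * DU (y i x) + (- 1) ^ N * Hd i * DU (y N x)) / \<epsilon> + deriv (\<lambda>t. \<beta> (curve i t) x) 0) (at 0)"
    by (simp only:)
  then show ?thesis unfolding uxi_d_def by (rule DERIV_imp_deriv)
qed

text \<open>A pointwise limit of difference quotients along \<open>s n\<close>, each continuous in
  \<open>x\<close>. The offset \<open>n0\<close> skips the indices at which the curve might be
  outside \<open>Omega\<close>, where nothing is known about \<open>\<beta>\<close>.\<close>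

lemma beta_deriv_measurable:
  assumes i: "i < N"
  shows "set_borel_measurable lborel {0..1} (\<lambda>x. deriv (\<lambda>t. \<beta> (curve i t) x) 0)"
proof -
  define s where "s n = 1 / real (Suc n)" for n
  have s: "s \<longlonglongrightarrow> 0" unfolding s_def by (rule LIMSEQ_Suc[OF lim_1_over_n])
  have "eventually (\<lambda>t. Omega N \<kappa>0 \<epsilon> (curve i t)) (nhds 0)"
    using eventually_near_curve[OF i] by eventually_elim simp
  then have "eventually (\<lambda>n. Omega N \<kappa>0 \<epsilon> (curve i (s n))) sequentially"
    using s by (rule eventually_compose_filterlim)
  then obtain n0 where n0: "\<And>n. n0 \<le> n \<Longrightarrow> Omega N \<kappa>0 \<epsilon> (curve i (s n))"
    unfolding eventually_sequentially by blast
  define p where "p n x = indicator {0..1} x *\<^sub>R ((\<beta> (curve i (s (n + n0))) x - \<beta> hs x) / s (n + n0))" for n x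
  have "p n \<in> borel_measurable lborel" for n
  proof -
    have "continuous_on {0..1} (\<lambda>x. (\<beta> (curve i (s (n + n0))) x - \<beta> hs x) / s (n + n0))"
      by (intro continuous_intros beta_continuous n0 omega) (simp_all add: s_def)
    from set_integrable_continuous[OF this] show ?thesis unfolding set_integrable_def p_def[abs_def] by auto
  qed
  moreover have "(\<lambda>n. p n x) \<longlonglongrightarrow> indicator {0..1} x *\<^sub>R deriv (\<lambda>t. \<beta> (curve i t) x) 0" for x
  proof (cases "x \<in> {0..1}")
    case True
    have "((\<lambda>t. (\<beta> (curve i t) x - \<beta> hs x) / t) \<longlongrightarrow> deriv (\<lambda>t. \<beta> (curve i t) x) 0) (at 0)"
      using beta_has_derivative(1)[OF i True] by (simp add: DERIV_def curve_simps)
    moreover have "filterlim (\<lambda>n. s (n + n0)) (at 0) sequentially"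
      using LIMSEQ_ignore_initial_segment[OF s] by (auto simp: filterlim_at s_def)
    ultimately have "(\<lambda>n. (\<beta> (curve i (s (n + n0))) x - \<beta> hs x) / s (n + n0)) \<longlonglongrightarrow> deriv (\<lambda>t. \<beta> (curve i t) x) 0"
      by (rule filterlim_compose)
    then show ?thesis using True by (simp add: p_def)
  qed (simp add: p_def)
  ultimately show ?thesis unfolding set_borel_measurable_def by (rule borel_measurable_LIMSEQ_real[rotated])
qed

text \<open>Since \<open>(- 1) ^ N * Hd j\<close> is nearly \<open>- ((- 1) ^ j)\<close>, a tangent
  vector is up to sign and scale the difference of two kernel functions, and orthogonality compares
  their projections. The 10 consists of 3 from the correction, 4 from \<open>Hd\<close>, and twice
  3/2 from replacing \<open>DU\<close> by \<open>loc\<close>.\<close>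

lemma nearly_equal_projections:
  assumes H: "H1 v g" and orth: "\<And>i. i < N \<Longrightarrow> ip v (uxi_d \<epsilon> \<beta> H \<xi> i) = 0" and j: "j \<le> N"
  shows "\<bar>ip v (\<lambda>x. loc a (y j x)) - ip v (\<lambda>x. loc a (y N x))\<bar> \<le> 10 * \<tau> * sqrt (nsq v)"
proof (cases "j = N")
  case True
  then show ?thesis using tau_pos nsq_nonneg[of v] by simp
next
  case False
  then have i: "j < N" using j by simp
  define nv where "nv = sqrt (nsq v)"
  have nv: "0 \<le> nv" using nsq_nonneg[of v] by (simp add: nv_def)
  have cv: "continuous_on {0..1} v" by (rule H1_continuous_on[OF H])
  have cy: "continuous_on S (\<lambda>x. DU (y i x))" for S i
    using eps by (intro profile_continuous_intros continuous_intros) simp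
  define p where "p i = (LINT x:{0..1}|lborel. v x * DU (y i x))" for i
  define D where "D x = deriv (\<lambda>t. \<beta> (curve j t) x) 0" for x
  have E: "E \<le> \<tau>"
  proof -
    have "0 \<le> 2 * (real N + 1) * exp (- sqrt 2 * a)" by simp
    then show ?thesis using tau(1) by linarith
  qed
  have D: "\<bar>D x\<bar> \<le> 3 * \<tau>" if "x \<in> {0..1}" for x
  proof -
    have "\<bar>D x\<bar> \<le> E * (1 + \<bar>Hd j\<bar>)" unfolding D_def by (rule beta_has_derivative(2)[OF i that])
    also have "\<dots> \<le> \<tau> * 3" using E layers.E[OF layers_axioms] Hd_bounds(2)[OF i] by (intro mult_mono) auto
    finally show ?thesis by simp
  qed
  have iD: "set_integrable lborel {0..1} (\<lambda>x. D x * v x)"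
  proof (rule set_integrable_bound)
    show "set_integrable lborel {0..1} (\<lambda>x. 3 * \<tau> * v x)" by (intro set_integrable_continuous continuous_intros cv)
    have "(\<lambda>x. (indicator {0..1} x *\<^sub>R D x) * (indicator {0..1} x *\<^sub>R v x)) \<in> borel_measurable lborel"
      using beta_deriv_measurable[OF i] set_integrable_continuous[OF cv]
      unfolding set_borel_measurable_def set_integrable_def D_def by (intro borel_measurable_times) auto
    moreover have "(\<lambda>x. (indicator {0..1} x *\<^sub>R D x) * (indicator {0..1} x *\<^sub>R v x)) = (\<lambda>x. indicator {0..1} x *\<^sub>R (D x * v x))"
      by (auto simp: indicator_def)
    ultimately show "set_borel_measurable lborel {0..1} (\<lambda>x. D x * v x)" unfolding set_borel_measurable_def by simp
    show "AE x in lborel. x \<in> {0..1} \<longrightarrow> norm (D x * v x) \<le> norm (3 * \<tau> * v x)"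
      using D tau_pos by (intro AE_I2 impI) (simp add: abs_mult mult_right_mono)
  qed
  have pd: "\<bar>p i\<bar> \<le> 1 * nv" for i
  proof -
    have "\<bar>LINT x:{0..1}|lborel. DU (y i x) * v x\<bar> \<le> 1 * sqrt (nsq v)"
      using DU_pos DU_le_1 by (intro abs_integral_mult_le cv set_integrable_continuous continuous_intros cy) (auto simp: less_imp_le)
    then show ?thesis by (simp add: p_def nv_def mult.commute)
  qed
  have bp: "\<bar>p i - ip v (\<lambda>x. loc a (y i x))\<bar> \<le> 3 / 2 * \<tau> * nv" for i
  proof -
    have "p i - ip v (\<lambda>x. loc a (y i x)) = (LINT x:{0..1}|lborel. v x * DU (y i x) - v x * loc a (y i x))"
      unfolding p_def ip_def
      by (intro set_integral_diff(2)[symmetric] set_integrable_continuous continuous_intros cv cy continuous_on_loc_y)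
    also have "\<dots> = (LINT x:{0..1}|lborel. (DU (y i x) - loc a (y i x)) * v x)" by (simp add: algebra_simps)
    finally have "\<bar>p i - ip v (\<lambda>x. loc a (y i x))\<bar> = \<bar>\<dots>\<bar>" by simp
    also have "\<dots> \<le> 3 * exp (- sqrt 2 * a) * sqrt (nsq v)"
      by (intro abs_integral_mult_le cv set_integrable_continuous continuous_intros cy continuous_on_loc_y loc_approx_DU a)
    also have "\<dots> \<le> 3 / 2 * \<tau> * nv" unfolding nv_def[symmetric] using exp_le_tau nv by (intro mult_right_mono) auto
    finally show ?thesis .
  qed
  have "0 = (LINT x:{0..1}|lborel. (- ((- 1) ^ j) / \<epsilon>) * (v x * DU (y j x)) + (- ((- 1) ^ N * Hd j) / \<epsilon>) * (v x * DU (y N x)) + D x * v x)"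
  proof -
    have "ip v (uxi_d \<epsilon> \<beta> H \<xi> j) = (LINT x:{0..1}|lborel. (- ((- 1) ^ j) / \<epsilon>) * (v x * DU (y j x)) + (- ((- 1) ^ N * Hd j) / \<epsilon>) * (v x * DU (y N x)) + D x * v x)"
      unfolding ip_def
    proof (intro set_lebesgue_integral_cong ballI allI impI)
      fix x :: real assume x: "x \<in> {0..1}"
      show "v x * uxi_d \<epsilon> \<beta> H \<xi> j x = (- ((- 1) ^ j) / \<epsilon>) * (v x * DU (y j x)) + (- ((- 1) ^ N * Hd j) / \<epsilon>) * (v x * DU (y N x)) + D x * v x"
        unfolding uxi_d_eq[OF i x] D_def using eps by (simp add: field_simps)
    qed simp
    then show ?thesis using orth[OF i] by simp
  qed
  also have "\<dots> = (LINT x:{0..1}|lborel. (- ((- 1) ^ j) / \<epsilon>) * (v x * DU (y j x)) + (- ((- 1) ^ N * Hd j) / \<epsilon>) * (v x * DU (y N x))) + (LINT x:{0..1}|lborel. D x * v x)"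
    by (intro set_integral_add(2) iD set_integrable_continuous continuous_intros cv cy)
  also have "(LINT x:{0..1}|lborel. (- ((- 1) ^ j) / \<epsilon>) * (v x * DU (y j x)) + (- ((- 1) ^ N * Hd j) / \<epsilon>) * (v x * DU (y N x)))
      = (LINT x:{0..1}|lborel. (- ((- 1) ^ j) / \<epsilon>) * (v x * DU (y j x))) + (LINT x:{0..1}|lborel. (- ((- 1) ^ N * Hd j) / \<epsilon>) * (v x * DU (y N x)))"
    by (intro set_integral_add(2) set_integrable_continuous continuous_intros cv cy)
  finally have "0 = (- ((- 1) ^ j) / \<epsilon>) * p j + (- ((- 1) ^ N * Hd j) / \<epsilon>) * p N + (LINT x:{0..1}|lborel. D x * v x)"
    by (simp only: p_def set_integral_mult_right)
  then have bal: "(- 1) ^ j * p j + (- 1) ^ N * Hd j * p N = \<epsilon> * (LINT x:{0..1}|lborel. D x * v x)"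
    using eps by (simp add: field_simps)
  have "(- 1) ^ j * (p j - p N) = \<epsilon> * (LINT x:{0..1}|lborel. D x * v x) - ((- 1) ^ j + (- 1) ^ N * Hd j) * p N"
    unfolding bal[symmetric] by (simp add: algebra_simps)
  then have "\<bar>p j - p N\<bar> = \<bar>\<epsilon> * (LINT x:{0..1}|lborel. D x * v x) - ((- 1) ^ j + (- 1) ^ N * Hd j) * p N\<bar>"
    by (metis abs_mult abs_neg_one mult_1 power_abs power_one)
  also have "\<dots> \<le> \<bar>\<epsilon> * (LINT x:{0..1}|lborel. D x * v x)\<bar> + \<bar>((- 1) ^ j + (- 1) ^ N * Hd j) * p N\<bar>"
    by (rule abs_triangle_ineq4)
  also have "\<dots> \<le> 1 * (3 * \<tau> * nv) + 4 * \<tau> * (1 * nv)"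
    unfolding abs_mult[of \<epsilon>] abs_mult[of "(- 1) ^ j + (- 1) ^ N * Hd j"] nv_def
    using eps eps_le_1 tau_pos
    by (intro add_mono mult_mono Hd_bounds(1)[OF i] pd[unfolded nv_def] abs_integral_mult_le cv iD D) (auto simp: nsq_nonneg)
  finally have "\<bar>p j - p N\<bar> \<le> 7 * \<tau> * nv" by simp
  moreover have "3 * \<tau> * nv = 2 * (3 / 2 * \<tau> * nv)" "10 * \<tau> * nv = 7 * \<tau> * nv + 3 * \<tau> * nv" by (simp_all add: algebra_simps)
  ultimately show ?thesis using bp[of j] bp[of N] unfolding nv_def[symmetric] by linarith
qed

end

section \<open>The spectral bound\<close>

lemma exp_powr_negligible:
  fixes s \<kappa> :: real
  assumes "0 < s" "0 < \<kappa>"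
  shows "((\<lambda>\<epsilon>. exp (- s / \<epsilon> powr \<kappa>) / \<epsilon>\<^sup>2) \<longlongrightarrow> 0) (at_right 0)"
  using assms by real_asymp

lemma scales_eventually_small:
  fixes n K k \<kappa> B l lam d :: real
  assumes pos: "0 < n" "0 < k" "0 < K" "0 < \<kappa>" "0 < l" "0 < lam" "0 < d" "0 < B"
  defines "a \<equiv> \<lambda>\<epsilon>. 1 / (4 * rho \<kappa> \<epsilon>)"
  defines "\<tau> \<equiv> \<lambda>\<epsilon>. 2 * n * exp (- sqrt 2 * a \<epsilon>) + expsmall \<kappa> \<epsilon> K k"
  shows "eventually (\<lambda>\<epsilon>. 1 \<le> a \<epsilon> \<and> \<epsilon> \<le> 1 / 500 \<and> \<tau> \<epsilon> \<le> 1 / 100 \<and> 9 * \<tau> \<epsilon> \<le> l / 25 \<and> (B / a \<epsilon>)\<^sup>2 / (l / 100) \<le> l / 25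
    \<and> n * (10 * \<tau> \<epsilon>)\<^sup>2 \<le> \<epsilon> * d / 100 \<and> 48 * B * \<tau> \<epsilon> \<le> 2 / 5 * lam * \<epsilon>\<^sup>2 * d) (at_right 0)"
proof -
  have "((\<lambda>\<epsilon>. \<epsilon> powr \<kappa>) \<longlongrightarrow> 0) (at_right 0)" using pos by real_asymp
  then have r: "(rho \<kappa> \<longlongrightarrow> 0) (at_right 0)" by (simp add: rho_def[abs_def])
  have "((\<lambda>\<epsilon>. 2 * n * (exp (- (sqrt 2 / 4) / \<epsilon> powr \<kappa>) / \<epsilon>\<^sup>2) + K * (exp (- k / \<epsilon> powr \<kappa>) / \<epsilon>\<^sup>2)) \<longlongrightarrow> 2 * n * 0 + K * 0) (at_right 0)"
    using pos by (intro tendsto_intros exp_powr_negligible) auto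
  then have t: "((\<lambda>\<epsilon>. \<tau> \<epsilon> / \<epsilon>\<^sup>2) \<longlongrightarrow> 0) (at_right 0)"
    by (simp add: \<tau>_def a_def rho_def expsmall_def add_divide_distrib)
  \<comment> \<open>One threshold for each demand on \<open>\<tau>\<close>, in the order of the
    conclusion; all four follow from
    \<open>\<tau> \<epsilon> \<le> \<eta> * \<epsilon>\<^sup>2\<close> and
    \<open>\<epsilon> < 1\<close>.\<close>
  define \<eta> where "\<eta> = Min {1 / 100, l / 225, d / (10000 * n), 2 / 5 * lam * d / (48 * B)}"
  have \<eta>: "0 < \<eta>" using pos by (simp add: \<eta>_def)
  have \<eta>_le: "\<eta> \<le> 1 / 100" "\<eta> \<le> l / 225" "\<eta> \<le> d / (10000 * n)" "\<eta> \<le> 2 / 5 * lam * d / (48 * B)"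
    by (simp_all add: \<eta>_def)
  \<comment> \<open>The bound 1/4 gives \<open>1 \<le> a \<epsilon>\<close>; the other gives
    \<open>B / a \<epsilon> \<le> l / 50\<close>, whose square over \<open>l / 100\<close> is
    \<open>l / 25\<close>.\<close>
  have e1: "eventually (\<lambda>\<epsilon>. \<bar>rho \<kappa> \<epsilon>\<bar> < min (1 / 4) (l / (200 * B))) (at_right 0)"
  proof -
    have "0 < min (1 / 4) (l / (200 * B))" using pos by simp
    then show ?thesis using tendstoD[OF r] unfolding dist_real_def diff_0_right by blast
  qed
  have e2: "eventually (\<lambda>\<epsilon>. \<bar>\<tau> \<epsilon> / \<epsilon>\<^sup>2\<bar> < \<eta>) (at_right 0)"
    using t \<eta> by (auto simp: tendsto_iff dist_real_def)
  have e3: "eventually (\<lambda>\<epsilon>. \<epsilon> \<in> {0 <..< 1 / 500}) (at_right (0::real))" by (rule eventually_at_right_real) simp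
  show ?thesis using e1 e2 e3
  proof eventually_elim
    case (elim \<epsilon>)
    then have e: "0 < \<epsilon>" "\<epsilon> < 1 / 500" by auto
    have rp: "0 < rho \<kappa> \<epsilon>" using e by (simp add: rho_def)
    have rs: "rho \<kappa> \<epsilon> < 1 / 4" "rho \<kappa> \<epsilon> < l / (200 * B)" using elim(1) rp by auto
    have tp: "0 \<le> \<tau> \<epsilon>" using pos by (simp add: \<tau>_def expsmall_def)
    have te: "\<tau> \<epsilon> \<le> \<eta> * \<epsilon>\<^sup>2" using elim(2) e tp by (simp add: field_simps)
    have e2: "\<epsilon>\<^sup>2 \<le> 1" using e by (intro power_le_one) auto
    have "\<eta> * \<epsilon>\<^sup>2 \<le> \<eta> * 1" using \<eta> e2 by (intro mult_left_mono) auto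
    then have tau: "\<tau> \<epsilon> \<le> \<eta>" using te by simp
    have "(B / a \<epsilon>)\<^sup>2 \<le> (l / 50)\<^sup>2"
    proof (intro power_mono)
      have "rho \<kappa> \<epsilon> * (200 * B) < l" using rs(2) pos by (simp add: field_simps)
      then show "B / a \<epsilon> \<le> l / 50" by (simp add: a_def field_simps)
    qed (use pos rp in \<open>simp add: a_def\<close>)
    then have "(B / a \<epsilon>)\<^sup>2 / (l / 100) \<le> (l / 50)\<^sup>2 / (l / 100)" using pos by (intro divide_right_mono) auto
    also have "\<dots> = l / 25" using pos by (simp add: power2_eq_square)
    finally have 5: "(B / a \<epsilon>)\<^sup>2 / (l / 100) \<le> l / 25" .
    have "(\<tau> \<epsilon>)\<^sup>2 = \<tau> \<epsilon> * \<tau> \<epsilon>" by (simp add: power2_eq_square)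
    also have "\<dots> \<le> (\<eta> * \<epsilon>\<^sup>2) * 1" using te tau \<eta>_le(1) tp \<eta> by (intro mult_mono) auto
    also have "\<dots> \<le> d / (10000 * n) * \<epsilon>"
      unfolding mult_1_right
    proof (intro mult_mono \<eta>_le)
      show "\<epsilon>\<^sup>2 \<le> \<epsilon>" using e by (simp add: power2_eq_square mult_left_le_one_le)
    qed (use pos in auto)
    finally have "n * (100 * (\<tau> \<epsilon>)\<^sup>2) \<le> n * (100 * (d / (10000 * n) * \<epsilon>))" using pos by (intro mult_left_mono) auto
    then have 6: "n * (10 * \<tau> \<epsilon>)\<^sup>2 \<le> \<epsilon> * d / 100" using pos by (simp add: power_mult_distrib field_simps)
    have "\<tau> \<epsilon> \<le> 2 / 5 * lam * d / (48 * B) * \<epsilon>\<^sup>2" using te \<eta>_le(4) by (meson mult_right_mono order_trans zero_le_power2)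
    then have 7: "48 * B * \<tau> \<epsilon> \<le> 2 / 5 * lam * \<epsilon>\<^sup>2 * d" using pos by (simp add: field_simps)
    show ?case using 5 6 7 tau \<eta>_le e rp rs by (auto simp: a_def field_simps)
  qed
qed

theorem theorem4p4:
  fixes N :: nat and \<mu> lam0 :: real
  assumes "N \<ge> 1" and "-1 < \<mu>" and "\<mu> < 1" and "lam0 > 0" and "lambda0_prop lam0"
  shows "\<exists>\<kappa>bar>0. \<forall>\<kappa>0 K k. 0 < \<kappa>0 \<and> \<kappa>0 < \<kappa>bar \<and> 0 < K \<and> 0 < k \<longrightarrow>
     (\<exists>C c \<epsilon>0. 0 < c \<and> 0 < \<epsilon>0 \<and>
       (\<forall>\<epsilon> \<beta> H \<xi> v g. 0 < \<epsilon> \<and> \<epsilon> < \<epsilon>0 \<and>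
          beta_ok N \<kappa>0 K k \<epsilon> \<beta> \<and> mass_map N \<kappa>0 \<mu> \<epsilon> \<beta> H \<and>
          length \<xi> = N \<and> Omega N \<kappa>0 \<epsilon> (\<xi> @ [H \<xi>]) \<and>
          H1 v g \<and> (LINT x:{0..1}|lborel. v x) = 0 \<and>
          (\<forall>i<N. ip v (uxi_d \<epsilon> \<beta> H \<xi> i) = 0) \<longrightarrow>
          Lform \<epsilon> (uxi \<epsilon> \<beta> H \<xi>) v g
            \<le> (- lam0 * \<epsilon> + C * exp (- c / rho \<kappa>0 \<epsilon>)) * nsq v))"
proof (rule exI[of _ 1], intro conjI allI impI)
  fix \<kappa>0 K k :: real
  assume "0 < \<kappa>0 \<and> \<kappa>0 < 1 \<and> 0 < K \<and> 0 < k"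
  then have pos: "0 < \<kappa>0" "0 < K" "0 < k" by auto
  obtain B where B: "1 \<le> B" "\<And>s. \<bar>bump1 s\<bar> \<le> B" "\<And>s. \<bar>bump2 s\<bar> \<le> B"
    using bump_derivatives_bounded by blast
  define l where "l = min 1 lam0"
  have l: "0 < l" "l \<le> 1" using assms(4) by (simp_all add: l_def)
  \<comment> \<open>Makes the prescribed gap \<open>\<epsilon> / rho \<kappa>0 \<epsilon>\<close>
    equal to \<open>4 * a \<epsilon> * \<epsilon>\<close>, the separation required for disjoint
    cutoffs.\<close>
  define a where "a \<epsilon> = 1 / (4 * rho \<kappa>0 \<epsilon>)" for \<epsilon>
  define \<tau> where "\<tau> \<epsilon> = 2 * (real N + 1) * exp (- sqrt 2 * a \<epsilon>) + expsmall \<kappa>0 \<epsilon> K k" for \<epsilon>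
  have "eventually (\<lambda>\<epsilon>. 1 \<le> a \<epsilon> \<and> \<epsilon> \<le> 1 / 500 \<and> \<tau> \<epsilon> \<le> 1 / 100 \<and> 9 * \<tau> \<epsilon> \<le> l / 25 \<and> (B / a \<epsilon>)\<^sup>2 / (l / 100) \<le> l / 25
    \<and> (real N + 1) * (10 * \<tau> \<epsilon>)\<^sup>2 \<le> \<epsilon> * (DU 1)\<^sup>2 / 100 \<and> 48 * B * \<tau> \<epsilon> \<le> 2 / 5 * lam0 * \<epsilon>\<^sup>2 * (DU 1)\<^sup>2) (at_right 0)"
    unfolding a_def \<tau>_def using pos l B(1) assms(4) DU_pos[of 1] by (intro scales_eventually_small) auto
  then obtain \<epsilon>0 where \<epsilon>0: "0 < \<epsilon>0" and small: "\<And>\<epsilon>. 0 < \<epsilon> \<Longrightarrow> \<epsilon> < \<epsilon>0 \<Longrightarrow>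
      1 \<le> a \<epsilon> \<and> \<epsilon> \<le> 1 / 500 \<and> \<tau> \<epsilon> \<le> 1 / 100 \<and> 9 * \<tau> \<epsilon> \<le> l / 25 \<and> (B / a \<epsilon>)\<^sup>2 / (l / 100) \<le> l / 25
    \<and> (real N + 1) * (10 * \<tau> \<epsilon>)\<^sup>2 \<le> \<epsilon> * (DU 1)\<^sup>2 / 100 \<and> 48 * B * \<tau> \<epsilon> \<le> 2 / 5 * lam0 * \<epsilon>\<^sup>2 * (DU 1)\<^sup>2"
    unfolding eventually_at_right_field by blast
  show "\<exists>C c \<epsilon>0. 0 < c \<and> 0 < \<epsilon>0 \<and>
       (\<forall>\<epsilon> \<beta> H \<xi> v g. 0 < \<epsilon> \<and> \<epsilon> < \<epsilon>0 \<and>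
          beta_ok N \<kappa>0 K k \<epsilon> \<beta> \<and> mass_map N \<kappa>0 \<mu> \<epsilon> \<beta> H \<and>
          length \<xi> = N \<and> Omega N \<kappa>0 \<epsilon> (\<xi> @ [H \<xi>]) \<and>
          H1 v g \<and> (LINT x:{0..1}|lborel. v x) = 0 \<and>
          (\<forall>i<N. ip v (uxi_d \<epsilon> \<beta> H \<xi> i) = 0) \<longrightarrow>
          Lform \<epsilon> (uxi \<epsilon> \<beta> H \<xi>) v g
            \<le> (- lam0 * \<epsilon> + C * exp (- c / rho \<kappa>0 \<epsilon>)) * nsq v)"
  \<comment> \<open>\<open>C = 0\<close> is possible because the surplus in the coefficient of
    \<open>\<epsilon>\<close> has absorbed all exponentially small errors; of \<open>c\<close> only
    positivity is then asked.\<close>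
  proof (rule exI[of _ 0], rule exI[of _ 1], rule exI[of _ \<epsilon>0], intro conjI allI impI \<epsilon>0)
    fix \<epsilon> \<beta> H \<xi> v g
    assume A: "0 < \<epsilon> \<and> \<epsilon> < \<epsilon>0 \<and>
          beta_ok N \<kappa>0 K k \<epsilon> \<beta> \<and> mass_map N \<kappa>0 \<mu> \<epsilon> \<beta> H \<and>
          length \<xi> = N \<and> Omega N \<kappa>0 \<epsilon> (\<xi> @ [H \<xi>]) \<and>
          H1 v g \<and> (LINT x:{0..1}|lborel. v x) = 0 \<and>
          (\<forall>i<N. ip v (uxi_d \<epsilon> \<beta> H \<xi> i) = 0)"
    then have e: "0 < \<epsilon>" and beta: "beta_ok N \<kappa>0 K k \<epsilon> \<beta>" and mass: "mass_map N \<kappa>0 \<mu> \<epsilon> \<beta> H"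
      and len: "length \<xi> = N" and omega: "Omega N \<kappa>0 \<epsilon> (\<xi> @ [H \<xi>])" and H: "H1 v g"
      and mean: "(LINT x:{0..1}|lborel. v x) = 0" and orth: "\<And>i. i < N \<Longrightarrow> ip v (uxi_d \<epsilon> \<beta> H \<xi> i) = 0"
      by blast+
    have sm: "1 \<le> a \<epsilon>" "\<epsilon> \<le> 1 / 500" "\<tau> \<epsilon> \<le> 1 / 100" "9 * \<tau> \<epsilon> \<le> l / 25" "(B / a \<epsilon>)\<^sup>2 / (l / 100) \<le> l / 25"
      "(real N + 1) * (10 * \<tau> \<epsilon>)\<^sup>2 \<le> \<epsilon> * (DU 1)\<^sup>2 / 100" "48 * B * \<tau> \<epsilon> \<le> 2 / 5 * lam0 * \<epsilon>\<^sup>2 * (DU 1)\<^sup>2"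
      using small[of \<epsilon>] A by blast+
    have gap: "\<epsilon> / rho \<kappa>0 \<epsilon> = 4 * a \<epsilon> * \<epsilon>" by (simp add: a_def)
    have gap0: "0 \<le> \<epsilon> / rho \<kappa>0 \<epsilon>" using e by (simp add: rho_def)
    note sep = Omega_separated[OF omega gap0, unfolded gap]
    have \<beta>: "\<beta> (\<xi> @ [H \<xi>]) differentiable (at x)" for x
      using beta omega unfolding beta_ok_def by blast
    interpret layer_manifold N \<xi> H "a \<epsilon>" \<epsilon> "expsmall \<kappa>0 \<epsilon> K k" "\<tau> \<epsilon>" B \<beta> \<kappa>0 K k \<mu>
    proof
      show "4 * a \<epsilon> * \<epsilon> \<le> (\<xi> @ [H \<xi>]) ! j - (\<xi> @ [H \<xi>]) ! i" if "i < j" "j \<le> N" for i j using sep(1)[OF that] .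
      show "2 * a \<epsilon> * \<epsilon> \<le> (\<xi> @ [H \<xi>]) ! 0" using sep(2) by (simp add: algebra_simps)
      show "2 * a \<epsilon> * \<epsilon> \<le> 1 - (\<xi> @ [H \<xi>]) ! N" using sep(3) by (simp add: algebra_simps)
      have uxi: "uxi \<epsilon> \<beta> H \<xi> x = (\<Sum>j\<le>N. (- 1) ^ j * U ((x - (\<xi> @ [H \<xi>]) ! j) / \<epsilon>)) + \<beta> (\<xi> @ [H \<xi>]) x" for x
        using len by (simp add: uxi_def uh_def lessThan_Suc_atMost)
      show "continuous_on {0..1} (uxi \<epsilon> \<beta> H \<xi>)" unfolding uxi[abs_def]
        using e differentiable_imp_continuous_within[OF \<beta>]
        by (intro continuous_intros profile_continuous_intros continuous_at_imp_continuous_on ballI) auto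
      show "\<bar>uxi \<epsilon> \<beta> H \<xi> x - ((\<Sum>j\<le>N. (- 1) ^ j * U ((x - (\<xi> @ [H \<xi>]) ! j) / \<epsilon>)) + bN N)\<bar> \<le> expsmall \<kappa>0 \<epsilon> K k"
        if "x \<in> {0..1}" for x
        using beta omega that unfolding uxi beta_ok_def by simp
      show "0 \<le> expsmall \<kappa>0 \<epsilon> K k" using pos by (simp add: expsmall_def)
      show "2 * (real N + 1) * exp (- sqrt 2 * a \<epsilon>) + expsmall \<kappa>0 \<epsilon> K k \<le> \<tau> \<epsilon>" by (simp add: \<tau>_def)
    qed (use e sm B omega beta mass len in auto)
    have "Lform \<epsilon> (uxi \<epsilon> \<beta> H \<xi>) v g \<le> - lam0 * \<epsilon> * nsq v"
    proof (rule Lform_le[OF assms(1,5,4) H mean nearly_equal_projections[OF H orth] _ _ sm(2,6,7)])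
      show "0 < l / 100" using l by simp
      \<comment> \<open>With \<open>\<delta> = l / 100\<close> and \<open>l \<le> 1\<close> the
        budget is 1.01 times 0.98, that is 0.9898, just below 0.99.\<close>
      have "(1 + l / 100) * (9 * \<tau> \<epsilon> + (B / a \<epsilon>)\<^sup>2 / (l / 100) + 9 / 10 * l) \<le> (101 / 100) * (l / 25 + l / 25 + 9 / 10 * l)"
        using l sm(4,5) tau_pos by (intro mult_mono add_mono) auto
      also have "\<dots> \<le> l - l / 100" using l by simp
      finally show "(1 + l / 100) * (9 * \<tau> \<epsilon> + (B / a \<epsilon>)\<^sup>2 / (l / 100) + 9 / 10 * min 1 lam0) \<le> min 1 lam0 - l / 100"
        by (simp add: l_def)
    qed
    then show "Lform \<epsilon> (uxi \<epsilon> \<beta> H \<xi>) v g \<le> (- lam0 * \<epsilon> + 0 * exp (- 1 / rho \<kappa>0 \<epsilon>)) * nsq v" by simp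
  qed simp
qed simp

end
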